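(* Suppose a connected closed 3-manifold $M$ has a triangulation with $n$ tetrahedra. Then $sc(M)\leqslant 4n$.
   Context: The differentiable, piecewise linear and topological viewpoints are freely intermingled. A triangulation of $M$ is a presentation of $M$ as a finite union of tetrahedra glued along their faces (self-adjacencies and multiple adjacencies are allowed). A Dehn surface of $M$ is a subset $\Sigma\subset M$ such that $\Sigma=f(S)$ for some (possibly non-connected) closed surface $S$ and some transverse (normal crossing) immersion $f\colon S\to M$. Each point of $\Sigma$ has 1, 2 or 3 preimages; points with 3 preimages are called triple points, and their set is denoted $T(\Sigma)$. A Dehn surface $\Sigma$ is quasi-filling if every component of $M\setminus\Sigma$ is an (open) ball. The surface-complexity $sc(M)$ is the minimum of $|T(\Sigma)|$ over all quasi-filling Dehn surfaces $\Sigma$ of $M$. *)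

theory Defs
  imports "HOL-Analysis.Analysis" "HOL-Homology.Homology" "HOL-Library.Extended_Nat" "HOL-Combinatorics.Permutations"
begin

section \<open>Closed manifolds\<close>

definition closed_manifold :: "nat \<Rightarrow> 'a topology \<Rightarrow> bool" where
  "closed_manifold d M \<longleftrightarrow>
     compact_space M \<and> Hausdorff_space M \<and> second_countable M \<and>
     (\<forall>p \<in> topspace M. \<exists>U. openin M U \<and> p \<in> U \<and>
        subtopology M U homeomorphic_space Euclidean_space d)"


section \<open>Triangulations by glued tetrahedra\<close>

definition tetrahedra :: "nat \<Rightarrow> (nat \<times> (nat \<Rightarrow> real)) topology" where
  "tetrahedra n =
     sum_topology (\<lambda>_. subtopology (powertop_real UNIV) (standard_simplex 3)) {..<n}"

text \<open>
  Face \<open>i\<close> of a tetrahedron is the one opposite to vertex \<open>i\<close>, that is \<open>x i = 0\<close> in barycentric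
  coordinates. The value \<open>G (a, i) = (b, \<sigma>)\<close> says that face \<open>i\<close> of tetrahedron \<open>a\<close> is glued to
  face \<open>\<sigma> i\<close> of tetrahedron \<open>b\<close> by the affine map that sends each vertex \<open>j \<noteq> i\<close> of \<open>a\<close> to the
  vertex \<open>\<sigma> j\<close> of \<open>b\<close>. The case \<open>a = b\<close> and several gluings between the same two tetrahedra are
  possible; only the gluing of a face to itself is excluded. Every face is glued, as the space
  to be presented has no boundary.
\<close>

type_synonym gluing = "nat \<times> nat \<Rightarrow> nat \<times> (nat \<Rightarrow> nat)"

definition face_pairing :: "nat \<Rightarrow> gluing \<Rightarrow> bool" where
  "face_pairing n G \<longleftrightarrow>
     (\<forall>a < n. \<forall>i \<le> 3. \<forall>b \<sigma>. G (a, i) = (b, \<sigma>) \<longrightarrow>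
        b < n \<and> \<sigma> permutes {..3} \<and> (b, \<sigma> i) \<noteq> (a, i) \<and> G (b, \<sigma> i) = (a, inv_into UNIV \<sigma>))"

definition glued_points :: "nat \<Rightarrow> gluing \<Rightarrow> nat \<times> (nat \<Rightarrow> real) \<Rightarrow> nat \<times> (nat \<Rightarrow> real) \<Rightarrow> bool" where
  "glued_points n G u v \<longleftrightarrow>
     (\<exists>a i x b \<sigma> y. u = (a, x) \<and> v = (b, y) \<and> a < n \<and> i \<le> 3 \<and> G (a, i) = (b, \<sigma>) \<and>
        x \<in> standard_simplex 3 \<and> x i = 0 \<and> x = y \<circ> \<sigma>)"

definition has_triangulation :: "'a topology \<Rightarrow> nat \<Rightarrow> bool" where
  "has_triangulation M n \<longleftrightarrow>
     (\<exists>G q. face_pairing n G \<and> quotient_map (tetrahedra n) M q \<and>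
        (\<forall>u \<in> topspace (tetrahedra n). \<forall>v \<in> topspace (tetrahedra n).
           q u = q v \<longleftrightarrow> equivclp (glued_points n G) u v))"


section \<open>Dehn surfaces\<close>

text \<open>
  A transverse immersion of a closed surface into a 3-manifold: around each point \<open>p\<close> there is a
  chart centred at \<open>p\<close> in which the image of the surface consists of \<open>k \<le> 3\<close> of the coordinate
  planes, and the part of the surface over the chart is the disjoint union of \<open>k\<close> open sheets,
  mapped homeomorphically onto these planes. So \<open>k\<close> is the number of preimages of \<open>p\<close>.
\<close>

definition crossing_chart ::
  "'b topology \<Rightarrow> 'a topology \<Rightarrow> ('b \<Rightarrow> 'a) \<Rightarrow> 'a \<Rightarrow>
     'a set \<Rightarrow> ('a \<Rightarrow> nat \<Rightarrow> real) \<Rightarrow> nat \<Rightarrow> (nat \<Rightarrow> 'b set) \<Rightarrow> bool" where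
  "crossing_chart S M f p U \<phi> k W \<longleftrightarrow>
     openin M U \<and> p \<in> U \<and>
     homeomorphic_map (subtopology M U) (Euclidean_space 3) \<phi> \<and> \<phi> p = (\<lambda>_. 0) \<and>
     k \<le> 3 \<and>
     {s \<in> topspace S. f s \<in> U} = (\<Union>i<k. W i) \<and> disjoint_family_on W {..<k} \<and>
     (\<forall>i<k. openin S (W i) \<and>
        homeomorphic_map (subtopology S (W i))
          (subtopology (Euclidean_space 3) {x. x i = 0}) (\<phi> \<circ> f))"

definition transverse_immersion :: "'b topology \<Rightarrow> 'a topology \<Rightarrow> ('b \<Rightarrow> 'a) \<Rightarrow> bool" where
  "transverse_immersion S M f \<longleftrightarrow>
     continuous_map S M f \<and>
     (\<forall>p \<in> topspace M. \<exists>U \<phi> k W. crossing_chart S M f p U \<phi> k W)"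

definition triple_points :: "'b topology \<Rightarrow> ('b \<Rightarrow> 'a) \<Rightarrow> 'a set" where
  "triple_points S f = {p. card {s \<in> topspace S. f s = p} = 3}"

definition open_ball3 :: "(nat \<Rightarrow> real) topology" where
  "open_ball3 = subtopology (Euclidean_space 3) {x. (\<Sum>i<3. x i ^ 2) < 1}"

definition quasi_filling :: "'a topology \<Rightarrow> 'a set \<Rightarrow> bool" where
  "quasi_filling M \<Sigma> \<longleftrightarrow>
     (\<forall>C \<in> connected_components_of (subtopology M (topspace M - \<Sigma>)).
        subtopology M C homeomorphic_space open_ball3)"

text \<open>
  The Dehn surface is \<open>\<Sigma> = f ` topspace S\<close>, given together with a parametrization. Whether a point
  is triple can be read off \<open>\<Sigma>\<close> near it (\<open>k\<close> coordinate planes cut space into \<open>2 ^ k\<close> pieces), so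
  the number of triple points depends on \<open>\<Sigma>\<close> only.
  The carrier type \<^typ>\<open>real\<close> of \<open>S\<close> is only a supply of points, its usual topology plays no role;
  lemma \<open>closed_surface_on_reals\<close> below shows that surfaces on other types give nothing new.
\<close>

definition dehn_surface :: "'a topology \<Rightarrow> real topology \<Rightarrow> (real \<Rightarrow> 'a) \<Rightarrow> 'a set \<Rightarrow> bool" where
  "dehn_surface M S f \<Sigma> \<longleftrightarrow>
     closed_manifold 2 S \<and> transverse_immersion S M f \<and> \<Sigma> = f ` topspace S"

text \<open>
  The values are extended naturals so that the minimum would be \<open>\<infinity>\<close>, not \<open>0\<close>, if there were no
  quasi-filling Dehn surface. The sets of triple points are finite (\<open>finite_triple_points\<close>
  below), so that \<open>card\<close> counts them.
\<close>

definition surface_complexity :: "'a topology \<Rightarrow> enat" where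
  "surface_complexity M =
     Inf {enat (card (triple_points S f)) | S f \<Sigma>. dehn_surface M S f \<Sigma> \<and> quasi_filling M \<Sigma>}"


section \<open>Sanity checks\<close>

lemma finite_triple_points:
  assumes "compact_space M" "transverse_immersion S M f"
  shows "finite (triple_points S f)"
proof -
  have "\<exists>U. openin M U \<and> p \<in> U \<and> finite (U \<inter> triple_points S f)" if p: "p \<in> topspace M" for p
  proof -
    obtain U \<phi> k W where ch: "crossing_chart S M f p U \<phi> k W"
      using assms(2) p unfolding transverse_immersion_def by blast
    have U: "openin M U" "p \<in> U"
      and phi: "homeomorphic_map (subtopology M U) (Euclidean_space 3) \<phi>" "\<phi> p = (\<lambda>_. 0)"
      and k: "k \<le> 3"
      and W: "{s \<in> topspace S. f s \<in> U} = (\<Union>i<k. W i)"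
      using ch by (simp_all add: crossing_chart_def)
    have hW: "openin S (W i)"
        "homeomorphic_map (subtopology S (W i))
           (subtopology (Euclidean_space 3) {x. x i = 0}) (\<phi> \<circ> f)" if "i < k" for i
      using ch that by (simp_all add: crossing_chart_def)
    have injphi: "inj_on \<phi> U"
      using phi(1) openin_subset[OF U(1)]
      by (metis homeomorphic_imp_injective_map topspace_subtopology_subset)
    have "q = p" if q: "q \<in> U" "q \<in> triple_points S f" for q
    proof -
      let ?A = "{s \<in> topspace S. f s = q}"
      have c3: "card ?A = 3" using q by (simp add: triple_points_def)
      have "\<exists>i. i < k \<and> s \<in> W i" if "s \<in> ?A" for s
      proof -
        have "s \<in> {s \<in> topspace S. f s \<in> U}" using that q by auto
        then show ?thesis unfolding W by auto
      qed
      then obtain ix where ix: "ix s < k" "s \<in> W (ix s)" if "s \<in> ?A" for s by metis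
      have topW: "topspace (subtopology S (W i)) = W i" if "i < k" for i
        using openin_subset[OF hW(1)[OF that]] by auto
      have inj: "inj_on ix ?A"
      proof (rule inj_onI)
        fix s t assume s: "s \<in> ?A" and t: "t \<in> ?A" and e: "ix s = ix t"
        have inj: "inj_on (\<phi> \<circ> f) (W (ix s))"
          using homeomorphic_imp_injective_map[OF hW(2)[OF ix(1)[OF s]]] topW[OF ix(1)[OF s]]
          by simp
        have eq: "(\<phi> \<circ> f) s = (\<phi> \<circ> f) t" using s t by simp
        have "t \<in> W (ix s)" using ix(2)[OF t] e by simp
        then show "s = t" by (rule inj_onD[OF inj eq ix(2)[OF s]])
      qed
      have c: "card (ix ` ?A) = 3" using inj c3 by (simp add: card_image)
      have sb: "ix ` ?A \<subseteq> {..<k}" using ix(1) by blast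
      have k3: "k = 3" using card_mono[OF finite_lessThan sb] c k by simp
      have im: "ix ` ?A = {..<k}" using card_subset_eq[OF finite_lessThan sb] c k3 by simp
      have z: "\<phi> q i = 0" if i: "i < 3" for i
      proof -
        have "i \<in> ix ` ?A" using im k3 i by simp
        then obtain s where s: "s \<in> ?A" "i = ix s" by (rule imageE)
        have ik: "i < k" using i k3 by simp
        have "(\<phi> \<circ> f) ` W i = topspace (subtopology (Euclidean_space 3) {x. x i = 0})"
          using homeomorphic_imp_surjective_map[OF hW(2)[OF ik]] topW[OF ik] by simp
        moreover have "s \<in> W i" using ix(2)[OF s(1)] s(2) by simp
        ultimately have "(\<phi> \<circ> f) s \<in> topspace (subtopology (Euclidean_space 3) {x. x i = 0})"
          by blast
        then show ?thesis using s(1) by simp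
      qed
      have "\<phi> q \<in> topspace (Euclidean_space 3)"
        using phi(1) q(1) openin_subset[OF U(1)] homeomorphic_imp_surjective_map
        by (metis imageI topspace_subtopology_subset)
      then have "\<phi> q = (\<lambda>_. 0)"
        using z by (auto simp: topspace_Euclidean_space fun_eq_iff not_less[symmetric])
      then show "q = p" using injphi phi(2) U(2) q(1) by (simp add: inj_on_def)
    qed
    then have "U \<inter> triple_points S f \<subseteq> {p}" by auto
    then show ?thesis using U finite_subset by blast
  qed
  then obtain U where U: "\<And>p. p \<in> topspace M \<Longrightarrow> openin M (U p) \<and> p \<in> U p \<and> finite (U p \<inter> triple_points S f)"
    by metis
  have "compactin M (topspace M)" using assms(1) by (simp add: compact_space_def)
  moreover have "\<And>V. V \<in> U ` topspace M \<Longrightarrow> openin M V" using U by auto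
  moreover have "topspace M \<subseteq> \<Union>(U ` topspace M)" using U by auto
  ultimately obtain \<F> where F: "finite \<F>" "\<F> \<subseteq> U ` topspace M" "topspace M \<subseteq> \<Union>\<F>"
    by (rule compactinD[THEN exE]) auto
  have "triple_points S f \<subseteq> topspace M"
  proof
    fix p assume "p \<in> triple_points S f"
    then have "{s \<in> topspace S. f s = p} \<noteq> {}" unfolding triple_points_def by force
    then show "p \<in> topspace M"
      using assms(2) continuous_map_image_subset_topspace unfolding transverse_immersion_def by fastforce
  qed
  then have "triple_points S f \<subseteq> (\<Union>V\<in>\<F>. V \<inter> triple_points S f)" using F by auto
  moreover have "finite (\<Union>V\<in>\<F>. V \<inter> triple_points S f)"
    using F(1,2) U by (intro finite_UN_I) auto
  ultimately show ?thesis by (rule finite_subset)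
qed

lemma closed_manifold_homeomorphic:
  assumes "closed_manifold d X" "homeomorphic_map X Y g"
  shows "closed_manifold d Y"
proof -
  have hom: "X homeomorphic_space Y" using assms(2) by (rule homeomorphic_map_imp_homeomorphic_space)
  have "\<exists>V. openin Y V \<and> y \<in> V \<and> subtopology Y V homeomorphic_space Euclidean_space d"
    if y: "y \<in> topspace Y" for y
  proof -
    obtain x where x: "x \<in> topspace X" "y = g x"
      using assms(2) y homeomorphic_imp_surjective_map by blast
    obtain U where U: "openin X U" "x \<in> U" "subtopology X U homeomorphic_space Euclidean_space d"
      using assms(1) x unfolding closed_manifold_def by blast
    have "openin Y (g ` U)"
      using assms(2) U(1) homeomorphic_map_openness openin_subset by metis
    moreover have "homeomorphic_map (subtopology X U) (subtopology Y (g ` U)) g"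
      using assms(2) U(1) openin_subset[OF U(1)] openin_subset[OF \<open>openin Y (g ` U)\<close>]
      by (intro homeomorphic_map_subtopologies) (simp_all add: Int_absorb1 Int_absorb2)
    ultimately show ?thesis
      using U x by (meson homeomorphic_map_imp_homeomorphic_space homeomorphic_space_sym
          homeomorphic_space_trans imageI)
  qed
  moreover have "compact_space Y" "Hausdorff_space Y" "second_countable Y"
    using assms(1) hom unfolding closed_manifold_def
    by (auto simp: homeomorphic_compact_space homeomorphic_Hausdorff_space homeomorphic_space_second_countability)
  ultimately show ?thesis unfolding closed_manifold_def by blast
qed

lemma closed_surface_on_reals:
  fixes S :: "'b topology" and f :: "'b \<Rightarrow> 'a"
  assumes S: "closed_manifold 2 S" and f: "transverse_immersion S M f"
  obtains S' :: "real topology" and f'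
    where "dehn_surface M S' f' (f ` topspace S)" "triple_points S' f' = triple_points S f"
proof -
  obtain B where B: "countable B" "\<And>V. V \<in> B \<Longrightarrow> openin S V"
    "\<And>U x. openin S U \<Longrightarrow> x \<in> U \<Longrightarrow> \<exists>V \<in> B. x \<in> V \<and> V \<subseteq> U"
    using S unfolding closed_manifold_def second_countable_def by metis
  let ?c = "\<lambda>x. to_nat_on B ` {V \<in> B. x \<in> V}"
  have sep: "\<exists>V \<in> B. x \<in> V \<and> y \<notin> V" if "x \<in> topspace S" "y \<in> topspace S" "x \<noteq> y" for x y
  proof -
    have "\<exists>U V. openin S U \<and> openin S V \<and> x \<in> U \<and> y \<in> V \<and> disjnt U V"
      using S that unfolding closed_manifold_def Hausdorff_space_def by blast
    then obtain U V where UV: "openin S U" "x \<in> U" "y \<in> V" "disjnt U V" by blast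
    then show ?thesis using B(3)[OF UV(1,2)] by (auto simp: disjnt_def)
  qed
  have injc: "inj_on ?c (topspace S)"
  proof (rule inj_onI, rule ccontr)
    fix x y assume xy: "x \<in> topspace S" "y \<in> topspace S" "?c x = ?c y" "x \<noteq> y"
    then obtain V where V: "V \<in> B" "x \<in> V" "y \<notin> V" using sep by metis
    then have "to_nat_on B V \<in> ?c y" using xy(3) by blast
    then obtain V' where "V' \<in> B" "y \<in> V'" "to_nat_on B V = to_nat_on B V'" by auto
    then show False using V B(1) by (metis inj_on_to_nat_on inj_onD)
  qed
  obtain e :: "nat set \<Rightarrow> real" where e: "bij_betw e UNIV UNIV"
    using nat_sets_eqpoll_reals unfolding eqpoll_def by blast
  define g where "g = e \<circ> ?c"
  have injg: "inj_on g (topspace S)"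
    unfolding g_def using injc e by (intro comp_inj_on) (auto simp: bij_betw_def inj_on_def)
  define h where "h = inv_into (topspace S) g"
  define S' where "S' = pullback_topology (g ` topspace S) h S"
  have hg: "h (g s) = s" if "s \<in> topspace S" for s
    unfolding h_def using injg that by simp
  have tS': "topspace S' = g ` topspace S"
    unfolding S'_def topspace_pullback_topology using hg by auto
  have op: "openin S' V \<longleftrightarrow> (\<exists>U. openin S U \<and> V = g ` U)" for V
  proof -
    have eq: "h -` U \<inter> g ` topspace S = g ` U" if "openin S U" for U
    proof -
      have "U \<subseteq> topspace S" using that by (rule openin_subset)
      then show ?thesis using hg by (auto simp: subset_iff)
    qed
    have "openin S' V \<longleftrightarrow> (\<exists>U. openin S U \<and> V = h -` U \<inter> g ` topspace S)"
      unfolding S'_def by (rule openin_pullback_topology)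
    also have "\<dots> \<longleftrightarrow> (\<exists>U. openin S U \<and> V = g ` U)"
      by (intro ex_cong1 conj_cong refl) (simp add: eq)
    finally show ?thesis .
  qed
  have gS: "homeomorphic_map S S' g"
  proof (rule bijective_open_imp_homeomorphic_map)
    show "continuous_map S S' g"
      unfolding continuous_map_def
    proof (intro conjI allI impI)
      show "g \<in> topspace S \<rightarrow> topspace S'" using tS' by auto
      fix V assume "openin S' V"
      then obtain U where U: "openin S U" "V = g ` U" using op by blast
      then have "{s \<in> topspace S. g s \<in> V} = U"
        using openin_subset[OF U(1)] injg by (auto simp: inj_on_def)
      then show "openin S {s \<in> topspace S. g s \<in> V}" using U by simp
    qed
    show "open_map S S' g" unfolding open_map_def using op by blast
  qed (use tS' injg in auto)
  then obtain k where k: "homeomorphic_maps S S' g k" unfolding homeomorphic_map_maps by blast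
  have "k y = h y" if "y \<in> topspace S'" for y
    using k that hg unfolding tS' homeomorphic_maps_def by auto
  moreover have "homeomorphic_map S' S k" using k homeomorphic_maps_map by blast
  ultimately have hS: "homeomorphic_map S' S h" by (metis homeomorphic_map_eq)
  have M': "closed_manifold 2 S'" using closed_manifold_homeomorphic[OF S gS] .
  define f' where "f' = f \<circ> h"
  have f': "f' (g s) = f s" if "s \<in> topspace S" for s by (simp add: f'_def hg that)
  have tr: "transverse_immersion S' M f'"
    unfolding transverse_immersion_def
  proof (intro conjI ballI)
    show "continuous_map S' M f'"
      unfolding f'_def using hS f homeomorphic_imp_continuous_map continuous_map_compose
      unfolding transverse_immersion_def by blast
    fix p assume "p \<in> topspace M"
    then obtain U \<phi> k W where ch: "crossing_chart S M f p U \<phi> k W"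
      using f unfolding transverse_immersion_def by blast
    have W: "{s \<in> topspace S. f s \<in> U} = (\<Union>i<k. W i)" "disjoint_family_on W {..<k}"
      using ch by (simp_all add: crossing_chart_def)
    have hW: "openin S (W i)"
        "homeomorphic_map (subtopology S (W i))
           (subtopology (Euclidean_space 3) {x. x i = 0}) (\<phi> \<circ> f)" if "i < k" for i
      using ch that by (simp_all add: crossing_chart_def)
    have sub: "W i \<subseteq> topspace S" if "i < k" for i using hW(1)[OF that] openin_subset by blast
    have "{s \<in> topspace S'. f' s \<in> U} = g ` {s \<in> topspace S. f s \<in> U}"
      using tS' f' by auto
    then have 1: "{s \<in> topspace S'. f' s \<in> U} = (\<Union>i<k. g ` W i)" unfolding W(1) by auto
    have 2: "disjoint_family_on (\<lambda>i. g ` W i) {..<k}"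
      unfolding disjoint_family_on_def
    proof (intro ballI impI)
      fix i j assume "i \<in> {..<k}" "j \<in> {..<k}" "i \<noteq> j"
      then have "W i \<inter> W j = {}" "W i \<subseteq> topspace S" "W j \<subseteq> topspace S"
        using W(2) sub by (auto simp: disjoint_family_on_def)
      then show "g ` W i \<inter> g ` W j = {}"
        using inj_on_image_Int[OF injg] by (metis image_empty)
    qed
    have 3: "openin S' (g ` W i) \<and> homeomorphic_map (subtopology S' (g ` W i))
             (subtopology (Euclidean_space 3) {x. x i = 0}) (\<phi> \<circ> f')" if i: "i < k" for i
    proof
      show o: "openin S' (g ` W i)" using op hW(1)[OF i] by blast
      have "h ` g ` W i = W i" using hg sub[OF i] by force
      then have "homeomorphic_map (subtopology S' (g ` W i)) (subtopology S (W i)) h"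
        using openin_subset[OF o] sub[OF i]
        by (intro homeomorphic_map_subtopologies[OF hS]) (simp add: Int_absorb1)
      from homeomorphic_map_compose[OF this hW(2)[OF i]]
      show "homeomorphic_map (subtopology S' (g ` W i))
             (subtopology (Euclidean_space 3) {x. x i = 0}) (\<phi> \<circ> f')"
        by (simp add: f'_def comp_assoc)
    qed
    have "crossing_chart S' M f' p U \<phi> k (\<lambda>i. g ` W i)"
      using ch 1 2 3 by (simp add: crossing_chart_def)
    then show "\<exists>U \<phi> k W. crossing_chart S' M f' p U \<phi> k W" by blast
  qed
  have im: "f' ` topspace S' = f ` topspace S"
    unfolding tS' image_image using f' by (intro image_cong) auto
  have "card {s \<in> topspace S'. f' s = p} = card {s \<in> topspace S. f s = p}" for p
  proof -
    have "{s \<in> topspace S'. f' s = p} = g ` {s \<in> topspace S. f s = p}" using tS' f' by auto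
    moreover have "inj_on g {s \<in> topspace S. f s = p}" using injg by (auto simp: inj_on_def)
    ultimately show ?thesis by (simp add: card_image)
  qed
  then have "triple_points S' f' = triple_points S f" by (simp add: triple_points_def)
  moreover have "dehn_surface M S' f' (f ` topspace S)"
    using M' tr im by (simp add: dehn_surface_def)
  ultimately show ?thesis using that by blast
qed

end

theory Submission
  imports Defs
begin

text \<open>
  The Dehn surface consists, in every tetrahedron, of the four triangles on which one barycentric
  coordinate equals \<open>1/8\<close>. The gluing maps permute barycentric coordinates, so these triangles fit
  together along the faces. Three of the four triangles of a tetrahedron meet in exactly one point,
  where the fourth coordinate is \<open>5/8\<close>; this gives at most four triple points per tetrahedron
  (\<open>card_triple_points\<close>). Any level strictly between \<open>0\<close> and \<open>1/4\<close> would do: below \<open>1/4\<close> the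
  coordinates of a point cannot all be small, and the barycentre of every face has only zero and
  large coordinates.

  \<^bold>\<open>Complement.\<close> Away from the surface a point of a tetrahedron is classified by the set of its
  coordinates below \<open>1/8\<close>, and it can be moved radially from or to the barycentre of the face where
  these coordinates vanish. The radial motion is compatible with the gluing, whence each component
  of the complement is an open cone, with a barycentre \<open>p\<close> of a vertex, an edge, a face or a
  tetrahedron as its apex. Nothing has to be known about the base of the cone (the link): because
  \<open>M\<close> is a manifold, \<open>p\<close> has a neighbourhood that is a round ball, which is an open cone too, and
  two open cones with a common apex, one of them embedded as an open set in the other, are
  homeomorphic (\<open>open_cone_unique\<close>). This replaces any study of links of vertices, and it covers
  an edge that might be glued to itself with its ends exchanged.

  \<^bold>\<open>Transversality.\<close> The abstract surface is realised inside \<open>M \<times> M\<close>: the point \<open>x\<close> of the triangle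
  \<open>x j = 1/8\<close> is recorded together with the point half way from \<open>x\<close> to vertex \<open>j\<close>, which tells
  apart the sheets through \<open>x\<close>. Near a point of the surface \<open>M\<close> is assembled from pieces of
  tetrahedra: a single one, two along a face, or a cycle of them around an edge. It suffices to map
  these pieces continuously and injectively to \<open>\<real>\<^sup>3\<close> with the sheets on coordinate planes; by
  invariance of domain such a map is a chart (\<open>chart_from_injection\<close>). The locale \<open>corner_chart\<close>
  turns such data into crossing charts. The charts also show that the abstract surface is a
  2-manifold.
\<close>

section \<open>Uniqueness of open cones\<close>

text \<open>
  Polar coordinates around an apex without a named base: \<open>\<gamma>\<close> is the radius, with values in
  \<open>[0, 1)\<close>, and \<open>\<delta> s\<close> multiplies the radius by \<open>s\<close> as long as the result stays below \<open>1\<close>.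
  Compactness of the sublevel sets makes them a neighbourhood base of the apex and an exhaustion of
  the space. Continuity of \<open>\<delta>\<close> is only required along radial maps, in the form in which it
  can be checked on a quotient space.
\<close>

locale open_cone =
  fixes X :: "'a topology" and p :: 'a and \<gamma> :: "'a \<Rightarrow> real" and \<delta> :: "real \<Rightarrow> 'a \<Rightarrow> 'a"
  assumes apex: "p \<in> topspace X" and gauge_apex: "\<gamma> p = 0"
    and Hausdorff: "Hausdorff_space X"
    and gauge_cont: "continuous_map X euclideanreal \<gamma>"
    and gauge_range: "\<And>x. x \<in> topspace X \<Longrightarrow> 0 \<le> \<gamma> x \<and> \<gamma> x < 1"
    and gauge_zero: "\<And>x. x \<in> topspace X \<Longrightarrow> \<gamma> x = 0 \<Longrightarrow> x = p"
    and sublevel_compact: "\<And>r. r < 1 \<Longrightarrow> compactin X {x \<in> topspace X. \<gamma> x \<le> r}"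
    and dil: "\<And>s x. x \<in> topspace X \<Longrightarrow> 0 < s \<Longrightarrow> s * \<gamma> x < 1 \<Longrightarrow>
                \<delta> s x \<in> topspace X \<and> \<gamma> (\<delta> s x) = s * \<gamma> x"
    and dil_one: "\<And>x. x \<in> topspace X \<Longrightarrow> \<delta> 1 x = x"
    and dil_dil: "\<And>s t x. x \<in> topspace X \<Longrightarrow> 0 < s \<Longrightarrow> s * \<gamma> x < 1 \<Longrightarrow> 0 < t \<Longrightarrow>
                t * (s * \<gamma> x) < 1 \<Longrightarrow> \<delta> t (\<delta> s x) = \<delta> (t * s) x"
    and radial_cont: "\<And>m. continuous_on {0..<1} m \<Longrightarrow> (\<And>r. r \<in> {0..<1} \<Longrightarrow> 0 < m r \<and> r * m r < 1) \<Longrightarrow>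
                continuous_map X X (\<lambda>x. \<delta> (m (\<gamma> x)) x)"

text \<open>
  On \<open>[u, 1)\<close> the piecewise linear map with \<open>u \<mapsto> u'\<close>, \<open>v \<mapsto> v'\<close> and \<open>1 \<mapsto> 1\<close>. Its factor
  \<open>stretch_factor\<close> is continued to \<open>[0, u]\<close> by the constant \<open>u' / u\<close>, so that it is continuous and
  positive at \<open>0\<close>.
\<close>

definition stretch :: "real \<Rightarrow> real \<Rightarrow> real \<Rightarrow> real \<Rightarrow> real \<Rightarrow> real" where
  "stretch u v u' v' r = u' + (v' - u') / (v - u) * (min r v - u) + (1 - v') / (1 - v) * (max r v - v)"

definition stretch_factor :: "real \<Rightarrow> real \<Rightarrow> real \<Rightarrow> real \<Rightarrow> real \<Rightarrow> real" where
  "stretch_factor u v u' v' r = stretch u v u' v' (max r u) / max r u"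

lemma stretch_between:
  assumes "0 < u" "u < v" "v < 1" "0 < u'" "u' < v'" "v' < 1" "u \<le> r" "r < 1"
  shows "u' \<le> stretch u v u' v' r" "stretch u v u' v' r < 1"
    "stretch u v u' v' r \<le> v' \<longleftrightarrow> r \<le> v" "stretch u' v' u v (stretch u v u' v' r) = r"
proof -
  let ?s = "stretch u v u' v' r"
  have "u' \<le> ?s \<and> ?s < 1 \<and> (?s \<le> v' \<longleftrightarrow> r \<le> v) \<and> stretch u' v' u v ?s = r"
  proof (cases "r \<le> v")
    case True
    have e: "?s = u' + (v' - u') / (v - u) * (r - u)" using True by (simp add: stretch_def)
    have "0 \<le> (v' - u') / (v - u) * (r - u)" using assms by simp
    moreover have "(v' - u') / (v - u) * (r - u) \<le> (v' - u') / (v - u) * (v - u)"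
      using assms True by (intro mult_left_mono) auto
    ultimately have b: "u' \<le> ?s" "?s \<le> v'" using e assms by auto
    have "stretch u' v' u v ?s = u + (v - u) / (v' - u') * (?s - u')"
      using b by (simp add: stretch_def[of u' v' u v])
    also have "\<dots> = r" unfolding e using assms by simp
    finally show ?thesis using b assms True by auto
  next
    case False
    have e: "?s = v' + (1 - v') / (1 - v) * (r - v)" using False assms by (simp add: stretch_def)
    have p: "0 < (1 - v') / (1 - v) * (r - v)" using assms False by simp
    have "(1 - v') / (1 - v) * (r - v) < (1 - v') / (1 - v) * (1 - v)"
      using assms False by (intro mult_strict_left_mono) auto
    then have b: "v' < ?s" "?s < 1" using e assms p by auto
    have "stretch u' v' u v ?s = v + (1 - v) / (1 - v') * (?s - v')"
      using b assms by (simp add: stretch_def[of u' v' u v])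
    also have "\<dots> = r" unfolding e using assms by simp
    finally show ?thesis using b assms False by auto
  qed
  then show "u' \<le> ?s" "?s < 1" "?s \<le> v' \<longleftrightarrow> r \<le> v" "stretch u' v' u v ?s = r" by auto
qed

lemma stretch_factor:
  assumes "0 < u" "u < v" "v < 1" "0 < u'" "u' < v'" "v' < 1" "0 \<le> r" "r < 1"
  shows "0 < stretch_factor u v u' v' r" "r * stretch_factor u v u' v' r < 1"
    "r * stretch_factor u v u' v' r \<le> v' \<longleftrightarrow> r \<le> v"
    "stretch_factor u' v' u v (r * stretch_factor u v u' v' r) * stretch_factor u v u' v' r = 1"
    "r \<le> u \<Longrightarrow> stretch_factor u v u' v' r = u' / u"
    "v' = v \<Longrightarrow> v \<le> r \<Longrightarrow> stretch_factor u v u' v' r = 1"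
proof -
  let ?m = "stretch_factor u v u' v' r"
  have su: "stretch u v u' v' u = u'" "stretch u' v' u v u' = u" using assms by (auto simp: stretch_def)
  have "0 < ?m \<and> r * ?m < 1 \<and> (r * ?m \<le> v' \<longleftrightarrow> r \<le> v) \<and> stretch_factor u' v' u v (r * ?m) * ?m = 1"
  proof (cases "r \<le> u")
    case True
    have m: "?m = u' / u" using True su by (simp add: stretch_factor_def max_def)
    have le: "r * ?m \<le> u'" unfolding m using True assms by (simp add: divide_simps mult.commute mult_right_mono)
    have "stretch_factor u' v' u v (r * ?m) = u / u'"
      using le su by (simp add: stretch_factor_def max_def)
    moreover have "r * ?m < 1" using le assms by simp
    ultimately show ?thesis using le m True assms by auto
  next
    case False
    then have r: "u < r" "0 < r" using assms by auto
    have m: "?m = stretch u v u' v' r / r" using r by (simp add: stretch_factor_def max_def)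
    then have rm: "r * ?m = stretch u v u' v' r" using r by simp
    note b = stretch_between[OF assms(1-6) less_imp_le[OF r(1)] assms(8)]
    have "stretch_factor u' v' u v (r * ?m) = r / stretch u v u' v' r"
      unfolding rm using b by (simp add: stretch_factor_def max_def)
    then have "stretch_factor u' v' u v (r * ?m) * ?m = 1"
      unfolding m using b(1) r assms(4) by simp
    moreover have "0 < ?m" unfolding m using b(1) r assms(4) by simp
    ultimately show ?thesis using b(2,3) rm by simp
  qed
  then show "0 < ?m" "r * ?m < 1" "r * ?m \<le> v' \<longleftrightarrow> r \<le> v" "stretch_factor u' v' u v (r * ?m) * ?m = 1"
    by auto
  show "r \<le> u \<Longrightarrow> ?m = u' / u" using su by (simp add: stretch_factor_def max_def)
  show "v' = v \<Longrightarrow> v \<le> r \<Longrightarrow> ?m = 1" using assms by (simp add: stretch_factor_def max_def stretch_def)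
qed

lemma continuous_on_stretch_factor:
  assumes "0 < u"
  shows "continuous_on A (stretch_factor u v u' v')"
  unfolding stretch_factor_def stretch_def using assms by (intro continuous_intros) auto

context open_cone
begin

text \<open>
  The supply of homeomorphisms of an open cone. The case \<open>u = u'\<close> stretches the cone and fixes a
  neighbourhood of the apex; the case \<open>v = v'\<close> shrinks a neighbourhood of the apex and fixes the
  outside.
\<close>

lemma radial_homeomorphism:
  assumes uv: "0 < u" "u < v" "v < 1" "0 < u'" "u' < v'" "v' < 1"
  obtains \<theta> \<theta>' where "homeomorphic_maps X X \<theta> \<theta>'"
    "\<And>x. x \<in> topspace X \<Longrightarrow> \<gamma> x \<le> u \<Longrightarrow> \<theta> x = \<delta> (u' / u) x \<and> \<gamma> (\<theta> x) = u' / u * \<gamma> x"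
    "\<And>x. x \<in> topspace X \<Longrightarrow> v' = v \<Longrightarrow> v \<le> \<gamma> x \<Longrightarrow> \<theta> x = x"
    "\<And>x. x \<in> topspace X \<Longrightarrow> \<gamma> (\<theta> x) \<le> v' \<longleftrightarrow> \<gamma> x \<le> v"
proof -
  let ?m = "stretch_factor u v u' v'" and ?m' = "stretch_factor u' v' u v"
  define \<theta> where "\<theta> x = \<delta> (?m (\<gamma> x)) x" for x
  define \<theta>' where "\<theta>' x = \<delta> (?m' (\<gamma> x)) x" for x
  note f = stretch_factor[OF uv] and f' = stretch_factor[OF uv(4-6) uv(1-3)]
  have g: "\<theta> x \<in> topspace X \<and> \<gamma> (\<theta> x) = ?m (\<gamma> x) * \<gamma> x" if "x \<in> topspace X" for x
    unfolding \<theta>_def using dil[OF that] f[of "\<gamma> x"] gauge_range[OF that] by (simp add: mult.commute)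
  have g': "\<theta>' x \<in> topspace X \<and> \<gamma> (\<theta>' x) = ?m' (\<gamma> x) * \<gamma> x" if "x \<in> topspace X" for x
    unfolding \<theta>'_def using dil[OF that] f'[of "\<gamma> x"] gauge_range[OF that] by (simp add: mult.commute)
  have i: "\<theta>' (\<theta> x) = x" if x: "x \<in> topspace X" for x
  proof -
    have r: "0 \<le> \<gamma> x" "\<gamma> x < 1" using gauge_range[OF x] by auto
    have r': "0 \<le> ?m (\<gamma> x) * \<gamma> x" "?m (\<gamma> x) * \<gamma> x < 1" using f[OF r] r by (auto simp: mult.commute)
    have e: "?m' (\<gamma> x * ?m (\<gamma> x)) * ?m (\<gamma> x) = 1" using f(4)[OF r] .
    have "\<theta>' (\<theta> x) = \<delta> (?m' (?m (\<gamma> x) * \<gamma> x)) (\<delta> (?m (\<gamma> x)) x)"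
      using g[OF x] by (simp add: \<theta>'_def \<theta>_def)
    also have "\<dots> = \<delta> (?m' (?m (\<gamma> x) * \<gamma> x) * ?m (\<gamma> x)) x"
      using dil_dil[OF x f(1)[OF r] r'(2) f'(1)[OF r']] f'(2)[OF r'] by (simp add: mult.commute)
    also have "\<dots> = x" using e dil_one[OF x] by (simp add: mult.commute)
    finally show ?thesis .
  qed
  have i': "\<theta> (\<theta>' x) = x" if x: "x \<in> topspace X" for x
  proof -
    have r: "0 \<le> \<gamma> x" "\<gamma> x < 1" using gauge_range[OF x] by auto
    have r': "0 \<le> ?m' (\<gamma> x) * \<gamma> x" "?m' (\<gamma> x) * \<gamma> x < 1" using f'[OF r] r by (auto simp: mult.commute)
    have e: "?m (\<gamma> x * ?m' (\<gamma> x)) * ?m' (\<gamma> x) = 1" using f'(4)[OF r] .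
    have "\<theta> (\<theta>' x) = \<delta> (?m (?m' (\<gamma> x) * \<gamma> x)) (\<delta> (?m' (\<gamma> x)) x)"
      using g'[OF x] by (simp add: \<theta>'_def \<theta>_def)
    also have "\<dots> = \<delta> (?m (?m' (\<gamma> x) * \<gamma> x) * ?m' (\<gamma> x)) x"
      using dil_dil[OF x f'(1)[OF r] r'(2) f(1)[OF r']] f(2)[OF r'] by (simp add: mult.commute)
    also have "\<dots> = x" using e dil_one[OF x] by (simp add: mult.commute)
    finally show ?thesis .
  qed
  show thesis
  proof
    have "continuous_map X X \<theta>" unfolding \<theta>_def
      by (rule radial_cont) (use uv f in \<open>auto intro: continuous_on_stretch_factor\<close>)
    moreover have "continuous_map X X \<theta>'" unfolding \<theta>'_def
      by (rule radial_cont) (use uv f' in \<open>auto intro: continuous_on_stretch_factor\<close>)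
    ultimately show "homeomorphic_maps X X \<theta> \<theta>'"
      using i i' by (simp add: homeomorphic_maps_def)
    show "\<theta> x = \<delta> (u' / u) x \<and> \<gamma> (\<theta> x) = u' / u * \<gamma> x" if "x \<in> topspace X" "\<gamma> x \<le> u" for x
      using g[OF that(1)] f(5)[of "\<gamma> x"] that gauge_range[OF that(1)] by (simp add: \<theta>_def)
    show "\<theta> x = x" if "x \<in> topspace X" "v' = v" "v \<le> \<gamma> x" for x
      using f(6)[of "\<gamma> x"] that gauge_range[OF that(1)] dil_one by (simp add: \<theta>_def)
    show "\<gamma> (\<theta> x) \<le> v' \<longleftrightarrow> \<gamma> x \<le> v" if "x \<in> topspace X" for x
      using g[OF that(1)] f(3)[of "\<gamma> x"] that gauge_range[OF that(1)] by (simp add: mult.commute)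
  qed
qed

lemma openin_sublevel: "openin X {x \<in> topspace X. \<gamma> x < r}"
  using openin_continuous_map_preimage[OF gauge_cont, of "{..<r}"] by simp

lemma sublevel_neighbourhood_base:
  assumes "openin X U" "p \<in> U"
  obtains e where "0 < e" "e < 1" "\<And>x. x \<in> topspace X \<Longrightarrow> \<gamma> x \<le> e \<Longrightarrow> x \<in> U"
proof -
  define K where "K = {x \<in> topspace X. \<gamma> x \<le> 1/2} \<inter> (topspace X - U)"
  have "compactin X K" unfolding K_def
    by (intro compact_Int_closedin sublevel_compact) (use assms in auto)
  then have cK: "compact (\<gamma> ` K)" using image_compactin[OF _ gauge_cont] by simp
  show thesis
  proof (cases "K = {}")
    case True
    show thesis by (rule that[of "1/2"]) (use True in \<open>auto simp: K_def\<close>)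
  next
    case False
    then obtain k where k: "k \<in> K" "\<And>x. x \<in> K \<Longrightarrow> \<gamma> k \<le> \<gamma> x"
      using compact_attains_inf[OF cK] by auto
    have "\<gamma> k \<noteq> 0" using gauge_zero[of k] k(1) assms(2) by (auto simp: K_def)
    then have pos: "0 < \<gamma> k" "\<gamma> k \<le> 1/2" using gauge_range[of k] k(1) by (auto simp: K_def)
    show thesis
    proof (rule that[of "\<gamma> k / 2"])
      fix x assume "x \<in> topspace X" "\<gamma> x \<le> \<gamma> k / 2"
      then show "x \<in> U" using k(2)[of x] pos by (auto simp: K_def)
    qed (use pos in auto)
  qed
qed

lemma compact_in_sublevel:
  assumes "compactin X K"
  obtains c where "0 < c" "c < 1" "\<And>x. x \<in> K \<Longrightarrow> \<gamma> x \<le> c"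
proof -
  have cK: "compact (\<gamma> ` K)" using image_compactin[OF assms gauge_cont] by simp
  have sub: "K \<subseteq> topspace X" using assms by (simp add: compactin_def)
  show thesis
  proof (cases "K = {}")
    case True
    then show thesis using that[of "1/2"] by simp
  next
    case False
    then obtain k where k: "k \<in> K" "\<And>x. x \<in> K \<Longrightarrow> \<gamma> x \<le> \<gamma> k"
      using compact_attains_sup[OF cK] by auto
    have k1: "\<gamma> k < 1" using gauge_range k(1) sub by auto
    show thesis by (rule that[of "max (1/2) (\<gamma> k)"]) (use k k1 in \<open>auto intro: order_trans[OF k(2)]\<close>)
  qed
qed

end

text \<open>
  The conjugation trick of Kister. Let \<open>\<sigma>\<close> shrink \<open>f {\<gamma> \<le> a}\<close> along the rays of \<open>X\<close> into a tiny
  neighbourhood of the apex, with support in \<open>f {\<gamma> \<le> b}\<close>, and let \<open>\<theta>\<close> stretch along the rays of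
  \<open>Y\<close>, fix that tiny neighbourhood and carry a set inside \<open>f {\<gamma> < b}\<close> onto \<open>{\<gamma>' \<le> C}\<close>.
  Then \<open>\<sigma>\<inverse> \<circ> \<theta> \<circ> \<sigma>\<close> fixes \<open>f {\<gamma> \<le> a}\<close> and still enlarges \<open>f {\<gamma> \<le> b}\<close> so that it covers
  \<open>{\<gamma>' \<le> c}\<close>. The rays of \<open>X\<close> and \<open>Y\<close> need not be related in any way.
\<close>

lemma engulfing:
  assumes X: "open_cone X p \<gamma> \<delta>" and Y: "open_cone Y p' \<gamma>' \<delta>'"
    and f: "continuous_map X Y f" "open_map X Y f" "inj_on f (topspace X)" "f p = p'"
    and ab: "0 < a" "a < b" "b < 1" and c: "c < 1"
  obtains \<phi> where "homeomorphic_map Y Y \<phi>"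
    "\<And>x. x \<in> topspace X \<Longrightarrow> \<gamma> x \<le> a \<Longrightarrow> \<phi> (f x) = f x"
    "\<And>y. y \<in> topspace Y \<Longrightarrow> \<gamma>' y \<le> c \<Longrightarrow> \<exists>x \<in> topspace X. \<gamma> x \<le> b \<and> \<phi> (f x) = y"
proof -
  interpret X: open_cone X p \<gamma> \<delta> by fact
  interpret Y: open_cone Y p' \<gamma>' \<delta>' by fact
  have fX: "f x \<in> topspace Y" if "x \<in> topspace X" for x
    using continuous_map_image_subset_topspace[OF f(1)] that by blast
  let ?B = "{x \<in> topspace X. \<gamma> x \<le> b}"
  have cB: "compactin Y (f ` ?B)" using image_compactin[OF X.sublevel_compact[OF ab(3)] f(1)] .
  obtain c1 where c1: "0 < c1" "c1 < 1" "\<And>y. y \<in> f ` ?B \<Longrightarrow> \<gamma>' y \<le> c1"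
    using Y.compact_in_sublevel[OF cB] by blast
  \<comment> \<open>\<open>C\<close> bounds \<open>f {\<gamma> \<le> b}\<close> as well, so that \<open>\<sigma>\<close> preserves \<open>{\<gamma>' \<le> C}\<close>.\<close>
  define C where "C = max c c1"
  have C: "c \<le> C" "c1 \<le> C" "0 < C" "C < 1" using c c1 by (auto simp: C_def)
  have "openin Y (f ` {x \<in> topspace X. \<gamma> x < b})"
    using f(2) X.openin_sublevel by (simp add: open_map_def)
  moreover have "p' \<in> f ` {x \<in> topspace X. \<gamma> x < b}"
    using f(4) X.apex X.gauge_apex ab by force
  ultimately obtain e0 where e0: "0 < e0" "e0 < 1"
      "\<And>y. y \<in> topspace Y \<Longrightarrow> \<gamma>' y \<le> e0 \<Longrightarrow> y \<in> f ` {x \<in> topspace X. \<gamma> x < b}"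
    by (rule Y.sublevel_neighbourhood_base) (rule that)
  define e where "e = min e0 (C/2)"
  have e: "0 < e" "e < 1" "e < C"
      "\<And>y. y \<in> topspace Y \<Longrightarrow> \<gamma>' y \<le> e \<Longrightarrow> y \<in> f ` {x \<in> topspace X. \<gamma> x < b}"
    using e0 C by (auto simp: e_def)
  have "openin X {x \<in> topspace X. f x \<in> {y \<in> topspace Y. \<gamma>' y < e/2}}"
    by (rule openin_continuous_map_preimage[OF f(1) Y.openin_sublevel])
  moreover have "p \<in> {x \<in> topspace X. f x \<in> {y \<in> topspace Y. \<gamma>' y < e/2}}"
    using X.apex f(4) Y.apex Y.gauge_apex e by simp
  ultimately obtain d0 where d0: "0 < d0" "d0 < 1"
      "\<And>x. x \<in> topspace X \<Longrightarrow> \<gamma> x \<le> d0 \<Longrightarrow>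
         x \<in> {x \<in> topspace X. f x \<in> {y \<in> topspace Y. \<gamma>' y < e/2}}"
    by (rule X.sublevel_neighbourhood_base) (rule that)
  define d where "d = min d0 (b/2)"
  have d: "0 < d" "d < b" "\<And>x. x \<in> topspace X \<Longrightarrow> \<gamma> x \<le> d \<Longrightarrow> \<gamma>' (f x) < e/2"
    using d0 ab by (auto simp: d_def)
  obtain \<rho> \<rho>' where rho: "homeomorphic_maps X X \<rho> \<rho>'"
      "\<And>x. x \<in> topspace X \<Longrightarrow> \<gamma> x \<le> a \<Longrightarrow> \<gamma> (\<rho> x) = d / a * \<gamma> x"
      "\<And>x. x \<in> topspace X \<Longrightarrow> b \<le> \<gamma> x \<Longrightarrow> \<rho> x = x"
      "\<And>x. x \<in> topspace X \<Longrightarrow> \<gamma> (\<rho> x) \<le> b \<longleftrightarrow> \<gamma> x \<le> b"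
    using X.radial_homeomorphism[OF ab d(1,2) ab(3)] by metis
  obtain \<theta> \<theta>' where theta: "homeomorphic_maps Y Y \<theta> \<theta>'"
      "\<And>y. y \<in> topspace Y \<Longrightarrow> \<gamma>' y \<le> e/2 \<Longrightarrow> \<theta> y = \<delta>' ((e/2) / (e/2)) y"
      "\<And>y. y \<in> topspace Y \<Longrightarrow> \<gamma>' (\<theta> y) \<le> C \<longleftrightarrow> \<gamma>' y \<le> e"
    using Y.radial_homeomorphism[of "e/2" e "e/2" C] e C by (smt (verit) half_gt_zero field_sum_of_halves)
  have theta_id: "\<theta> y = y" if "y \<in> topspace Y" "\<gamma>' y \<le> e/2" for y
    using theta(2)[OF that] Y.dil_one that e by simp
  have rX: "\<rho> x \<in> topspace X" "\<rho>' x \<in> topspace X" "\<rho>' (\<rho> x) = x" "\<rho> (\<rho>' x) = x" if "x \<in> topspace X" for x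
    using rho(1) that by (auto simp: homeomorphic_maps_def continuous_map_def)
  have tY: "\<theta> y \<in> topspace Y" "\<theta>' y \<in> topspace Y" "\<theta>' (\<theta> y) = y" "\<theta> (\<theta>' y) = y" if "y \<in> topspace Y" for y
    using theta(1) that by (auto simp: homeomorphic_maps_def continuous_map_def)
  have rho': "\<rho>' x = x" if "x \<in> topspace X" "b \<le> \<gamma> x" for x
    using rho(3)[OF that] rX[OF that(1)] by metis
  have rho'_b: "\<gamma> (\<rho>' x) \<le> b \<longleftrightarrow> \<gamma> x \<le> b" if "x \<in> topspace X" for x
    using rho(4)[OF rX(2)[OF that]] rX(4)[OF that] by simp
  \<comment> \<open>A self-map of \<open>X\<close> that is the identity outside \<open>{\<gamma> < b}\<close> is extended by the identity to \<open>Y\<close>.\<close>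
  define ext where "ext r y = (if y \<in> f ` topspace X then f (r (inv_into (topspace X) f y)) else y)" for r y
  have ext_f: "ext r (f x) = f (r x)" if "x \<in> topspace X" for r x
    using that f(3) by (simp add: ext_def)
  have ext_out: "ext r y = y" if "y \<notin> f ` ?B" "\<And>x. x \<in> topspace X \<Longrightarrow> b \<le> \<gamma> x \<Longrightarrow> r x = x" for r y
    using that f(3) by (auto simp: ext_def image_iff) (metis linorder_not_le order_less_imp_le)
  have ext_cont: "continuous_map Y Y (ext r)"
    if r: "continuous_map X X r" "\<And>x. x \<in> topspace X \<Longrightarrow> b \<le> \<gamma> x \<Longrightarrow> r x = x" for r
  proof (rule pasting_lemma[where I = UNIV and f = "\<lambda>i::bool. ext r"
        and T = "\<lambda>i. if i then f ` topspace X else topspace Y - f ` ?B"])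
    fix i :: bool
    show "openin Y (if i then f ` topspace X else topspace Y - f ` ?B)"
      using f(2) compactin_imp_closedin[OF Y.Hausdorff cB] by (auto simp: open_map_def)
    have "continuous_map (subtopology Y (f ` topspace X)) Y (ext r)"
    proof -
      have hf: "homeomorphic_map X (subtopology Y (f ` topspace X)) f"
        using injective_open_imp_embedding_map[OF f(1,2,3)] by (simp add: embedding_map_def)
      then obtain g where g: "homeomorphic_maps X (subtopology Y (f ` topspace X)) f g"
        by (auto simp: homeomorphic_map_maps)
      have "continuous_map (subtopology Y (f ` topspace X)) Y (f \<circ> r \<circ> g)"
        using g r(1) f(1) unfolding homeomorphic_maps_def by (metis continuous_map_compose)
      moreover have "(f \<circ> r \<circ> g) y = ext r y" if "y \<in> topspace (subtopology Y (f ` topspace X))" for y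
        using that g ext_f by (auto simp: homeomorphic_maps_def)
      ultimately show ?thesis using continuous_map_eq by blast
    qed
    moreover have "continuous_map (subtopology Y (topspace Y - f ` ?B)) Y (ext r)"
    proof (rule continuous_map_eq[where f = "\<lambda>y. y"])
      show "continuous_map (subtopology Y (topspace Y - f ` ?B)) Y (\<lambda>y. y)"
        by (simp add: continuous_map_from_subtopology)
      show "y = ext r y" if "y \<in> topspace (subtopology Y (topspace Y - f ` ?B))" for y
        using ext_out[of y r] r(2) that by auto
    qed
    ultimately show "continuous_map (subtopology Y (if i then f ` topspace X else topspace Y - f ` ?B)) Y (ext r)"
      by simp
  next
    fix y assume y: "y \<in> topspace Y"
    show "\<exists>j::bool. j \<in> UNIV \<and> y \<in> (if j then f ` topspace X else topspace Y - f ` ?B) \<and> ext r y = ext r y"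
    proof (cases "y \<in> f ` topspace X")
      case True
      then show ?thesis by (intro exI[of _ True]) simp
    next
      case False
      then show ?thesis using y by (intro exI[of _ False]) auto
    qed
  qed auto
  define \<sigma> \<sigma>' where "\<sigma> = ext \<rho>" and "\<sigma>' = ext \<rho>'"
  have cancel: "ext r (ext s y) = y"
    if "y \<in> topspace Y" "\<And>x. x \<in> topspace X \<Longrightarrow> s x \<in> topspace X \<and> r (s x) = x" for r s y
  proof (cases "y \<in> f ` topspace X")
    case True
    then show ?thesis using ext_f that(2) by auto
  next
    case False
    then show ?thesis by (simp add: ext_def)
  qed
  have sigma: "homeomorphic_maps Y Y \<sigma> \<sigma>'"
    unfolding homeomorphic_maps_def \<sigma>_def \<sigma>'_def
    using rho(1,3) rho' rX by (auto intro!: ext_cont cancel simp: homeomorphic_maps_def)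
  have sY: "\<sigma> y \<in> topspace Y" "\<sigma>' y \<in> topspace Y" "\<sigma>' (\<sigma> y) = y" "\<sigma> (\<sigma>' y) = y" if "y \<in> topspace Y" for y
    using sigma that by (auto simp: homeomorphic_maps_def continuous_map_def)
  show thesis
  proof
    have "homeomorphic_map Y Y \<sigma>" "homeomorphic_map Y Y \<sigma>'" "homeomorphic_map Y Y \<theta>"
      using sigma theta(1) homeomorphic_maps_map by blast+
    then show "homeomorphic_map Y Y (\<sigma>' \<circ> (\<theta> \<circ> \<sigma>))" by (meson homeomorphic_map_compose)
    fix x assume x: "x \<in> topspace X" "\<gamma> x \<le> a"
    have "d / a * \<gamma> x \<le> d" using x(2) ab d(1) by (simp add: divide_simps mult_left_mono)
    then have "\<gamma>' (f (\<rho> x)) \<le> e/2" using d(3)[OF rX(1)[OF x(1)]] rho(2)[OF x] by simp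
    then have "\<theta> (\<sigma> (f x)) = \<sigma> (f x)"
      using theta_id fX rX x(1) ext_f by (simp add: \<sigma>_def)
    then show "(\<sigma>' \<circ> (\<theta> \<circ> \<sigma>)) (f x) = f x" using sY(3) fX x(1) by simp
  next
    fix y assume y: "y \<in> topspace Y" "\<gamma>' y \<le> c"
    have "\<gamma>' (\<sigma> y) \<le> C"
    proof (cases "y \<in> f ` ?B")
      case True
      then obtain x where x: "x \<in> topspace X" "\<gamma> x \<le> b" "y = f x" by auto
      then have "\<sigma> y \<in> f ` ?B" using ext_f rX(1) rho(4) by (simp add: \<sigma>_def)
      then show ?thesis using c1(3) C(2) by fastforce
    next
      case False
      then have "\<sigma> y = y" unfolding \<sigma>_def using rho(3) by (intro ext_out) auto
      then show ?thesis using y C by simp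
    qed
    then have "\<gamma>' (\<theta>' (\<sigma> y)) \<le> e" using theta(3) tY sY y(1) by metis
    then obtain x where x: "x \<in> topspace X" "\<gamma> x < b" "\<theta>' (\<sigma> y) = f x"
      using e(4) tY(2) sY(1) y(1) by blast
    have "\<sigma>' (\<theta> (\<sigma> (f (\<rho>' x)))) = \<sigma>' (\<theta> (f x))"
      using ext_f rX x(1) by (simp add: \<sigma>_def)
    also have "\<dots> = y" using x(3) tY(4) sY y(1) by metis
    finally show "\<exists>x \<in> topspace X. \<gamma> x \<le> b \<and> (\<sigma>' \<circ> (\<theta> \<circ> \<sigma>)) (f x) = y"
      using rX(2) rho'_b x by (intro bexI[of _ "\<rho>' x"]) auto
  qed
qed

text \<open>
  Kwun's uniqueness of open cone neighbourhoods. Engulfing is iterated on an exhaustion of \<open>X\<close>: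
  the \<open>k\<close>-th correction does not change the embedding on \<open>{\<gamma> \<le> r k}\<close> and makes the image of
  \<open>{\<gamma> \<le> r (k + 1)}\<close> cover \<open>{\<gamma>' \<le> r k}\<close>. The embeddings are therefore eventually constant near
  every point, and their limit is an open embedding onto \<open>Y\<close>.
\<close>

theorem open_cone_unique:
  assumes X: "open_cone X p \<gamma> \<delta>" and Y: "open_cone Y p' \<gamma>' \<delta>'"
    and f: "continuous_map X Y f" "open_map X Y f" "inj_on f (topspace X)" "f p = p'"
  shows "X homeomorphic_space Y"
proof -
  interpret X: open_cone X p \<gamma> \<delta> by fact
  interpret Y: open_cone Y p' \<gamma>' \<delta>' by fact
  define r :: "nat \<Rightarrow> real" where "r k = 1 - 1 / (real k + 2)" for k
  have r: "0 < r k" "r k < r (Suc k)" "r k < 1" for k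
    by (auto simp: r_def field_simps)
  have r_mono: "r j \<le> r k" if "j \<le> k" for j k using that by (simp add: r_def frac_le)
  have r_lim: "\<exists>k. t < r k" if t: "t < 1" for t
  proof -
    obtain k where "inverse (real (Suc k)) < 1 - t"
      using reals_Archimedean[of "1 - t"] t by auto
    moreover have "1 / (real k + 2) \<le> inverse (real (Suc k))"
      by (simp add: inverse_eq_divide frac_le)
    ultimately have "1 / (real k + 2) < 1 - t" by linarith
    then show ?thesis by (intro exI[of _ k]) (simp add: r_def)
  qed
  define emb where "emb g \<longleftrightarrow> continuous_map X Y g \<and> open_map X Y g \<and> inj_on g (topspace X) \<and> g p = p'" for g
  have step: "\<exists>h. emb h \<and> (\<forall>x \<in> topspace X. \<gamma> x \<le> r k \<longrightarrow> h x = g x) \<and>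
      (\<forall>y \<in> topspace Y. \<gamma>' y \<le> r k \<longrightarrow> (\<exists>x \<in> topspace X. \<gamma> x \<le> r (Suc k) \<and> h x = y))"
    if g: "emb g" for g k
  proof -
    obtain \<phi> where phi: "homeomorphic_map Y Y \<phi>"
      "\<And>x. x \<in> topspace X \<Longrightarrow> \<gamma> x \<le> r k \<Longrightarrow> \<phi> (g x) = g x"
      "\<And>y. y \<in> topspace Y \<Longrightarrow> \<gamma>' y \<le> r k \<Longrightarrow> \<exists>x \<in> topspace X. \<gamma> x \<le> r (Suc k) \<and> \<phi> (g x) = y"
    proof (rule engulfing[OF X Y _ _ _ _ r(1) r(2) r(3) r(3), of g k k])
      show "continuous_map X Y g" "open_map X Y g" "inj_on g (topspace X)" "g p = p'"
        using g by (auto simp: emb_def)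
    qed (rule that)
    have "emb (\<phi> \<circ> g)" unfolding emb_def
    proof (intro conjI)
      show "continuous_map X Y (\<phi> \<circ> g)" "open_map X Y (\<phi> \<circ> g)"
        using g homeomorphic_imp_continuous_map[OF phi(1)] homeomorphic_imp_open_map[OF phi(1)]
        by (auto simp: emb_def intro: continuous_map_compose open_map_compose)
      show "inj_on (\<phi> \<circ> g) (topspace X)"
        using g inj_on_subset[OF homeomorphic_imp_injective_map[OF phi(1)]]
          continuous_map_image_subset_topspace[of X Y g]
        by (intro comp_inj_on) (auto simp: emb_def)
      show "(\<phi> \<circ> g) p = p'" using g phi(2)[OF X.apex] X.gauge_apex r(1)[of k] by (simp add: emb_def)
    qed
    then show ?thesis using phi by (intro exI[of _ "\<phi> \<circ> g"]) simp
  qed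
  obtain F where F: "\<And>k. emb (F k)" "\<And>k x. x \<in> topspace X \<Longrightarrow> \<gamma> x \<le> r k \<Longrightarrow> F (Suc k) x = F k x"
      "\<And>k y. y \<in> topspace Y \<Longrightarrow> \<gamma>' y \<le> r k \<Longrightarrow> \<exists>x \<in> topspace X. \<gamma> x \<le> r (Suc k) \<and> F (Suc k) x = y"
  proof -
    have "\<exists>F. \<forall>k. emb (F k) \<and> ((\<forall>x \<in> topspace X. \<gamma> x \<le> r k \<longrightarrow> F (Suc k) x = F k x) \<and>
      (\<forall>y \<in> topspace Y. \<gamma>' y \<le> r k \<longrightarrow> (\<exists>x \<in> topspace X. \<gamma> x \<le> r (Suc k) \<and> F (Suc k) x = y)))"
    proof (rule dependent_nat_choice)
      show "\<exists>g. emb g" using f unfolding emb_def by blast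
    qed (rule step)
    then obtain F where "\<forall>k. emb (F k) \<and> ((\<forall>x \<in> topspace X. \<gamma> x \<le> r k \<longrightarrow> F (Suc k) x = F k x) \<and>
      (\<forall>y \<in> topspace Y. \<gamma>' y \<le> r k \<longrightarrow> (\<exists>x \<in> topspace X. \<gamma> x \<le> r (Suc k) \<and> F (Suc k) x = y)))" ..
    then show thesis by (intro that[of F]) blast+
  qed
  have stable: "F k x = F j x" if "x \<in> topspace X" "\<gamma> x \<le> r j" "j \<le> k" for j k x
    using that(3)
  proof (induction k rule: dec_induct)
    case (step k)
    then show ?case using F(2)[OF that(1), of k] r_mono[OF step(1)] that(2) by simp
  qed simp
  define N where "N x = (LEAST k. \<gamma> x \<le> r k)" for x
  define G where "G x = F (N x) x" for x
  have N: "\<gamma> x \<le> r (N x)" if "x \<in> topspace X" for x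
    unfolding N_def using r_lim[of "\<gamma> x"] X.gauge_range[OF that] by (meson LeastI less_imp_le)
  have G: "G x = F k x" if "x \<in> topspace X" "\<gamma> x \<le> r k" for k x
    unfolding G_def using stable[OF that(1) N[OF that(1)], of k] that(2) by (simp add: N_def Least_le)
  let ?T = "\<lambda>k. {x \<in> topspace X. \<gamma> x < r k}"
  have cover: "\<exists>k. x \<in> ?T k" if "x \<in> topspace X" for x
    using r_lim[of "\<gamma> x"] X.gauge_range[OF that] that by auto
  have "homeomorphic_map X Y G"
  proof (rule bijective_open_imp_homeomorphic_map)
    show "continuous_map X Y G"
    proof (rule pasting_lemma[where I = UNIV and T = ?T and f = F])
      fix k
      show "openin X (?T k)" by (rule X.openin_sublevel)
      show "continuous_map (subtopology X (?T k)) Y (F k)"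
        using F(1) by (simp add: emb_def continuous_map_from_subtopology)
    next
      fix i j x assume "x \<in> topspace X \<inter> ?T i \<inter> ?T j"
      then show "F i x = F j x" using G[of x i] G[of x j] by simp
    next
      fix x assume x: "x \<in> topspace X"
      then obtain k where "x \<in> ?T k" using cover by blast
      then show "\<exists>j. j \<in> UNIV \<and> x \<in> ?T j \<and> G x = F j x" using G[of x k] by auto
    qed
    show "open_map X Y G"
      unfolding open_map_def
    proof (intro allI impI)
      fix U assume U: "openin X U"
      have "G ` U = (\<Union>k. F k ` (U \<inter> ?T k))"
      proof -
        have "G ` (U \<inter> ?T k) = F k ` (U \<inter> ?T k)" for k using G by (intro image_cong) auto
        moreover have "U = (\<Union>k. U \<inter> ?T k)" using cover openin_subset[OF U] by blast
        then have "G ` U = (\<Union>k. G ` (U \<inter> ?T k))" by blast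
        ultimately show ?thesis by simp
      qed
      moreover have "openin Y (F k ` (U \<inter> ?T k))" for k
        using F(1)[of k] openin_Int[OF U X.openin_sublevel] unfolding emb_def open_map_def by blast
      ultimately show "openin Y (G ` U)" by auto
    qed
    show "inj_on G (topspace X)"
    proof (rule inj_onI)
      fix x y assume xy: "x \<in> topspace X" "y \<in> topspace X" "G x = G y"
      define k where "k = max (N x) (N y)"
      have "\<gamma> x \<le> r k" "\<gamma> y \<le> r k"
        using N[OF xy(1)] N[OF xy(2)] r_mono[of "N x" k] r_mono[of "N y" k] by (auto simp: k_def)
      then have "F k x = F k y" using G[of x k] G[of y k] xy by simp
      then show "x = y" using F(1)[of k] xy by (simp add: emb_def inj_on_def)
    qed
    show "G ` topspace X = topspace Y"
    proof
      show "G ` topspace X \<subseteq> topspace Y"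
      proof
        fix y assume "y \<in> G ` topspace X"
        then obtain x where "x \<in> topspace X" "y = F (N x) x" by (auto simp: G_def)
        then show "y \<in> topspace Y"
          using F(1)[of "N x"] continuous_map_image_subset_topspace by (fastforce simp: emb_def)
      qed
      show "topspace Y \<subseteq> G ` topspace X"
      proof
        fix y assume y: "y \<in> topspace Y"
        then obtain k where "\<gamma>' y < r k" using r_lim[of "\<gamma>' y"] Y.gauge_range[OF y] by blast
        then have "\<gamma>' y \<le> r k" by simp
        then obtain x where "x \<in> topspace X" "\<gamma> x \<le> r (Suc k)" "F (Suc k) x = y" using F(3)[OF y] by blast
        then show "y \<in> G ` topspace X" using G[of x "Suc k"] by (intro image_eqI[of _ _ x]) auto
      qed
    qed
  qed
  then show ?thesis by (rule homeomorphic_map_imp_homeomorphic_space)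
qed

section \<open>Local models in Euclidean space\<close>

lemma Euclidean_space_eq: "Euclidean_space n = top_of_set {x. \<forall>i\<ge>n. x i = 0}"
  by (simp add: Euclidean_space_def euclidean_product_topology)

lemma open_ball3_eq: "open_ball3 = top_of_set {x. (\<forall>i\<ge>3. x i = 0) \<and> (\<Sum>i<3. x i ^ 2) < 1}"
  by (simp add: open_ball3_def Euclidean_space_eq subtopology_subtopology Collect_conj_eq)

lemma continuous_on_coordinate: "continuous_on A (\<lambda>x::nat \<Rightarrow> real. x i)"
  by (rule continuous_on_subset[OF continuous_on_product_coordinates]) simp

lemma open_cone_ball:
  "open_cone open_ball3 (\<lambda>_. 0) (\<lambda>x. sqrt (\<Sum>i<3. x i ^ 2)) (\<lambda>s x i. s * x i)"
proof
  let ?B = "{x :: nat \<Rightarrow> real. (\<forall>i\<ge>3. x i = 0) \<and> (\<Sum>i<3. x i ^ 2) < 1}"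
  let ?g = "\<lambda>x :: nat \<Rightarrow> real. sqrt (\<Sum>i<3. x i ^ 2)"
  have ts: "topspace open_ball3 = ?B" by (simp add: open_ball3_eq)
  have contg: "continuous_on A ?g" for A by (intro continuous_intros continuous_on_coordinate)
  have scale: "?g (\<lambda>i. s * x i) = s * ?g x" if "0 \<le> s" for s x
    using that by (simp add: power_mult_distrib real_sqrt_mult flip: sum_distrib_left)
  show "(\<lambda>_. 0) \<in> topspace open_ball3" "?g (\<lambda>_. 0) = 0" by (auto simp: ts)
  show "Hausdorff_space open_ball3" by (simp add: open_ball3_eq Hausdorff_space_subtopology)
  show "continuous_map open_ball3 euclideanreal ?g" by (simp add: open_ball3_eq contg)
  show "0 \<le> ?g x \<and> ?g x < 1" if "x \<in> topspace open_ball3" for x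
    using that by (simp add: ts sum_nonneg)
  show "x = (\<lambda>_. 0)" if "x \<in> topspace open_ball3" "?g x = 0" for x
  proof
    fix i
    have "x i = 0" if "i < 3" using that \<open>?g x = 0\<close> by (simp add: sum_nonneg_eq_0_iff)
    then show "x i = 0" using that(1) by (cases "i < 3") (auto simp: ts)
  qed
  show "compactin open_ball3 {x \<in> topspace open_ball3. ?g x \<le> r}" if "r < 1" for r
  proof -
    let ?K = "{x \<in> topspace open_ball3. ?g x \<le> r}"
    let ?P = "PiE UNIV (\<lambda>i. if i < (3::nat) then {-1..1::real} else {0})"
    have P: "x \<in> ?P \<longleftrightarrow> (\<forall>i. x i \<in> (if i < (3::nat) then {-1..1::real} else {0}))" for x
      by (simp add: PiE_UNIV_domain Pi_iff)
    have eq: "?K = ?P \<inter> {x. ?g x \<le> r}"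
    proof (intro equalityI subsetI)
      fix x assume x: "x \<in> ?K"
      have "\<bar>x i\<bar> \<le> 1" if "i < 3" for i
      proof -
        have "(x i)\<^sup>2 \<le> (\<Sum>i<3. (x i)\<^sup>2)" using that by (intro member_le_sum) auto
        also have "\<dots> \<le> 1" using x by (simp add: ts)
        finally show ?thesis by (simp add: abs_square_le_1)
      qed
      then have "x \<in> ?P" unfolding P using x by (auto simp: ts abs_le_iff)
      then show "x \<in> ?P \<inter> {x. ?g x \<le> r}" using x by simp
    next
      fix x assume x: "x \<in> ?P \<inter> {x. ?g x \<le> r}"
      then have r: "?g x \<le> r" and xi: "\<And>i. x i \<in> (if i < (3::nat) then {-1..1::real} else {0})"
        unfolding Int_iff P by auto
      have "?g x < 1" using that r by linarith
      then have "(\<Sum>i<3. (x i)\<^sup>2) < 1" by (simp add: real_sqrt_lt_1_iff del: real_sqrt_le_iff)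
      moreover have "x i = 0" if "i \<ge> 3" for i using xi[of i] that by simp
      ultimately show "x \<in> ?K" using r by (simp add: ts)
    qed
    have "compact ?P"
      using compactin_PiE[of "\<lambda>_. euclideanreal" UNIV "\<lambda>i. if i < (3::nat) then {-1..1::real} else {0}"]
      by (simp add: euclidean_product_topology)
    moreover have "closed {x. ?g x \<le> r}"
      using closed_Collect_le[OF contg continuous_on_const] by simp
    ultimately have "compact ?K" unfolding eq by (rule compact_Int_closed)
    then show ?thesis by (auto simp: open_ball3_eq compactin_subtopology)
  qed
  show "(\<lambda>i. s * x i) \<in> topspace open_ball3 \<and> ?g (\<lambda>i. s * x i) = s * ?g x"
    if "x \<in> topspace open_ball3" "0 < s" "s * ?g x < 1" for s x
    using that scale[of s x] by (simp add: ts) (metis real_sqrt_lt_1_iff)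
  show "(\<lambda>i. 1 * x i) = x" for x :: "nat \<Rightarrow> real" by simp
  show "(\<lambda>i. t * (s * x i)) = (\<lambda>i. t * s * x i)" for s t and x :: "nat \<Rightarrow> real" by (simp add: mult.assoc)
  show "continuous_map open_ball3 open_ball3 (\<lambda>x i. m (?g x) * x i)"
    if m: "continuous_on {0..<1} m" "\<And>r. r \<in> {0..<1} \<Longrightarrow> 0 < m r \<and> r * m r < 1" for m
  proof -
    have r: "?g x \<in> {0..<1}" if "x \<in> ?B" for x using that by (simp add: sum_nonneg)
    have "continuous_on ?B (\<lambda>x. m (?g x))"
      by (rule continuous_on_compose2[OF m(1) contg]) (use r in auto)
    then have "continuous_on ?B (\<lambda>x i. m (?g x) * x i)"
      by (intro continuous_on_coordinatewise_then_product continuous_intros continuous_on_coordinate) 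
    moreover have "(\<lambda>i. m (?g x) * x i) \<in> ?B" if x: "x \<in> ?B" for x
    proof -
      have "?g (\<lambda>i. m (?g x) * x i) < 1"
        using m(2)[OF r[OF x]] scale[of "m (?g x)" x] by (simp add: mult.commute)
      then show ?thesis using x by simp
    qed
    ultimately show ?thesis by (auto simp: open_ball3_eq)
  qed
qed

text \<open>
  In the product topology a neighbourhood of the origin contains a box in finitely many
  coordinates, and the other coordinates vanish on \<open>Euclidean_space n\<close>.
\<close>

lemma box_neighbourhood:
  assumes "openin (Euclidean_space n) V" "(\<lambda>_. 0) \<in> V"
  obtains e where "0 < e" "{x \<in> topspace (Euclidean_space n). \<forall>i<n. \<bar>x i\<bar> < e} \<subseteq> V"
proof -
  obtain W where W: "openin (powertop_real UNIV) W" "V = W \<inter> {x. \<forall>i\<ge>n. x i = 0}"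
    using assms(1) by (auto simp: Euclidean_space_def openin_subtopology)
  have "(\<lambda>_. 0) \<in> W" using assms(2) W(2) by auto
  then obtain U where U: "\<And>i. open (U i)" "(\<lambda>_. 0) \<in> PiE UNIV U" "PiE UNIV U \<subseteq> W"
    using W(1) unfolding openin_product_topology_alt by force
  have "\<exists>d>0. \<forall>t. \<bar>t\<bar> < d \<longrightarrow> t \<in> U i" for i
  proof -
    have "0 \<in> U i" using U(2) by (auto simp: PiE_UNIV_domain)
    then show ?thesis using U(1)[of i] unfolding open_dist by (force simp: dist_real_def)
  qed
  then obtain d where d: "\<And>i. 0 < d i" "\<And>i t. \<bar>t\<bar> < d i \<Longrightarrow> t \<in> U i" by metis
  show thesis
  proof (rule that)
    let ?e = "Min (insert 1 (d ` {..<n}))"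
    show "0 < ?e" using d(1) by (subst Min_gr_iff) auto
    show "{x \<in> topspace (Euclidean_space n). \<forall>i<n. \<bar>x i\<bar> < ?e} \<subseteq> V"
    proof
      fix x assume x: "x \<in> {x \<in> topspace (Euclidean_space n). \<forall>i<n. \<bar>x i\<bar> < ?e}"
      have "x i \<in> U i" for i
      proof (cases "i < n")
        case True
        then have "\<bar>x i\<bar> < ?e" using x by simp
        also have "?e \<le> d i" using True by (intro Min_le) auto
        finally show ?thesis by (rule d(2))
      next
        case False
        then show ?thesis using x d(1) by (intro d(2)) (auto simp: topspace_Euclidean_space)
      qed
      then have "x \<in> PiE UNIV U" by (simp add: PiE_UNIV_domain)
      then show "x \<in> V" using U(3) x W(2) by (auto simp: topspace_Euclidean_space)
    qed
  qed
qed

lemma box_homeomorphic: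
  fixes e :: real
  assumes "0 < e"
  shows "homeomorphic_map (subtopology (Euclidean_space n) {x. \<forall>i<n. \<bar>x i\<bar> < e}) (Euclidean_space n)
           (\<lambda>x i. tan (pi / (2 * e) * x i))"
proof -
  let ?E = "{x :: nat \<Rightarrow> real. \<forall>i\<ge>n. x i = 0}" and ?B = "{x. \<forall>i<n. \<bar>x i\<bar> < e}"
  let ?f = "\<lambda>(x :: nat \<Rightarrow> real) i. tan (pi / (2 * e) * x i)"
  let ?g = "\<lambda>(x :: nat \<Rightarrow> real) i. 2 * e / pi * arctan (x i)"
  have rng: "- (pi/2) < pi / (2 * e) * x i \<and> pi / (2 * e) * x i < pi/2" if "x \<in> ?E \<inter> ?B" for x i
  proof -
    have "\<bar>x i\<bar> < e" using that assms by (cases "i < n") auto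
    then have "pi / (2 * e) * \<bar>x i\<bar> < pi / (2 * e) * e" using assms by (intro mult_strict_left_mono) auto
    then have "\<bar>pi / (2 * e) * x i\<bar> < pi / 2" using assms by (simp add: abs_mult)
    then show ?thesis by linarith
  qed
  have "continuous_on (?E \<inter> ?B) (\<lambda>x. tan (pi / (2 * e) * x i))" for i
  proof -
    have "cos (pi / (2 * e) * x i) \<noteq> 0" if "x \<in> ?E \<inter> ?B" for x
      using cos_gt_zero_pi[of "pi / (2 * e) * x i"] rng[OF that, of i] by auto
    moreover have "continuous_on (?E \<inter> ?B) (\<lambda>x. sin (pi / (2 * e) * x i))"
      "continuous_on (?E \<inter> ?B) (\<lambda>x. cos (pi / (2 * e) * x i))"
      by (intro continuous_on_sin continuous_on_cos continuous_on_mult continuous_on_const continuous_on_coordinate)+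
    ultimately show ?thesis unfolding tan_def using continuous_on_divide by blast
  qed
  then have cf: "continuous_on (?E \<inter> ?B) ?f"
    by (rule continuous_on_coordinatewise_then_product)
  have cg: "continuous_on ?E ?g"
    by (intro continuous_on_coordinatewise_then_product continuous_intros continuous_on_coordinate)
  have gf: "?g (?f x) = x" if "x \<in> ?E \<inter> ?B" for x
  proof
    fix i show "?g (?f x) i = x i" using rng[OF that, of i] assms by (simp add: arctan_tan)
  qed
  have fg: "?f (?g x) = x" if "x \<in> ?E" for x
    using assms by (simp add: tan_arctan)
  have gB: "?g x \<in> ?E \<inter> ?B" if "x \<in> ?E" for x
  proof -
    have "\<bar>arctan (x i)\<bar> < pi / 2" for i using arctan_lbound[of "x i"] arctan_ubound[of "x i"] by linarith
    then have "2 * e / pi * \<bar>arctan (x i)\<bar> < 2 * e / pi * (pi / 2)" for i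
      using assms by (intro mult_strict_left_mono) auto
    then have "\<bar>?g x i\<bar> < e" for i using assms by (simp add: abs_mult)
    then show ?thesis using that by simp
  qed
  have "homeomorphic_maps (top_of_set (?E \<inter> ?B)) (top_of_set ?E) ?f ?g"
    unfolding homeomorphic_maps_def using cf cg gf fg gB by auto
  then show ?thesis
    by (simp add: Euclidean_space_eq subtopology_subtopology homeomorphic_maps_map)
qed

text \<open>
  Invariance of domain, transported from Euclidean space by the charts of \<open>M\<close>.
\<close>

lemma locally_Euclidean_injective_open:
  assumes M: "closed_manifold n M" and U: "openin M U"
    and f: "continuous_map (subtopology M U) (Euclidean_space n) f" "inj_on f U"
  shows "openin (Euclidean_space n) (f ` U)"
proof -
  have "\<exists>T. openin (Euclidean_space n) T \<and> f x \<in> T \<and> T \<subseteq> f ` U" if x: "x \<in> U" for x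
  proof -
    have "x \<in> topspace M" using x openin_subset[OF U] by blast
    then obtain V where V: "openin M V" "x \<in> V" "subtopology M V homeomorphic_space Euclidean_space n"
      using M unfolding closed_manifold_def by blast
    then obtain h g where hg: "homeomorphic_maps (subtopology M V) (Euclidean_space n) h g"
      by (auto simp: homeomorphic_space_def)
    have tV: "topspace (subtopology M V) = V" using openin_subset[OF V(1)] by auto
    let ?W = "h ` (U \<inter> V)"
    have UV: "openin (subtopology M V) (U \<inter> V)" using U by (simp add: openin_subtopology_Int)
    have oW: "openin (Euclidean_space n) ?W"
      using hg UV homeomorphic_imp_open_map homeomorphic_maps_imp_map unfolding open_map_def by blast
    have gh: "g (h y) = y" if "y \<in> V" for y using hg that tV by (simp add: homeomorphic_maps_def)
    have im: "(f \<circ> g) ` ?W = f ` (U \<inter> V)" using gh by (force simp: image_iff)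
    have "continuous_map (subtopology (Euclidean_space n) ?W) (Euclidean_space n) (f \<circ> g)"
    proof (rule continuous_map_compose[OF _ f(1)])
      have "continuous_map (Euclidean_space n) M g"
        using hg continuous_map_into_fulltopology unfolding homeomorphic_maps_def by blast
      then show "continuous_map (subtopology (Euclidean_space n) ?W) (subtopology M U) g"
        using gh by (auto simp: continuous_map_in_subtopology continuous_map_from_subtopology)
    qed
    moreover have "inj_on (f \<circ> g) ?W"
      using f(2) gh by (auto simp: inj_on_def)
    ultimately have "openin (Euclidean_space n) ((f \<circ> g) ` ?W)"
      by (rule invariance_of_domain_Euclidean_space[OF oW])
    then show ?thesis unfolding im using x V(2) by (intro exI[of _ "f ` (U \<inter> V)"]) auto
  qed
  then show ?thesis by (subst openin_subopen) blast
qed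

text \<open>
  Invariance of domain makes an injective continuous map into Euclidean space an open embedding. A
  box in its image, stretched coordinatewise by the tangent function, gives a chart onto the whole
  space with the same coordinate planes. In this way charts need no explicit inverse and no
  surjectivity.
\<close>

lemma chart_from_injection:
  assumes M: "closed_manifold n M" and U0: "openin M U0" "p \<in> U0"
    and f: "continuous_map (subtopology M U0) (Euclidean_space n) f" "inj_on f U0" "f p = (\<lambda>_. 0)"
  obtains U \<phi> where "openin M U" "U \<subseteq> U0" "p \<in> U"
    "homeomorphic_map (subtopology M U) (Euclidean_space n) \<phi>" "\<phi> p = (\<lambda>_. 0)"
    "\<And>x i. x \<in> U \<Longrightarrow> \<phi> x i = 0 \<longleftrightarrow> f x i = 0"
proof -
  have tU0: "topspace (subtopology M U0) = U0" using openin_subset[OF U0(1)] by auto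
  have fE: "f x \<in> topspace (Euclidean_space n)" if "x \<in> U0" for x
    using continuous_map_image_subset_topspace[OF f(1)] that tU0 by auto
  have "openin (Euclidean_space n) (f ` U0)"
    by (rule locally_Euclidean_injective_open[OF M U0(1) f(1,2)])
  moreover have "(\<lambda>_. 0) \<in> f ` U0" using U0(2) f(3) by force
  ultimately obtain e where e: "0 < e" "{x \<in> topspace (Euclidean_space n). \<forall>i<n. \<bar>x i\<bar> < e} \<subseteq> f ` U0"
    by (rule box_neighbourhood)
  define B where "B = {x :: nat \<Rightarrow> real. \<forall>i<n. \<bar>x i\<bar> < e}"
  define U where "U = {x \<in> U0. f x \<in> B}"
  define tn where "tn = (\<lambda>(x :: nat \<Rightarrow> real) i. tan (pi / (2 * e) * x i))"
  have chi: "homeomorphic_map (subtopology (Euclidean_space n) B) (Euclidean_space n) tn"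
    unfolding B_def tn_def by (rule box_homeomorphic[OF e(1)])
  have "openin (Euclidean_space n) (topspace (Euclidean_space n) \<inter> B)"
  proof -
    have "B = (\<Inter>i<n. {x. \<bar>x i\<bar> < e})" by (auto simp: B_def)
    moreover have "open {x :: nat \<Rightarrow> real. \<bar>x i\<bar> < e}" for i
      by (intro open_Collect_less continuous_intros continuous_on_coordinate)
    ultimately have "open B" by (simp add: open_INT)
    then show ?thesis by (auto simp: Euclidean_space_eq openin_open)
  qed
  then have "openin (subtopology M U0) {x \<in> topspace (subtopology M U0). f x \<in> topspace (Euclidean_space n) \<inter> B}"
    by (rule openin_continuous_map_preimage[OF f(1)])
  moreover have "{x \<in> topspace (subtopology M U0). f x \<in> topspace (Euclidean_space n) \<inter> B} = U"
    using fE tU0 by (auto simp: U_def)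
  ultimately have oU: "openin M U" using U0(1) openin_trans_full by metis
  have tU: "topspace (subtopology M U) = U" using openin_subset[OF oU] by auto
  have hf: "homeomorphic_map (subtopology M U) (subtopology (Euclidean_space n) B) f"
  proof (rule bijective_open_imp_homeomorphic_map)
    show "continuous_map (subtopology M U) (subtopology (Euclidean_space n) B) f"
    proof -
      have "continuous_map (subtopology (subtopology M U0) U) (Euclidean_space n) f"
        by (rule continuous_map_from_subtopology[OF f(1)])
      moreover have "subtopology (subtopology M U0) U = subtopology M U"
        by (simp add: subtopology_subtopology U_def Int_absorb1)
      ultimately show ?thesis by (auto simp: continuous_map_in_subtopology U_def)
    qed
    show "open_map (subtopology M U) (subtopology (Euclidean_space n) B) f"
      unfolding open_map_def
    proof (intro allI impI)
      fix V assume "openin (subtopology M U) V"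
      then have V: "openin M V" "V \<subseteq> U" using oU openin_open_subtopology by blast+
      have "continuous_map (subtopology M V) (Euclidean_space n) f"
      proof -
        have "continuous_map (subtopology (subtopology M U0) V) (Euclidean_space n) f"
          by (rule continuous_map_from_subtopology[OF f(1)])
        moreover have "U0 \<inter> V = V" using V(2) by (auto simp: U_def)
        ultimately show ?thesis by (simp add: subtopology_subtopology)
      qed
      moreover have "inj_on f V" using f(2) V(2) by (auto simp: U_def inj_on_def)
      ultimately have "openin (Euclidean_space n) (f ` V)"
        by (rule locally_Euclidean_injective_open[OF M V(1)])
      moreover have "f ` V \<subseteq> B" using V(2) by (auto simp: U_def)
      ultimately show "openin (subtopology (Euclidean_space n) B) (f ` V)"
        by (simp add: openin_subtopology) (metis inf.absorb1)
    qed
    show "f ` topspace (subtopology M U) = topspace (subtopology (Euclidean_space n) B)"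
      unfolding tU using e(2) fE by (auto simp: U_def B_def)
    show "inj_on f (topspace (subtopology M U))" using f(2) by (auto simp: tU U_def inj_on_def)
  qed
  show thesis
  proof
    show "openin M U" by (rule oU)
    show "U \<subseteq> U0" by (auto simp: U_def)
    show "p \<in> U" using U0(2) f(3) e(1) by (simp add: U_def B_def)
    show "homeomorphic_map (subtopology M U) (Euclidean_space n) (tn \<circ> f)"
      by (rule homeomorphic_map_compose[OF hf chi])
    show "(tn \<circ> f) p = (\<lambda>_. 0)" using f(3) by (simp add: tn_def)
    fix x i assume x: "x \<in> U"
    show "(tn \<circ> f) x i = 0 \<longleftrightarrow> f x i = 0"
    proof (cases "i < n")
      case True
      then have "\<bar>f x i\<bar> < e" using x by (simp add: U_def B_def)
      then have "pi / (2 * e) * \<bar>f x i\<bar> < pi / (2 * e) * e" using e(1) by (intro mult_strict_left_mono) auto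
      then have "\<bar>pi / (2 * e) * f x i\<bar> < pi / 2" using e(1) by (simp add: abs_mult)
      then have "arctan (tan (pi / (2 * e) * f x i)) = pi / (2 * e) * f x i"
        by (intro arctan_tan) linarith+
      then show ?thesis using e(1) by (auto simp: tn_def)
    next
      case False
      then show ?thesis using fE x by (auto simp: tn_def U_def topspace_Euclidean_space)
    qed
  qed
qed

lemma centred_chart:
  assumes M: "closed_manifold n M" and U0: "openin M U0" "p \<in> U0"
  obtains U \<phi> where "openin M U" "U \<subseteq> U0" "p \<in> U"
    "homeomorphic_map (subtopology M U) (Euclidean_space n) \<phi>" "\<phi> p = (\<lambda>_. 0)"
proof -
  have "p \<in> topspace M" using U0 openin_subset by blast
  then obtain V where V: "openin M V" "p \<in> V" "subtopology M V homeomorphic_space Euclidean_space n"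
    using M unfolding closed_manifold_def by blast
  then obtain h where h: "homeomorphic_map (subtopology M V) (Euclidean_space n) h"
    using homeomorphic_space by blast
  have tV: "topspace (subtopology M V) = V" using openin_subset[OF V(1)] by auto
  let ?f = "\<lambda>x i. h x i - h p i"
  have hE: "h x \<in> topspace (Euclidean_space n)" if "x \<in> V" for x
    using homeomorphic_imp_surjective_map[OF h] that tV by auto
  have "continuous_map (subtopology M V) (Euclidean_space n) ?f"
    using homeomorphic_imp_continuous_map[OF h] hE[OF V(2)]
    by (intro continuous_map_Euclidean_space_diff) auto
  then have "continuous_map (subtopology (subtopology M V) (V \<inter> U0)) (Euclidean_space n) ?f"
    by (rule continuous_map_from_subtopology)
  then have cf: "continuous_map (subtopology M (V \<inter> U0)) (Euclidean_space n) ?f"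
    by (simp add: subtopology_subtopology)
  have inj: "inj_on ?f (V \<inter> U0)"
    using homeomorphic_imp_injective_map[OF h] tV by (auto simp: inj_on_def fun_eq_iff)
  have VR: "openin M (V \<inter> U0)" using V(1) U0(1) by blast
  have pf: "p \<in> V \<inter> U0" "?f p = (\<lambda>_. 0)" using V(2) U0(2) by auto
  obtain U \<phi> where U: "openin M U" "U \<subseteq> V \<inter> U0" "p \<in> U"
    "homeomorphic_map (subtopology M U) (Euclidean_space n) \<phi>" "\<phi> p = (\<lambda>_. 0)"
    by (rule chart_from_injection[OF M VR pf(1) cf inj pf(2)]) (rule that)
  show thesis by (rule that[OF U(1) _ U(3-5)]) (use U(2) in blast)
qed

lemma coordinate_plane_homeomorphic:
  assumes "i < 3"
  shows "subtopology (Euclidean_space 3) {x. x i = 0} homeomorphic_space Euclidean_space 2"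
proof -
  let ?f = "\<lambda>(x :: nat \<Rightarrow> real) j. x (if j < i then j else Suc j)"
  let ?g = "\<lambda>(x :: nat \<Rightarrow> real) j. if j < i then x j else if j = i then 0 else x (j - 1)"
  let ?P = "{x :: nat \<Rightarrow> real. \<forall>i\<ge>3. x i = 0} \<inter> {x. x i = 0}" and ?E = "{x :: nat \<Rightarrow> real. \<forall>i\<ge>2. x i = 0}"
  have cf: "continuous_on ?P ?f"
    by (intro continuous_on_coordinatewise_then_product continuous_on_coordinate)
  have cg: "continuous_on ?E ?g"
  proof (intro continuous_on_coordinatewise_then_product)
    fix j show "continuous_on ?E (\<lambda>x. ?g x j)"
      by (cases "j < i"; cases "j = i") (auto intro: continuous_on_coordinate)
  qed
  have "homeomorphic_maps (top_of_set ?P) (top_of_set ?E) ?f ?g"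
    unfolding homeomorphic_maps_def using cf cg assms by (auto simp: fun_eq_iff)
  then show ?thesis
    by (auto simp: Euclidean_space_eq subtopology_subtopology homeomorphic_space_def)
qed

lemma second_countable_prod_topology:
  assumes "second_countable X" "second_countable Y"
  shows "second_countable (prod_topology X Y)"
proof -
  obtain A where A: "countable A" "\<forall>V \<in> A. openin X V"
    "\<forall>U x. openin X U \<and> x \<in> U \<longrightarrow> (\<exists>V \<in> A. x \<in> V \<and> V \<subseteq> U)"
    using assms(1) unfolding second_countable_def by (elim exE conjE)
  obtain B where B: "countable B" "\<forall>V \<in> B. openin Y V"
    "\<forall>U x. openin Y U \<and> x \<in> U \<longrightarrow> (\<exists>V \<in> B. x \<in> V \<and> V \<subseteq> U)"
    using assms(2) unfolding second_countable_def by (elim exE conjE)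
  let ?C = "(\<lambda>(U, V). U \<times> V) ` (A \<times> B)"
  show ?thesis
    unfolding second_countable_def
  proof (intro exI[of _ ?C] conjI ballI allI impI)
    show "countable ?C" using A(1) B(1) by simp
    show "openin (prod_topology X Y) V" if "V \<in> ?C" for V
      using that A(2) B(2) by (auto simp: openin_prod_Times_iff)
    fix U z assume "openin (prod_topology X Y) U \<and> z \<in> U"
    then have U: "openin (prod_topology X Y) U" "(fst z, snd z) \<in> U" by auto
    obtain V W where VW: "openin X V" "openin Y W" "fst z \<in> V" "snd z \<in> W" "V \<times> W \<subseteq> U"
      using iffD1[OF openin_prod_topology_alt U(1), rule_format, OF U(2)] by auto
    obtain V' where "V' \<in> A" "fst z \<in> V'" "V' \<subseteq> V" using A(3) VW(1,3) by blast
    moreover obtain W' where "W' \<in> B" "snd z \<in> W'" "W' \<subseteq> W" using B(3) VW(2,4) by blast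
    ultimately show "\<exists>V \<in> ?C. z \<in> V \<and> V \<subseteq> U"
      using VW(5) by (intro bexI[of _ "V' \<times> W'"]) (auto simp: mem_Times_iff)
  qed
qed

section \<open>Points of a triangulation\<close>

abbreviation simplex3 :: "(nat \<Rightarrow> real) set" ("\<Delta>") where "\<Delta> \<equiv> standard_simplex 3"

lemma atMost_3: "{..3::nat} = {0, 1, 2, 3}" by auto

lemma simplex3_iff: "x \<in> \<Delta> \<longleftrightarrow> (\<forall>i. 0 \<le> x i) \<and> (\<forall>i>3. x i = 0) \<and> (\<Sum>i\<le>3. x i) = 1"
proof -
  have "x i \<le> 1" if x: "\<forall>i. 0 \<le> x i" "\<forall>i>3. x i = 0" "(\<Sum>i\<le>3. x i) = 1" for i
  proof (cases "i \<le> 3")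
    case True
    then have "x i \<le> (\<Sum>i\<le>3. x i)" using x(1) by (intro member_le_sum) auto
    then show ?thesis using x(3) by simp
  next
    case False
    then show ?thesis using x(2) by simp
  qed
  then show ?thesis by (auto simp: standard_simplex_def)
qed

lemma simplex3_permute:
  assumes "\<sigma> permutes {..3}"
  shows "x \<circ> \<sigma> \<in> \<Delta> \<longleftrightarrow> x \<in> \<Delta>"
proof -
  have s: "(\<Sum>i\<le>3. (x \<circ> \<sigma>) i) = (\<Sum>i\<le>3. x i)"
    using sum.permute[OF assms, of x] by simp
  have 1: "(\<forall>i. 0 \<le> (x \<circ> \<sigma>) i) \<longleftrightarrow> (\<forall>i. 0 \<le> x i)"
    using permutes_inverses(1)[OF assms] by (metis comp_apply)
  have 2: "(\<forall>i>3. (x \<circ> \<sigma>) i = 0) \<longleftrightarrow> (\<forall>i>3. x i = 0)"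
    using permutes_not_in[OF assms] by (simp add: not_le)
  show ?thesis unfolding simplex3_iff s 1 2 ..
qed

lemma permutes_le3: "\<sigma> permutes {..3} \<Longrightarrow> \<sigma> i \<le> 3 \<longleftrightarrow> i \<le> (3::nat)"
  using permutes_in_image[of \<sigma> "{..3}" i] by simp

lemma tetrahedra_eq: "tetrahedra n = sum_topology (\<lambda>_. top_of_set \<Delta>) {..<n}"
  by (simp add: tetrahedra_def euclidean_product_topology)

lemma topspace_tetrahedra: "topspace (tetrahedra n) = {..<n} \<times> \<Delta>"
  by (auto simp: tetrahedra_eq)

lemma openin_tetrahedra:
  "openin (tetrahedra n) W \<longleftrightarrow> W \<subseteq> {..<n} \<times> \<Delta> \<and> (\<forall>a<n. openin (top_of_set \<Delta>) {x. (a, x) \<in> W})"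
  unfolding tetrahedra_eq openin_sum_topology by (auto simp: o_def)

lemma openin_piece:
  assumes "a < n" "openin (top_of_set \<Delta>) P"
  shows "openin (tetrahedra n) ({a} \<times> P)"
proof -
  have "{x. (b, x) \<in> {a} \<times> P} = (if b = a then P else {})" for b by auto
  then show ?thesis using assms openin_subset[OF assms(2)] by (auto simp: openin_tetrahedra)
qed

lemma continuous_snd_tetrahedra: "continuous_map (tetrahedra n) (top_of_set \<Delta>) snd"
proof -
  have "openin (tetrahedra n) {u \<in> topspace (tetrahedra n). snd u \<in> U}" if "openin (top_of_set \<Delta>) U" for U
  proof -
    have "{x. (a, x) \<in> {u \<in> topspace (tetrahedra n). snd u \<in> U}} = U" if "a < n" for a
      using \<open>a < n\<close> openin_subset[OF \<open>openin (top_of_set \<Delta>) U\<close>] by (auto simp: topspace_tetrahedra)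
    then show ?thesis using that by (auto simp: openin_tetrahedra topspace_tetrahedra)
  qed
  then show ?thesis by (auto simp: continuous_map_def topspace_tetrahedra)
qed

lemma continuous_on_piece:
  assumes "continuous_map (top_of_set P) Z (\<lambda>x. f (a, x))" "P \<subseteq> \<Delta>"
  shows "continuous_map (subtopology (tetrahedra n) ({a} \<times> P)) Z f"
proof -
  have "continuous_map (subtopology (tetrahedra n) ({a} \<times> P)) (top_of_set P) snd"
  proof -
    have "continuous_map (subtopology (tetrahedra n) ({a} \<times> P)) (top_of_set \<Delta>) snd"
      by (rule continuous_map_from_subtopology[OF continuous_snd_tetrahedra])
    then have "continuous_map (subtopology (tetrahedra n) ({a} \<times> P)) (subtopology (top_of_set \<Delta>) P) snd"
      by (auto simp: continuous_map_in_subtopology)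
    then show ?thesis using assms(2) by (simp add: subtopology_subtopology Int_absorb1)
  qed
  \<comment> \<open>The map \<open>f\<close> factors through \<open>snd\<close> on a set with constant first component.\<close>
  from continuous_map_compose[OF this assms(1)] show ?thesis
    by (rule continuous_map_eq) auto
qed

lemma continuous_injection:
  assumes "a < n"
  shows "continuous_map (top_of_set \<Delta>) (tetrahedra n) (Pair a)"
  unfolding tetrahedra_eq using assms continuous_map_component_injection[of a "{..<n}"] by auto

lemma compact_simplex3: "compact \<Delta>"
  using compactin_standard_simplex[of 3] by (simp add: euclidean_product_topology)

locale triangulation =
  fixes M :: "'a topology" and n :: nat and G :: gluing and q :: "nat \<times> (nat \<Rightarrow> real) \<Rightarrow> 'a"
  assumes manifold: "closed_manifold 3 M"
    and pairing: "face_pairing n G"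
    and quotient: "quotient_map (tetrahedra n) M q"
    and kernel: "\<And>u v. u \<in> topspace (tetrahedra n) \<Longrightarrow> v \<in> topspace (tetrahedra n) \<Longrightarrow>
                   q u = q v \<longleftrightarrow> equivclp (glued_points n G) u v"
begin

lemma Hausdorff: "Hausdorff_space M"
  using manifold by (simp add: closed_manifold_def)

lemma pairingD:
  assumes "G (a, i) = (b, \<sigma>)" "a < n" "i \<le> 3"
  shows "b < n" "\<sigma> permutes {..3}" "(b, \<sigma> i) \<noteq> (a, i)" "G (b, \<sigma> i) = (a, inv_into UNIV \<sigma>)" "\<sigma> i \<le> 3"
proof -
  show *: "b < n" "\<sigma> permutes {..3}" "(b, \<sigma> i) \<noteq> (a, i)" "G (b, \<sigma> i) = (a, inv_into UNIV \<sigma>)"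
    using pairing assms unfolding face_pairing_def by blast+
  show "\<sigma> i \<le> 3" using permutes_le3[OF *(2)] assms(3) by simp
qed

lemma q_continuous: "continuous_map (tetrahedra n) M q"
  by (rule quotient_imp_continuous_map[OF quotient])

lemma q_in: "a < n \<Longrightarrow> x \<in> \<Delta> \<Longrightarrow> q (a, x) \<in> topspace M"
  using continuous_map_image_subset_topspace[OF q_continuous] by (auto simp: topspace_tetrahedra)

lemma q_surj:
  assumes "m \<in> topspace M"
  obtains a x where "a < n" "x \<in> \<Delta>" "m = q (a, x)"
proof -
  have "m \<in> q ` ({..<n} \<times> \<Delta>)"
    using quotient_imp_surjective_map[OF quotient] assms by (simp add: topspace_tetrahedra)
  then show thesis using that by auto
qed

lemma glued_iff:
  "glued_points n G (a, x) (b, y) \<longleftrightarrow>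
     a < n \<and> x \<in> \<Delta> \<and> (\<exists>i \<sigma>. i \<le> 3 \<and> x i = 0 \<and> G (a, i) = (b, \<sigma>) \<and> y = x \<circ> inv_into UNIV \<sigma>)" (is "?L = ?R")
proof
  assume ?L
  then obtain i \<sigma> where h: "a < n" "i \<le> 3" "G (a, i) = (b, \<sigma>)" "x \<in> \<Delta>" "x i = 0" "x = y \<circ> \<sigma>"
    unfolding glued_points_def by auto
  have "x \<circ> inv_into UNIV \<sigma> = y" unfolding h(6) using permutes_inverses(1)[OF pairingD(2)[OF h(3,1,2)]] by (auto simp: fun_eq_iff)
  then show ?R using h by auto
next
  assume ?R
  then obtain i \<sigma> where h: "a < n" "x \<in> \<Delta>" "i \<le> 3" "x i = 0" "G (a, i) = (b, \<sigma>)" "y = x \<circ> inv_into UNIV \<sigma>" by auto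
  have "y \<circ> \<sigma> = x" unfolding h(6) using permutes_inverses(2)[OF pairingD(2)[OF h(5,1,3)]] by (auto simp: fun_eq_iff)
  then show ?L unfolding glued_points_def using h by blast
qed

lemma q_glued:
  assumes "a < n" "x \<in> \<Delta>" "i \<le> 3" "x i = 0" "G (a, i) = (b, \<sigma>)"
  shows "q (a, x) = q (b, x \<circ> inv_into UNIV \<sigma>)" "x \<circ> inv_into UNIV \<sigma> \<in> \<Delta>"
proof -
  note p = pairingD[OF assms(5,1,3)]
  show *: "x \<circ> inv_into UNIV \<sigma> \<in> \<Delta>" using assms(2) permutes_inv[OF p(2)] by (simp add: simplex3_permute)
  have "glued_points n G (a, x) (b, x \<circ> inv_into UNIV \<sigma>)" using assms by (auto simp: glued_iff)
  then show "q (a, x) = q (b, x \<circ> inv_into UNIV \<sigma>)"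
    using assms * p(1) by (subst kernel) (auto simp: topspace_tetrahedra intro: r_into_equivclp)
qed

text \<open>The only way in which points of \<open>M\<close> get several representatives is through faces.\<close>

lemma q_invariant:
  assumes "\<And>a x i b \<sigma>. a < n \<Longrightarrow> x \<in> \<Delta> \<Longrightarrow> i \<le> 3 \<Longrightarrow> x i = 0 \<Longrightarrow> G (a, i) = (b, \<sigma>) \<Longrightarrow>
      F (a, x) = F (b, x \<circ> inv_into UNIV \<sigma>)"
    and "u \<in> {..<n} \<times> \<Delta>" "v \<in> {..<n} \<times> \<Delta>" "q u = q v"
  shows "F u = F v"
proof -
  have g: "F w = F z" if "glued_points n G w z" for w z
    using that assms(1) by (cases w; cases z) (auto simp: glued_iff)
  have "equivclp (glued_points n G) u v" using kernel assms(2-4) by (simp add: topspace_tetrahedra)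
  then show ?thesis
  proof (induction rule: equivclp_induct)
    case (step y z)
    then show ?case using g[of y z] g[of z y] by auto
  qed simp
qed

text \<open>
  Open sets of \<open>M\<close> are obtained from open sets of tetrahedra that are compatible with the gluing of
  faces, and functions on them may be defined and checked for continuity on the tetrahedra.
\<close>

lemma open_saturated_image:
  assumes N: "openin (tetrahedra n) N"
    and sat: "\<And>a x i b \<sigma>. a < n \<Longrightarrow> x \<in> \<Delta> \<Longrightarrow> i \<le> 3 \<Longrightarrow> x i = 0 \<Longrightarrow> G (a, i) = (b, \<sigma>) \<Longrightarrow>
      (a, x) \<in> N \<longleftrightarrow> (b, x \<circ> inv_into UNIV \<sigma>) \<in> N"
  shows "openin M (q ` N)" "quotient_map (subtopology (tetrahedra n) N) (subtopology M (q ` N)) q"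
    "\<And>u. u \<in> {..<n} \<times> \<Delta> \<Longrightarrow> q u \<in> q ` N \<longleftrightarrow> u \<in> N"
proof -
  have sub: "N \<subseteq> {..<n} \<times> \<Delta>" using openin_subset[OF N] by (simp add: topspace_tetrahedra)
  show iff: "q u \<in> q ` N \<longleftrightarrow> u \<in> N" if "u \<in> {..<n} \<times> \<Delta>" for u
  proof
    assume "q u \<in> q ` N"
    then obtain v where v: "v \<in> N" "q u = q v" by auto
    have "(u \<in> N) = (v \<in> N)"
      by (rule q_invariant[of "\<lambda>u. u \<in> N"]) (use sat that v sub in auto)
    then show "u \<in> N" using v by simp
  qed simp
  have eq: "{u \<in> topspace (tetrahedra n). q u \<in> q ` N} = N"
    using iff sub by (auto simp: topspace_tetrahedra)
  have "q ` N \<subseteq> topspace M" using sub q_in by auto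
  then have "openin (tetrahedra n) {u \<in> topspace (tetrahedra n). q u \<in> q ` N} = openin M (q ` N)"
    using quotient unfolding quotient_map_def by blast
  then show o: "openin M (q ` N)" using N eq by simp
  show "quotient_map (subtopology (tetrahedra n) N) (subtopology M (q ` N)) q"
    by (rule quotient_map_restriction[OF quotient eq]) (use o in simp)
qed

end

section \<open>The complement of the level triangles\<close>

text \<open>
  Let \<open>A\<close> be a proper subset of \<open>{0, 1, 2, 3}\<close>. The points whose coordinates in \<open>A\<close> are below \<open>1/8\<close> and
  whose other coordinates are above \<open>1/8\<close> form a convex cell, relatively open in the tetrahedron. It contains the barycentre of the face
  on which the coordinates in \<open>A\<close> vanish (\<open>cell_centre\<close>), whose other coordinates have the common
  value \<open>cell_height\<close>. The gauge is the Minkowski functional of the cell with respect to this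
  centre, cut out by the four inequalities of \<open>cell_term\<close>.
\<close>

definition cell_height :: "nat set \<Rightarrow> real" where
  "cell_height A = 1 / (4 - real (card A))"

definition cell_centre :: "nat set \<Rightarrow> nat \<Rightarrow> real" where
  "cell_centre A j = (if j \<le> 3 \<and> j \<notin> A then cell_height A else 0)"

definition cell_term :: "nat set \<Rightarrow> (nat \<Rightarrow> real) \<Rightarrow> nat \<Rightarrow> real" where
  "cell_term A x j = (if j \<in> A then 8 * x j else (cell_height A - x j) / (cell_height A - 1/8))"

definition cell_gauge :: "nat set \<Rightarrow> (nat \<Rightarrow> real) \<Rightarrow> real" where
  "cell_gauge A x = Max (cell_term A x ` {..3})"

definition cell_dilation :: "nat set \<Rightarrow> real \<Rightarrow> (nat \<Rightarrow> real) \<Rightarrow> nat \<Rightarrow> real" where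
  "cell_dilation A s x j = cell_centre A j + s * (x j - cell_centre A j)"

definition cell :: "nat set \<Rightarrow> (nat \<Rightarrow> real) set" where
  "cell A = {x \<in> \<Delta>. \<forall>j\<le>3. if j \<in> A then x j < 1/8 else x j > 1/8}"

lemma cell_height:
  assumes "A \<subset> {..3}"
  shows "1/4 \<le> cell_height A" "(\<Sum>j\<le>3. cell_centre A j) = 1" "cell_height A \<le> 1"
proof -
  have "card A < card {..3::nat}" by (rule psubset_card_mono[OF _ assms]) simp
  then have c: "card A \<le> 3" by simp
  then show "1/4 \<le> cell_height A" "cell_height A \<le> 1" by (auto simp: cell_height_def divide_simps)
  have fA: "finite A" using assms finite_subset by blast
  have "(\<Sum>j\<le>3. cell_centre A j) = (\<Sum>j\<in>{..3} - A. cell_height A)"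
    by (rule sum.mono_neutral_cong_right) (auto simp: cell_centre_def)
  also have "\<dots> = real (4 - card A) * cell_height A" using assms fA by (simp add: card_Diff_subset)
  also have "\<dots> = 1" using c by (simp add: cell_height_def of_nat_diff)
  finally show "(\<Sum>j\<le>3. cell_centre A j) = 1" .
qed

lemma cell_gauge_less: "cell_gauge A x < r \<longleftrightarrow> (\<forall>j\<le>3. cell_term A x j < r)"
  unfolding cell_gauge_def by (subst Max_less_iff) auto

lemma cell_gauge_le: "cell_gauge A x \<le> r \<longleftrightarrow> (\<forall>j\<le>3. cell_term A x j \<le> r)"
  unfolding cell_gauge_def by (subst Max_le_iff) auto

lemma cell_iff_gauge:
  assumes "A \<subset> {..3}"
  shows "x \<in> cell A \<longleftrightarrow> x \<in> \<Delta> \<and> cell_gauge A x < 1"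
proof -
  have "cell_term A x j < 1 \<longleftrightarrow> (if j \<in> A then x j < 1/8 else x j > 1/8)" for j
    using cell_height(1)[OF assms] by (auto simp: cell_term_def divide_simps)
  then show ?thesis by (simp add: cell_def cell_gauge_less)
qed

text \<open>
  If no term of the gauge is positive, then all coordinates in \<open>A\<close> vanish and the others are at
  least the height of the centre; as the coordinates have sum \<open>1\<close>, there is equality everywhere.
\<close>

lemma cell_gauge_nonneg:
  assumes "A \<subset> {..3}" "x \<in> \<Delta>"
  shows "0 \<le> cell_gauge A x" "cell_gauge A x = 0 \<Longrightarrow> x = cell_centre A"
proof -
  have x: "\<And>i. 0 \<le> x i" "\<And>i. i > 3 \<Longrightarrow> x i = 0" "(\<Sum>i\<le>3. x i) = 1" using assms(2) by (auto simp: simplex3_iff)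
  have le: "x = cell_centre A" if "cell_gauge A x \<le> 0"
  proof -
    have t: "cell_term A x j \<le> 0" if "j \<le> 3" for j using \<open>cell_gauge A x \<le> 0\<close> that cell_gauge_le by blast
    have ge: "cell_centre A j \<le> x j" if "j \<le> 3" for j
      using t[OF that] cell_height(1)[OF assms(1)] x(1)[of j] that
      by (auto simp: cell_term_def cell_centre_def divide_simps split: if_splits)
    have "(\<Sum>j\<le>3. x j - cell_centre A j) = 0" using x(3) cell_height(2)[OF assms(1)] by (simp add: sum_subtractf)
    then have "\<forall>j\<in>{..3}. x j - cell_centre A j = 0"
      using ge by (subst (asm) sum_nonneg_eq_0_iff) auto
    then have "x j = cell_centre A j" for j
      using x(2)[of j] by (cases "j \<le> 3") (auto simp: cell_centre_def)
    then show ?thesis by auto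
  qed
  show "cell_gauge A x = 0 \<Longrightarrow> x = cell_centre A" using le by simp
  show "0 \<le> cell_gauge A x"
  proof (rule ccontr)
    assume n: "\<not> 0 \<le> cell_gauge A x"
    then have e: "x = cell_centre A" using le by simp
    obtain j where j: "j \<le> 3" "j \<notin> A" using assms(1) by auto
    then have "cell_term A x j = 0" by (simp add: cell_term_def e cell_centre_def)
    moreover have "cell_term A x j < 0" using n j(1) cell_gauge_less[of A x 0] by auto
    ultimately show False by simp
  qed
qed

lemma cell_centre_in:
  assumes "A \<subset> {..3}"
  shows "cell_centre A \<in> cell A" "cell_gauge A (cell_centre A) = 0"
proof -
  have D: "cell_centre A \<in> \<Delta>"
    unfolding simplex3_iff using cell_height[OF assms] by (auto simp: cell_centre_def)
  have "cell_gauge A (cell_centre A) \<le> 0"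
    unfolding cell_gauge_le by (auto simp: cell_term_def cell_centre_def)
  then show z: "cell_gauge A (cell_centre A) = 0" using cell_gauge_nonneg(1)[OF assms D] by simp
  show "cell_centre A \<in> cell A" using D z by (simp add: cell_iff_gauge[OF assms])
qed

text \<open>
  All terms of the gauge are homogeneous with respect to the centre. For \<open>s > 1\<close> the dilated point
  stays in the tetrahedron, as its coordinates in \<open>A\<close> are multiplied by \<open>s\<close> and the others remain
  above \<open>1/8\<close>.
\<close>

lemma cell_dilation:
  assumes A: "A \<subset> {..3}" and x: "x \<in> cell A" and s: "0 \<le> s" "s * cell_gauge A x < 1"
  shows "cell_dilation A s x \<in> cell A" "cell_gauge A (cell_dilation A s x) = s * cell_gauge A x"
proof -
  let ?y = "cell_dilation A s x"
  have xD: "x \<in> \<Delta>" using x by (simp add: cell_def)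
  have t: "cell_term A ?y j = s * cell_term A x j" if "j \<le> 3" for j
    using that by (auto simp: cell_term_def cell_dilation_def cell_centre_def algebra_simps diff_divide_distrib)
  have "cell_term A ?y ` {..3} = (\<lambda>r. s * r) ` cell_term A x ` {..3}"
    using t by (auto simp: image_image intro!: image_cong)
  moreover have "Max ((\<lambda>r. s * r) ` cell_term A x ` {..3}) = s * Max (cell_term A x ` {..3})"
    using s(1) by (intro mono_Max_commute[symmetric]) (auto simp: mono_def mult_left_mono)
  ultimately show g: "cell_gauge A ?y = s * cell_gauge A x" by (simp add: cell_gauge_def)
  have lt: "cell_term A ?y j < 1" if "j \<le> 3" for j using s(2) g that cell_gauge_less by metis
  have "0 \<le> ?y j" for j
  proof (cases "j \<le> 3 \<and> j \<notin> A")
    case True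
    then have "(cell_height A - ?y j) / (cell_height A - 1/8) < 1" using lt[of j] by (simp add: cell_term_def)
    then show ?thesis using cell_height(1)[OF A] by (simp add: divide_simps split: if_splits)
  next
    case False
    then show ?thesis using xD s(1) by (auto simp: cell_dilation_def cell_centre_def simplex3_iff)
  qed
  moreover have "?y j = 0" if "j > 3" for j
    using that xD by (simp add: cell_dilation_def cell_centre_def simplex3_iff)
  moreover have "(\<Sum>j\<le>3. ?y j) = 1"
    using xD cell_height(2)[OF A]
    by (simp add: cell_dilation_def sum.distrib sum_subtractf simplex3_iff flip: sum_distrib_left)
  ultimately have "?y \<in> \<Delta>" by (simp add: simplex3_iff)
  then show "?y \<in> cell A" using lt by (simp add: cell_iff_gauge[OF A] cell_gauge_less)
qed

lemma cell_dilation_dilation: "cell_dilation A t (cell_dilation A s x) = cell_dilation A (t * s) x"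
  by (auto simp: cell_dilation_def fun_eq_iff algebra_simps)

lemma cell_dilation_one: "cell_dilation A 1 x = x"
  by (auto simp: cell_dilation_def fun_eq_iff)

lemma continuous_cell_gauge: "continuous_on S (cell_gauge A)"
proof -
  have eq: "cell_gauge A =
      (\<lambda>x. max (cell_term A x 0) (max (cell_term A x 1) (max (cell_term A x 2) (cell_term A x 3))))"
    unfolding cell_gauge_def atMost_3 by (rule ext) simp
  have "continuous_on S (\<lambda>x. cell_term A x j)" for j
  proof (cases "j \<in> A")
    case True
    then show ?thesis by (simp add: cell_term_def continuous_on_mult_left continuous_on_coordinate)
  next
    case False
    have "continuous_on S (\<lambda>x. (cell_height A - x j) * inverse (cell_height A - 1/8))"
      by (intro continuous_on_mult_right continuous_on_diff continuous_on_const continuous_on_coordinate)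
    then show ?thesis using False by (simp only: cell_term_def if_False divide_inverse)
  qed
  then show ?thesis unfolding eq by (intro continuous_on_max)
qed

lemma openin_cell:
  assumes "A \<subset> {..3}" shows "openin (top_of_set \<Delta>) (cell A)"
proof -
  have "cell A = \<Delta> \<inter> {x. cell_gauge A x < 1}" using cell_iff_gauge[OF assms] by auto
  moreover have "open {x. cell_gauge A x < 1}"
    by (intro open_Collect_less continuous_cell_gauge continuous_on_const)
  ultimately show ?thesis using openin_open_Int[of "{x. cell_gauge A x < 1}" \<Delta>] by simp
qed

definition small_coordinates :: "(nat \<Rightarrow> real) \<Rightarrow> nat set" where
  "small_coordinates x = {j. j \<le> 3 \<and> x j < 1/8}"

lemma small_coordinates_proper:
  assumes "x \<in> \<Delta>" shows "small_coordinates x \<subset> {..3}"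
proof -
  have "small_coordinates x \<noteq> {..3}"
  proof
    assume "small_coordinates x = {..3}"
    then have "x j < 1/8" if "j \<le> 3" for j using that by (auto simp: small_coordinates_def)
    then have "(\<Sum>j\<le>3. x j) < (\<Sum>j\<le>(3::nat). 1/8)" by (intro sum_strict_mono) auto
    then show False using assms by (simp add: simplex3_iff)
  qed
  then show ?thesis by (auto simp: small_coordinates_def)
qed

lemma small_coordinates_cell: "x \<in> cell A \<Longrightarrow> A \<subseteq> {..3} \<Longrightarrow> small_coordinates x = A"
  by (auto simp: cell_def small_coordinates_def split: if_splits)

lemma in_cell_small: "x \<in> \<Delta> \<Longrightarrow> \<forall>j\<le>3. x j \<noteq> 1/8 \<Longrightarrow> x \<in> cell (small_coordinates x)"
  by (force simp: cell_def small_coordinates_def)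

text \<open>
  The cells and their radial structure are defined symmetrically in the four vertices, hence they
  are respected by the gluing maps.
\<close>

lemma cell_permute:
  assumes s: "\<sigma> permutes {..3}" and A: "A \<subseteq> {..3}"
  shows "cell_centre (\<sigma> ` A) = cell_centre A \<circ> inv_into UNIV \<sigma>"
    "cell_gauge (\<sigma> ` A) (x \<circ> inv_into UNIV \<sigma>) = cell_gauge A x"
    "cell_dilation (\<sigma> ` A) t (x \<circ> inv_into UNIV \<sigma>) = cell_dilation A t x \<circ> inv_into UNIV \<sigma>"
    "small_coordinates (x \<circ> inv_into UNIV \<sigma>) = \<sigma> ` small_coordinates x"
proof -
  have inj: "inj \<sigma>" using permutes_inj[OF s] .
  have iv: "inv_into UNIV \<sigma> (\<sigma> j) = j" "\<sigma> (inv_into UNIV \<sigma> j) = j" for j using permutes_inverses[OF s] by auto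
  have mem: "j \<in> \<sigma> ` B \<longleftrightarrow> inv_into UNIV \<sigma> j \<in> B" for j B using iv by (metis image_iff)
  have le: "inv_into UNIV \<sigma> j \<le> 3 \<longleftrightarrow> j \<le> 3" for j using permutes_le3[OF permutes_inv[OF s]] .
  have h: "cell_height (\<sigma> ` A) = cell_height A"
    unfolding cell_height_def using card_image[OF inj_on_subset[OF inj subset_UNIV]] by simp
  show c: "cell_centre (\<sigma> ` A) = cell_centre A \<circ> inv_into UNIV \<sigma>"
    by (auto simp: fun_eq_iff cell_centre_def h mem le)
  have t: "cell_term (\<sigma> ` A) (x \<circ> inv_into UNIV \<sigma>) j = cell_term A x (inv_into UNIV \<sigma> j)" for j
    by (simp add: cell_term_def h mem)
  have "cell_term (\<sigma> ` A) (x \<circ> inv_into UNIV \<sigma>) ` {..3} = cell_term A x ` inv_into UNIV \<sigma> ` {..3}"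
    by (auto simp: t image_image)
  then show "cell_gauge (\<sigma> ` A) (x \<circ> inv_into UNIV \<sigma>) = cell_gauge A x"
    using permutes_image[OF permutes_inv[OF s]] by (simp add: cell_gauge_def)
  show "cell_dilation (\<sigma> ` A) t (x \<circ> inv_into UNIV \<sigma>) = cell_dilation A t x \<circ> inv_into UNIV \<sigma>"
    by (auto simp: fun_eq_iff cell_dilation_def c)
  show "small_coordinates (x \<circ> inv_into UNIV \<sigma>) = \<sigma> ` small_coordinates x"
    by (auto simp: set_eq_iff mem small_coordinates_def le)
qed

context triangulation
begin

definition level :: "nat \<times> (nat \<Rightarrow> real) \<Rightarrow> bool" where
  "level u \<longleftrightarrow> (\<exists>j\<le>3. snd u j = 1/8)"

definition surface :: "'a set" where
  "surface = q ` {u \<in> {..<n} \<times> \<Delta>. level u}"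

text \<open>
  The radial structure of the cells is transferred to \<open>M\<close> in terms of representatives. The regions
  are indexed by their centre as a point of \<open>M\<close>, which automatically collects all the cells that are
  glued around it.
\<close>

definition centre :: "nat \<times> (nat \<Rightarrow> real) \<Rightarrow> 'a" where
  "centre u = q (fst u, cell_centre (small_coordinates (snd u)))"

definition gauge :: "nat \<times> (nat \<Rightarrow> real) \<Rightarrow> real" where
  "gauge u = cell_gauge (small_coordinates (snd u)) (snd u)"

definition dilate :: "real \<Rightarrow> nat \<times> (nat \<Rightarrow> real) \<Rightarrow> 'a" where
  "dilate s u = q (fst u, cell_dilation (small_coordinates (snd u)) s (snd u))"

definition region :: "'a \<Rightarrow> (nat \<times> (nat \<Rightarrow> real)) set" where
  "region p = {u \<in> {..<n} \<times> \<Delta>. \<not> level u \<and> centre u = p}"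

definition lift :: "'a \<Rightarrow> nat \<times> (nat \<Rightarrow> real)" where
  "lift m = (SOME u. u \<in> {..<n} \<times> \<Delta> \<and> q u = m)"

lemma lift: "u \<in> {..<n} \<times> \<Delta> \<Longrightarrow> lift (q u) \<in> {..<n} \<times> \<Delta> \<and> q (lift (q u)) = q u"
  unfolding lift_def by (rule someI[of _ u]) simp

lemma level_glued:
  assumes "G (a, i) = (b, \<sigma>)" "a < n" "i \<le> 3"
  shows "level (b, x \<circ> inv_into UNIV \<sigma>) \<longleftrightarrow> level (a, x)"
proof -
  note s = pairingD(2)[OF assms]
  show ?thesis unfolding level_def
    using permutes_le3[OF s] permutes_le3[OF permutes_inv[OF s]] permutes_inverses[OF s]
    by (metis comp_apply snd_conv)
qed

text \<open>
  A coordinate that vanishes at \<open>x\<close> is small, so it also vanishes at the centre and at all dilates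
  of \<open>x\<close>: the whole ray of a point in a glued face lies in that face.
\<close>

lemma cell_glued:
  assumes "G (a, i) = (b, \<sigma>)" "a < n" "i \<le> 3" and x: "x \<in> \<Delta>" "x i = 0"
  shows "centre (b, x \<circ> inv_into UNIV \<sigma>) = centre (a, x)"
    "gauge (b, x \<circ> inv_into UNIV \<sigma>) = gauge (a, x)"
    "\<not> level (a, x) \<Longrightarrow> 0 \<le> s \<Longrightarrow> s * gauge (a, x) < 1 \<Longrightarrow>
       dilate s (b, x \<circ> inv_into UNIV \<sigma>) = dilate s (a, x)"
proof -
  let ?A = "small_coordinates x"
  note A = small_coordinates_proper[OF x(1)]
  note perm = cell_permute[OF pairingD(2)[OF assms(1-3)] psubset_imp_subset[OF A]]
  have i: "i \<in> ?A" using assms(3) x(2) by (simp add: small_coordinates_def)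
  show "gauge (b, x \<circ> inv_into UNIV \<sigma>) = gauge (a, x)"
    by (simp add: gauge_def perm)
  have "cell_centre ?A \<in> \<Delta>" "cell_centre ?A i = 0"
    using cell_centre_in(1)[OF A] i by (auto simp: cell_def cell_centre_def)
  then show "centre (b, x \<circ> inv_into UNIV \<sigma>) = centre (a, x)"
    using q_glued(1)[OF assms(2) _ assms(3) _ assms(1)] by (simp add: centre_def perm)
  assume h: "\<not> level (a, x)" "0 \<le> s" "s * gauge (a, x) < 1"
  have "x \<in> cell ?A" using in_cell_small[OF x(1)] h(1) by (simp add: level_def)
  then have "cell_dilation ?A s x \<in> cell ?A"
    using h by (intro cell_dilation(1)[OF A]) (auto simp: gauge_def)
  then have "cell_dilation ?A s x \<in> \<Delta>" "cell_dilation ?A s x i = 0"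
    using i x(2) by (auto simp: cell_def cell_dilation_def cell_centre_def)
  then show "dilate s (b, x \<circ> inv_into UNIV \<sigma>) = dilate s (a, x)"
    using q_glued(1)[OF assms(2) _ assms(3) _ assms(1)] by (simp add: dilate_def perm)
qed

lemma level_invariant: "u \<in> {..<n} \<times> \<Delta> \<Longrightarrow> v \<in> {..<n} \<times> \<Delta> \<Longrightarrow> q u = q v \<Longrightarrow> level u = level v"
  by (rule q_invariant) (use level_glued in auto)

lemma gauge_invariant: "u \<in> {..<n} \<times> \<Delta> \<Longrightarrow> v \<in> {..<n} \<times> \<Delta> \<Longrightarrow> q u = q v \<Longrightarrow> gauge u = gauge v"
  by (rule q_invariant) (use cell_glued(2) in auto)

text \<open>
  Dilates are only defined inside the regions, so the invariance principle is applied to a partial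
  function.
\<close>

lemma dilate_invariant:
  assumes "u \<in> {..<n} \<times> \<Delta>" "v \<in> {..<n} \<times> \<Delta>" "q u = q v"
    and s: "\<not> level u" "0 \<le> s" "s * gauge u < 1"
  shows "dilate s u = dilate s v"
proof -
  define F where "F w = (if \<not> level w \<and> s * gauge w < 1 then Some (dilate s w) else None)" for w
  have "F u = F v"
  proof (rule q_invariant[OF _ assms(1-3)])
    fix a x i b \<sigma> assume h: "a < n" "x \<in> \<Delta>" "i \<le> 3" "x i = 0" "G (a, i) = (b, \<sigma>)"
    show "F (a, x) = F (b, x \<circ> inv_into UNIV \<sigma>)"
      unfolding F_def
      using level_glued[OF h(5,1,3)] cell_glued[OF h(5,1,3,2,4)] s(2) by simp
  qed
  then show ?thesis using s level_invariant[OF assms(1-3)] gauge_invariant[OF assms(1-3)]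
    by (simp add: F_def)
qed

lemma regionD:
  assumes "u \<in> region p"
  obtains a x A where "u = (a, x)" "a < n" "A \<subset> {..3}" "x \<in> cell A" "x \<in> \<Delta>" "small_coordinates x = A"
    "q (a, cell_centre A) = p"
proof -
  obtain a x where u: "u = (a, x)" "a < n" "x \<in> \<Delta>" "\<not> level (a, x)" "centre (a, x) = p"
    using assms by (auto simp: region_def)
  show thesis
    by (rule that[OF u(1,2) small_coordinates_proper[OF u(3)] in_cell_small[OF u(3)] u(3) refl])
      (use u in \<open>auto simp: level_def centre_def\<close>)
qed

lemma region_cell:
  assumes "a < n" "A \<subset> {..3}" "x \<in> cell A"
  shows "(a, x) \<in> region (q (a, cell_centre A))" "small_coordinates x = A" "gauge (a, x) = cell_gauge A x"
    "dilate s (a, x) = q (a, cell_dilation A s x)" "x \<in> \<Delta>"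
proof -
  show A: "small_coordinates x = A" using small_coordinates_cell assms by blast
  show D: "x \<in> \<Delta>" using assms(3) by (simp add: cell_def)
  have "\<not> level (a, x)" using assms(3) by (auto simp: cell_def level_def split: if_splits)
  then show "(a, x) \<in> region (q (a, cell_centre A))"
    using assms(1) D A by (simp add: region_def centre_def)
  show "gauge (a, x) = cell_gauge A x" "dilate s (a, x) = q (a, cell_dilation A s x)"
    using A by (auto simp: gauge_def dilate_def)
qed

lemma region_eq:
  "region p = (\<Union>(a, A) \<in> {(a, A). a < n \<and> A \<subset> {..3} \<and> q (a, cell_centre A) = p}. {a} \<times> cell A)" (is "_ = ?U")
proof (intro equalityI subsetI)
  fix u assume "u \<in> region p"
  then show "u \<in> ?U" by (rule regionD) auto
next
  fix u assume "u \<in> ?U"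
  then show "u \<in> region p" using region_cell(1) by auto
qed

lemma openin_region: "openin (tetrahedra n) (region p)"
  unfolding region_eq by (auto intro!: openin_piece openin_cell)

lemma region_image:
  shows "openin M (q ` region p)" "quotient_map (subtopology (tetrahedra n) (region p)) (subtopology M (q ` region p)) q"
    "\<And>u. u \<in> {..<n} \<times> \<Delta> \<Longrightarrow> q u \<in> q ` region p \<longleftrightarrow> u \<in> region p"
proof -
  have sat: "(a, x) \<in> region p \<longleftrightarrow> (b, x \<circ> inv_into UNIV \<sigma>) \<in> region p"
    if h: "a < n" "x \<in> \<Delta>" "i \<le> 3" "x i = 0" "G (a, i) = (b, \<sigma>)" for a x i b \<sigma>
    using level_glued[OF h(5,1,3)] cell_glued(1)[OF h(5,1,3,2,4)] q_glued(2)[OF h] pairingD(1)[OF h(5,1,3)] h(1,2)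
    by (simp add: region_def)
  note * = open_saturated_image[OF openin_region, of p]
  show "openin M (q ` region p)" by (rule *(1)) (rule sat)
  show "quotient_map (subtopology (tetrahedra n) (region p)) (subtopology M (q ` region p)) q" by (rule *(2)) (rule sat)
  show "\<And>u. u \<in> {..<n} \<times> \<Delta> \<Longrightarrow> q u \<in> q ` region p \<longleftrightarrow> u \<in> region p" by (rule *(3)) (use sat in blast)
qed

lemma region_subset: "region p \<subseteq> {..<n} \<times> \<Delta>" by (auto simp: region_def)

lemma region_image_subset: "q ` region p \<subseteq> topspace M"
  using openin_subset[OF region_image(1)] .

lemma gauge_lift: "u \<in> region p \<Longrightarrow> gauge (lift (q u)) = gauge u"
  using region_subset lift by (intro gauge_invariant) blast+

lemma dilate_lift: "u \<in> region p \<Longrightarrow> 0 \<le> s \<Longrightarrow> s * gauge u < 1 \<Longrightarrow> dilate s (lift (q u)) = dilate s u"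
  using region_subset lift by (intro dilate_invariant[symmetric]) (auto simp: region_def)

lemma dilate_region:
  assumes "u \<in> region p" "0 \<le> s" "s * gauge u < 1"
  obtains v where "v \<in> region p" "dilate s u = q v" "gauge v = s * gauge u"
    "\<And>t. dilate t v = dilate (t * s) u"
proof -
  obtain a x A where u: "u = (a, x)" "a < n" "A \<subset> {..3}" "x \<in> cell A" "q (a, cell_centre A) = p"
    using assms(1) by (rule regionD)
  note r = region_cell[OF u(2-4)]
  have s: "s * cell_gauge A x < 1" using assms(3) r(3) u(1) by simp
  note d = cell_dilation[OF u(3,4) assms(2) s]
  note r' = region_cell[OF u(2,3) d(1)]
  show thesis
    by (rule that[of "(a, cell_dilation A s x)"])
      (use r r' d u cell_dilation_dilation in auto)
qed

text \<open>
  All conditions are checked on representatives, cell by cell. There are finitely many cells, which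
  gives compactness, and the region carries the quotient topology of its cells, which gives
  continuity.
\<close>

lemma open_cone_region:
  assumes p: "q ` region p \<noteq> {}"
  shows "open_cone (subtopology M (q ` region p)) p (\<lambda>m. gauge (lift m)) (\<lambda>s m. dilate s (lift m))"
proof
  let ?X = "subtopology M (q ` region p)" and ?T = "subtopology (tetrahedra n) (region p)"
  have ts: "topspace ?X = q ` region p" using region_image_subset by auto
  have tT: "topspace ?T = region p" using region_subset by (auto simp: topspace_tetrahedra)
  obtain u0 where "u0 \<in> region p" using p by auto
  then obtain a0 A0 where A0: "a0 < n" "A0 \<subset> {..3}" "q (a0, cell_centre A0) = p" by (rule regionD)
  note r0 = region_cell[OF A0(1,2) cell_centre_in(1)[OF A0(2)], unfolded A0(3)]
  show "p \<in> topspace ?X" unfolding ts using r0(1) A0(3) by force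
  have "gauge (lift (q (a0, cell_centre A0))) = 0"
    using gauge_lift[OF r0(1)] r0(3) cell_centre_in(2)[OF A0(2)] by simp
  then show "gauge (lift p) = 0" using A0(3) by simp
  show "Hausdorff_space ?X" using Hausdorff by (rule Hausdorff_space_subtopology)
  show "0 \<le> gauge (lift x) \<and> gauge (lift x) < 1" if x: "x \<in> topspace ?X" for x
  proof -
    obtain u where u: "u \<in> region p" "x = q u" using x ts by auto
    obtain a y A where h: "u = (a, y)" "a < n" "A \<subset> {..3}" "y \<in> cell A" using u(1) by (rule regionD)
    show ?thesis using gauge_lift[OF u(1)] region_cell[OF h(2-4)] cell_gauge_nonneg(1)[OF h(3)]
        cell_iff_gauge[OF h(3)] h(1,4) u(2) by auto
  qed
  show "x = p" if x: "x \<in> topspace ?X" "gauge (lift x) = 0" for x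
  proof -
    obtain u where u: "u \<in> region p" "x = q u" using x ts by auto
    obtain a y A where h: "u = (a, y)" "a < n" "A \<subset> {..3}" "y \<in> cell A" "q (a, cell_centre A) = p"
      using u(1) by (rule regionD)
    have "cell_gauge A y = 0" using x(2) gauge_lift[OF u(1)] region_cell(3)[OF h(2-4)] u(2) h(1) by simp
    then have "y = cell_centre A" using cell_gauge_nonneg(2)[OF h(3)] h(4) by (simp add: cell_def)
    then show ?thesis using u(2) h(1,5) by simp
  qed
  show "dilate s (lift x) \<in> topspace ?X \<and> gauge (lift (dilate s (lift x))) = s * gauge (lift x)"
    if x: "x \<in> topspace ?X" "0 < s" "s * gauge (lift x) < 1" for s x
  proof -
    obtain u where u: "u \<in> region p" "x = q u" using x ts by auto
    then have s: "0 \<le> s" "s * gauge u < 1" using x gauge_lift[OF u(1)] by auto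
    obtain v where v: "v \<in> region p" "dilate s u = q v" "gauge v = s * gauge u"
      by (rule dilate_region[OF u(1) s]) (rule that)
    then show ?thesis using dilate_lift[OF u(1) s] gauge_lift[OF u(1)] gauge_lift[OF v(1)] u(2) ts by simp
  qed
  show "dilate 1 (lift x) = x" if x: "x \<in> topspace ?X" for x
  proof -
    obtain u where u: "u \<in> region p" "x = q u" using x ts by auto
    have "lift x \<in> {..<n} \<times> \<Delta>" "q (lift x) = x" using lift region_subset u by blast+
    then show ?thesis by (simp add: dilate_def cell_dilation_one)
  qed
  show "dilate t (lift (dilate s (lift x))) = dilate (t * s) (lift x)"
    if x: "x \<in> topspace ?X" "0 < s" "s * gauge (lift x) < 1" "0 < t" "t * (s * gauge (lift x)) < 1" for s t x
  proof -
    obtain u where u: "u \<in> region p" "x = q u" using x ts by auto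
    then have s: "0 \<le> s" "s * gauge u < 1" "0 \<le> t * s" "t * s * gauge u < 1"
      using x gauge_lift[OF u(1)] by (auto simp: mult.assoc)
    obtain v where v: "v \<in> region p" "dilate s u = q v" "gauge v = s * gauge u" "\<And>t. dilate t v = dilate (t * s) u"
      by (rule dilate_region[OF u(1) s(1,2)]) (rule that)
    have "dilate t (lift (q v)) = dilate t v"
      using x(4) s(4) v(3) by (intro dilate_lift[OF v(1)]) (auto simp: mult.assoc)
    then show ?thesis using dilate_lift[OF u(1) s(1,2)] dilate_lift[OF u(1) s(3,4)] v u(2) by simp
  qed
  have piecewise: "continuous_map ?T Z f"
    if "\<And>a A. a < n \<Longrightarrow> A \<subset> {..3} \<Longrightarrow> q (a, cell_centre A) = p \<Longrightarrow>
         continuous_map (top_of_set (cell A)) Z (\<lambda>x. f (a, x))" for Z :: "'c topology" and f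
  proof (rule pasting_lemma[where I = "{(a, A). a < n \<and> A \<subset> {..3} \<and> q (a, cell_centre A) = p}"
        and T = "\<lambda>(a, A). {a} \<times> cell A" and f = "\<lambda>_. f"])
    fix i assume "i \<in> {(a, A). a < n \<and> A \<subset> {..3} \<and> q (a, cell_centre A) = p}"
    then obtain a A where i: "i = (a, A)" "a < n" "A \<subset> {..3}" "q (a, cell_centre A) = p" by auto
    have sub: "{a} \<times> cell A \<subseteq> region p" using i unfolding region_eq by auto
    show "openin ?T (case i of (a, A) \<Rightarrow> {a} \<times> cell A)"
      using i(1) sub openin_piece[OF i(2) openin_cell[OF i(3)]] openin_open_subtopology[OF openin_region] by simp
    have "continuous_map (subtopology (tetrahedra n) ({a} \<times> cell A)) Z f"
      by (rule continuous_on_piece) (use that[OF i(2-4)] in \<open>auto simp: cell_def\<close>)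
    then show "continuous_map (subtopology ?T (case i of (a, A) \<Rightarrow> {a} \<times> cell A)) Z f"
      using i(1) sub by (simp add: subtopology_subtopology Int_absorb1)
  next
    fix u assume "u \<in> topspace ?T"
    then have "u \<in> region p" by (simp add: tT)
    then show "\<exists>j. j \<in> {(a, A). a < n \<and> A \<subset> {..3} \<and> q (a, cell_centre A) = p} \<and>
        u \<in> (case j of (a, A) \<Rightarrow> {a} \<times> cell A) \<and> f u = f u"
      by (rule regionD) auto
  qed simp
  show "continuous_map ?X euclideanreal (\<lambda>m. gauge (lift m))"
  proof (rule continuous_compose_quotient_map[OF region_image(2)])
    have "continuous_map ?T euclideanreal gauge"
    proof (rule piecewise)
      fix a and A :: "nat set" assume h: "a < n" "A \<subset> {..3}"
      have "continuous_on (cell A) (\<lambda>x. gauge (a, x))"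
        using continuous_cell_gauge region_cell(3)[OF h] by (simp cong: continuous_on_cong)
      then show "continuous_map (top_of_set (cell A)) euclideanreal (\<lambda>x. gauge (a, x))" by simp
    qed
    then show "continuous_map ?T euclideanreal ((\<lambda>m. gauge (lift m)) \<circ> q)"
      by (rule continuous_map_eq) (use gauge_lift tT in auto)
  qed
  show "continuous_map ?X ?X (\<lambda>x. dilate (m (gauge (lift x))) (lift x))"
    if m: "continuous_on {0..<1} m" "\<And>r. r \<in> {0..<1} \<Longrightarrow> 0 < m r \<and> r * m r < 1" for m
  proof (rule continuous_compose_quotient_map[OF region_image(2)])
    have "continuous_map ?T ?X (\<lambda>u. dilate (m (gauge u)) u)"
    proof (rule piecewise)
      fix a and A :: "nat set" assume h: "a < n" "A \<subset> {..3}" "q (a, cell_centre A) = p"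
      let ?f = "\<lambda>x. cell_dilation A (m (cell_gauge A x)) x"
      have r: "cell_gauge A x \<in> {0..<1}" if "x \<in> cell A" for x
        using that cell_iff_gauge[OF h(2)] cell_gauge_nonneg[OF h(2)] by auto
      have "continuous_on (cell A) (\<lambda>x. m (cell_gauge A x))"
        by (rule continuous_on_compose2[OF m(1) continuous_cell_gauge]) (use r in auto)
      then have "continuous_on (cell A) ?f"
        unfolding cell_dilation_def
        by (intro continuous_on_coordinatewise_then_product continuous_on_add continuous_on_mult
            continuous_on_diff continuous_on_const continuous_on_coordinate)
      moreover have f: "?f x \<in> cell A" if "x \<in> cell A" for x
        using m(2)[OF r[OF that]] that by (intro cell_dilation(1)[OF h(2)]) (auto simp: mult.commute)
      ultimately have "continuous_map (top_of_set (cell A)) (top_of_set \<Delta>) ?f"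
        by (auto simp: cell_def)
      then have "continuous_map (top_of_set (cell A)) M (\<lambda>x. q (a, ?f x))"
        by (rule continuous_map_compose[OF continuous_map_compose[OF _ continuous_injection[OF h(1)]] q_continuous,
              unfolded o_def])
      moreover have "q (a, ?f x) \<in> q ` region p" if "x \<in> cell A" for x
        using region_cell(1)[OF h(1,2) f[OF that]] h(3) by auto
      ultimately have "continuous_map (top_of_set (cell A)) ?X (\<lambda>x. q (a, ?f x))"
        by (auto simp: continuous_map_in_subtopology)
      then show "continuous_map (top_of_set (cell A)) ?X (\<lambda>x. dilate (m (gauge (a, x))) (a, x))"
        by (rule continuous_map_eq) (use region_cell[OF h(1,2)] in auto)
    qed
    moreover have "dilate (m (gauge u)) u = ((\<lambda>x. dilate (m (gauge (lift x))) (lift x)) \<circ> q) u"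
      if u: "u \<in> topspace ?T" for u
    proof -
      have u: "u \<in> region p" using u tT by simp
      then obtain a y A where h: "u = (a, y)" "a < n" "A \<subset> {..3}" "y \<in> cell A" by (rule regionD)
      have "gauge u \<in> {0..<1}" using region_cell[OF h(2-4)] cell_gauge_nonneg(1)[OF h(3)]
        cell_iff_gauge[OF h(3)] h(1,4) by auto
      then show ?thesis using dilate_lift[OF u] gauge_lift[OF u] m(2)[of "gauge u"] by (simp add: mult.commute)
    qed
    ultimately show "continuous_map ?T ?X ((\<lambda>x. dilate (m (gauge (lift x))) (lift x)) \<circ> q)"
      by (rule continuous_map_eq)
  qed
  show "compactin ?X {x \<in> topspace ?X. gauge (lift x) \<le> r}" if r: "r < 1" for r
  proof -
    let ?I = "{(a, A). a < n \<and> A \<subset> {..3} \<and> q (a, cell_centre A) = p}"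
    have fin: "finite ?I"
      by (rule finite_subset[of _ "{..<n} \<times> Pow {..3}"]) auto
    let ?K = "\<lambda>A. {x \<in> \<Delta>. cell_gauge A x \<le> r}"
    have K: "?K A \<subseteq> cell A" if "A \<subset> {..3}" for A :: "nat set"
      using r by (auto simp: cell_iff_gauge[OF that])
    have cK: "compactin M (q ` ({a} \<times> ?K A))" if "a < n" for a and A :: "nat set"
    proof -
      have "closed {x. cell_gauge A x \<le> r}"
        by (intro closed_Collect_le continuous_cell_gauge continuous_on_const)
      then have "compact (\<Delta> \<inter> {x. cell_gauge A x \<le> r})" by (rule compact_Int_closed[OF compact_simplex3])
      then have "compactin (top_of_set \<Delta>) (?K A)"
        by (auto simp: compactin_subtopology Collect_conj_eq)
      then have "compactin (tetrahedra n) (Pair a ` ?K A)"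
        by (rule image_compactin[OF _ continuous_injection[OF that]])
      then have "compactin M (q ` Pair a ` ?K A)" by (rule image_compactin[OF _ q_continuous])
      moreover have "Pair a ` ?K A = {a} \<times> ?K A" by auto
      ultimately show ?thesis by simp
    qed
    have "{x \<in> topspace ?X. gauge (lift x) \<le> r} = (\<Union>(a, A) \<in> ?I. q ` ({a} \<times> ?K A))" (is "?L = ?R")
    proof (intro equalityI subsetI)
      fix x assume "x \<in> ?L"
      then obtain u where u: "u \<in> region p" "x = q u" "gauge u \<le> r" using ts gauge_lift by auto
      from u(1) obtain a y A where h: "u = (a, y)" "a < n" "A \<subset> {..3}" "y \<in> cell A" "q (a, cell_centre A) = p"
        by (rule regionD)
      have "y \<in> ?K A" using region_cell(3,5)[OF h(2-4)] h(1) u(3) by simp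
      then show "x \<in> ?R" using h u(2) by auto
    next
      fix x assume "x \<in> ?R"
      then obtain a A y where h: "a < n" "A \<subset> {..3}" "q (a, cell_centre A) = p" "y \<in> ?K A" "x = q (a, y)" by auto
      have y: "y \<in> cell A" using K[OF h(2)] h(4) by blast
      note rc = region_cell[OF h(1,2) y, unfolded h(3)]
      show "x \<in> ?L" using rc(1,3) h(4,5) gauge_lift[OF rc(1)] ts by auto
    qed
    moreover have "compactin M ?R" using fin cK by (intro compactin_Union) auto
    ultimately show ?thesis by (auto simp: compactin_subtopology ts)
  qed
qed

text \<open>
  This is where the topology of \<open>M\<close> enters: the centre of the region has a chart, the inverse of the
  chart embeds a round ball in the region as an open set, and uniqueness of open cones applies.
\<close>

lemma region_ball:
  assumes p: "q ` region p \<noteq> {}"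
  shows "subtopology M (q ` region p) homeomorphic_space open_ball3"
proof -
  let ?R = "q ` region p"
  let ?X = "subtopology M ?R"
  interpret X: open_cone ?X p "\<lambda>m. gauge (lift m)" "\<lambda>s m. dilate s (lift m)"
    by (rule open_cone_region[OF p])
  have pR: "p \<in> ?R" using X.apex by simp
  obtain U \<phi> where U: "openin M U" "U \<subseteq> ?R" "p \<in> U"
    "homeomorphic_map (subtopology M U) (Euclidean_space 3) \<phi>" "\<phi> p = (\<lambda>_. 0)"
    by (rule centred_chart[OF manifold region_image(1) pR]) (rule that)
  obtain \<psi> where psi: "homeomorphic_maps (subtopology M U) (Euclidean_space 3) \<phi> \<psi>"
    using U(4) by (auto simp: homeomorphic_map_maps)
  have tU: "topspace (subtopology M U) = U" using openin_subset[OF U(1)] by auto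
  have hpsi: "homeomorphic_map (Euclidean_space 3) (subtopology M U) \<psi>"
    using psi homeomorphic_maps_map by blast
  have psiU: "\<psi> x \<in> U" if "x \<in> topspace (Euclidean_space 3)" for x
    using homeomorphic_imp_surjective_map[OF hpsi] that tU by auto
  have psi0: "\<psi> (\<lambda>_. 0) = p" using psi U(3,5) tU by (auto simp: homeomorphic_maps_def)
  have sub: "topspace open_ball3 \<subseteq> topspace (Euclidean_space 3)" by (simp add: open_ball3_def)
  have ob: "openin (Euclidean_space 3) (topspace open_ball3)"
  proof -
    have "open {x :: nat \<Rightarrow> real. (\<Sum>i<3. x i ^ 2) < 1}"
      by (intro open_Collect_less continuous_on_sum continuous_on_power continuous_on_coordinate continuous_on_const)
    then have "openin (Euclidean_space 3) ({x. \<forall>i\<ge>3. x i = 0} \<inter> {x. (\<Sum>i<3. x i ^ 2) < 1})"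
      unfolding Euclidean_space_eq by (rule openin_open_Int)
    then show ?thesis by (simp add: open_ball3_eq Collect_conj_eq)
  qed
  have "open_ball3 homeomorphic_space ?X"
  proof (rule open_cone_unique[OF open_cone_ball X.open_cone_axioms])
    have "continuous_map (Euclidean_space 3) M \<psi>"
      using homeomorphic_imp_continuous_map[OF hpsi] continuous_map_into_fulltopology by blast
    then have "continuous_map open_ball3 M \<psi>" unfolding open_ball3_def by (rule continuous_map_from_subtopology)
    then show "continuous_map open_ball3 ?X \<psi>"
      using subsetD[OF U(2) psiU] subsetD[OF sub] by (auto simp: continuous_map_in_subtopology)
    show "open_map open_ball3 ?X \<psi>"
      unfolding open_map_def
    proof (intro allI impI)
      fix W assume "openin open_ball3 W"
      moreover have "open_ball3 = subtopology (Euclidean_space 3) (topspace open_ball3)"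
        unfolding open_ball3_def topspace_subtopology by (rule subtopology_restrict[symmetric])
      ultimately have "openin (subtopology (Euclidean_space 3) (topspace open_ball3)) W" by simp
      then have "openin (Euclidean_space 3) W" using ob by (rule openin_trans_full)
      then have "openin (subtopology M U) (\<psi> ` W)"
        using homeomorphic_imp_open_map[OF hpsi] by (simp add: open_map_def)
      then have "openin M (\<psi> ` W)" "\<psi> ` W \<subseteq> ?R" using U(1,2) openin_trans_full openin_subset tU by blast+
      then show "openin ?X (\<psi> ` W)" using region_image(1) by (simp add: openin_open_subtopology)
    qed
    show "inj_on \<psi> (topspace open_ball3)"
      using homeomorphic_imp_injective_map[OF hpsi] sub inj_on_subset by blast
    show "\<psi> (\<lambda>_. 0) = p" by (rule psi0)
  qed
  then show ?thesis by (rule homeomorphic_space_sym[THEN iffD1])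
qed

lemma connectedin_region: "connectedin M (q ` region p)"
proof -
  have *: "\<exists>C. connectedin M C \<and> C \<subseteq> q ` region p \<and> p \<in> C \<and> q u \<in> C" if u: "u \<in> region p" for u
  proof -
    obtain a x A where h: "u = (a, x)" "a < n" "A \<subset> {..3}" "x \<in> cell A" "q (a, cell_centre A) = p"
      using u by (rule regionD)
    let ?c = "\<lambda>s. cell_dilation A s x"
    have c: "?c s \<in> cell A" if "s \<in> {0..1}" for s
    proof (rule cell_dilation(1)[OF h(3,4)])
      have g: "0 \<le> cell_gauge A x" "cell_gauge A x < 1"
        using h(4) cell_iff_gauge[OF h(3)] cell_gauge_nonneg[OF h(3)] by auto
      have "s * cell_gauge A x \<le> 1 * cell_gauge A x" using that g by (intro mult_right_mono) auto
      then show "s * cell_gauge A x < 1" using g by linarith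
    qed (use that in simp)
    have "continuous_on {0..1} ?c" unfolding cell_dilation_def
      by (intro continuous_on_coordinatewise_then_product continuous_on_add continuous_on_mult
            continuous_on_const continuous_on_id)
    then have "continuous_map (top_of_set {0..1}) (top_of_set \<Delta>) ?c" using c by (auto simp: cell_def)
    then have "continuous_map (top_of_set {0..1}) M (q \<circ> (Pair a \<circ> ?c))"
      by (intro continuous_map_compose[OF continuous_map_compose[OF _ continuous_injection[OF h(2)]] q_continuous])
    moreover have "connectedin (top_of_set {0..1::real}) {0..1}"
      by (simp add: connectedin_subtopology)
    ultimately have "connectedin M ((q \<circ> (Pair a \<circ> ?c)) ` {0..1})" by (rule connectedin_continuous_map_image)
    moreover have "(q \<circ> (Pair a \<circ> ?c)) ` {0..1} \<subseteq> q ` region p"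
      using region_cell(1)[OF h(2,3) c] h(5) by auto
    moreover have "(q \<circ> (Pair a \<circ> ?c)) 0 = p"
    proof -
      have "?c 0 = cell_centre A" by (auto simp: cell_dilation_def)
      then show ?thesis using h(5) by simp
    qed
    moreover have "(q \<circ> (Pair a \<circ> ?c)) 1 = q u" by (simp add: cell_dilation_one h(1))
    ultimately show ?thesis
      by (intro exI[of _ "(q \<circ> (Pair a \<circ> ?c)) ` {0..1}"]) (metis atLeastAtMost_iff imageI order_refl zero_le_one)
  qed
  let ?F = "{C. connectedin M C \<and> C \<subseteq> q ` region p \<and> p \<in> C}"
  have "connectedin M (\<Union>?F)" by (rule connectedin_Union) auto
  moreover have "\<Union>?F = q ` region p" using * by blast
  ultimately show ?thesis by simp
qed

text \<open>
  The regions are disjoint open connected sets that cover the complement of the surface; thus they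
  are its components.
\<close>

theorem quasi_filling_surface: "quasi_filling M surface"
  unfolding quasi_filling_def
proof
  let ?Y = "subtopology M (topspace M - surface)"
  fix C assume C: "C \<in> connected_components_of ?Y"
  have sub: "q ` region p \<subseteq> topspace M - surface" for p
  proof
    fix m assume "m \<in> q ` region p"
    then obtain u where u: "u \<in> region p" "m = q u" by auto
    have "m \<notin> surface"
    proof
      assume "m \<in> surface"
      then obtain v where "v \<in> {..<n} \<times> \<Delta>" "level v" "q v = q u" using u(2) by (auto simp: surface_def)
      then show False using level_invariant[of v u] u(1) by (auto simp: region_def)
    qed
    then show "m \<in> topspace M - surface" using region_image_subset u by auto
  qed
  obtain m where m: "m \<in> C" using nonempty_connected_components_of[OF C] by auto
  then have mY: "m \<in> topspace M" "m \<notin> surface"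
    using connected_components_of_subset[OF C] by auto
  then obtain a x where ax: "a < n" "x \<in> \<Delta>" "m = q (a, x)" by (auto elim: q_surj)
  define p where "p = centre (a, x)"
  have ur: "(a, x) \<in> region p" using ax mY by (auto simp: region_def p_def surface_def)
  have con: "connectedin ?Y (q ` region p)"
    using connectedin_region sub by (simp add: connectedin_subtopology)
  have "C = q ` region p"
  proof
    show "q ` region p \<subseteq> C"
      using connected_components_of_maximal[OF C con] m ur ax(3) by (auto simp: disjnt_iff)
    have oY: "openin ?Y (q ` region p')" for p'
    proof -
      have "q ` region p' = q ` region p' \<inter> (topspace M - surface)" using sub by blast
      then show ?thesis using region_image(1) unfolding openin_subtopology by blast
    qed
    have "closedin ?Y (q ` region p)"
    proof -
      have "topspace ?Y - q ` region p = (\<Union>p' \<in> - {p}. q ` region p')"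
      proof (intro equalityI subsetI)
        fix z assume z: "z \<in> topspace ?Y - q ` region p"
        then obtain b y where b: "b < n" "y \<in> \<Delta>" "z = q (b, y)" by (auto elim: q_surj)
        then have "(b, y) \<in> region (centre (b, y))" using z by (auto simp: region_def surface_def)
        then show "z \<in> (\<Union>p' \<in> - {p}. q ` region p')" using z b by auto
      next
        fix z assume "z \<in> (\<Union>p' \<in> - {p}. q ` region p')"
        then obtain p' u where u: "p' \<noteq> p" "u \<in> region p'" "z = q u" by auto
        moreover have "q u \<notin> q ` region p"
          using region_image(3)[of u p] region_subset u(1,2) by (auto simp: region_def)
        ultimately show "z \<in> topspace ?Y - q ` region p" using sub by auto
      qed
      moreover have "openin ?Y (\<Union>p' \<in> - {p}. q ` region p')"
        using oY by blast
      moreover have "q ` region p \<subseteq> topspace ?Y" using sub by auto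
      ultimately show ?thesis by (simp add: closedin_def)
    qed
    moreover have "connectedin ?Y C" by (rule connectedin_connected_components_of[OF C])
    ultimately have "C \<subseteq> q ` region p \<or> disjnt C (q ` region p)"
      using connectedin_clopen_cases oY by blast
    then show "C \<subseteq> q ` region p" using m ur ax(3) by (auto simp: disjnt_iff)
  qed
  then show "subtopology M C homeomorphic_space open_ball3"
    using region_ball[of p] ur by blast
qed

end

section \<open>The abstract surface\<close>

text \<open>
  The point half way between \<open>x\<close> and vertex \<open>j\<close>. It lies in the same open face as \<open>x\<close> or in a larger
  one, but if \<open>x j\<close> is not zero, then it lies in the same open face, so that pushing is compatible
  with the gluing maps on the triangle \<open>x j = 1/8\<close>.
\<close>

definition push :: "nat \<Rightarrow> (nat \<Rightarrow> real) \<Rightarrow> nat \<Rightarrow> real" where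
  "push j x i = (x i + (if i = j then 1 else 0)) / 2"

lemma push_simplex: "x \<in> \<Delta> \<Longrightarrow> j \<le> 3 \<Longrightarrow> push j x \<in> \<Delta>"
  unfolding simplex3_iff push_def by (auto simp: sum.distrib simp flip: sum_divide_distrib)

lemma continuous_push: "continuous_on A (push j)"
proof -
  have "continuous_on A (\<lambda>x i. (x i + (if i = j then 1 else 0)) * (1/2))"
    by (intro continuous_on_coordinatewise_then_product continuous_on_mult continuous_on_add
        continuous_on_const continuous_on_coordinate)
  then show ?thesis by (simp add: push_def[abs_def])
qed

lemma push_permute:
  assumes "\<sigma> permutes {..3}"
  shows "push (\<sigma> j) (x \<circ> inv_into UNIV \<sigma>) = push j x \<circ> inv_into UNIV \<sigma>"
  using permutes_inverses[OF assms] by (auto simp: fun_eq_iff push_def)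

context triangulation
begin

definition sheet :: "nat \<times> (nat \<Rightarrow> real) \<Rightarrow> nat \<Rightarrow> 'a \<times> 'a" where
  "sheet u j = (q u, q (fst u, push j (snd u)))"

text \<open>
  As a compact subset of \<open>M \<times> M\<close> the surface is a Hausdorff space with a countable base without
  further ado. That it is a surface will follow from the crossing charts.
\<close>

definition sheet_points :: "('a \<times> 'a) set" where
  "sheet_points = {sheet (a, x) j | a x j. a < n \<and> x \<in> \<Delta> \<and> j \<le> 3 \<and> x j = 1/8}"

definition sheet_space :: "('a \<times> 'a) topology" where
  "sheet_space = subtopology (prod_topology M M) sheet_points"

lemma sheet_glued:
  assumes "a < n" "x \<in> \<Delta>" "i \<le> 3" "x i = 0" "G (a, i) = (b, \<sigma>)" "j \<le> 3" "x j \<noteq> 0"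
  shows "sheet (b, x \<circ> inv_into UNIV \<sigma>) (\<sigma> j) = sheet (a, x) j"
proof -
  have "push j x i = 0" using assms by (auto simp: push_def)
  then have "q (b, push j x \<circ> inv_into UNIV \<sigma>) = q (a, push j x)"
    using q_glued(1)[OF assms(1) push_simplex[OF assms(2,6)] assms(3) _ assms(5)] by simp
  then show ?thesis
    using q_glued(1)[OF assms(1-5)] push_permute[OF pairingD(2)[OF assms(5,1,3)]] by (simp add: sheet_def)
qed

lemma level_coordinates_glued:
  fixes x :: "nat \<Rightarrow> real"
  assumes "G (a, i) = (b, \<sigma>)" "a < n" "i \<le> 3"
  shows "{j. j \<le> 3 \<and> (x \<circ> inv_into UNIV \<sigma>) j = 1/8} = \<sigma> ` {j. j \<le> 3 \<and> x j = 1/8}"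
proof -
  note s = pairingD(2)[OF assms]
  have iv: "inv_into UNIV \<sigma> (\<sigma> j) = j" "\<sigma> (inv_into UNIV \<sigma> j) = j" for j using permutes_inverses[OF s] by auto
  have mem: "j \<in> \<sigma> ` B \<longleftrightarrow> inv_into UNIV \<sigma> j \<in> B" for j B using iv by (metis image_iff)
  show ?thesis by (auto simp: set_eq_iff mem permutes_le3[OF permutes_inv[OF s]])
qed

definition sheets :: "nat \<times> (nat \<Rightarrow> real) \<Rightarrow> ('a \<times> 'a) set" where
  "sheets u = sheet u ` {j. j \<le> 3 \<and> snd u j = 1/8}"

lemma sheets_invariant:
  assumes "u \<in> {..<n} \<times> \<Delta>" "v \<in> {..<n} \<times> \<Delta>" "q u = q v"
  shows "sheets u = sheets v"
proof (rule q_invariant[OF _ assms])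
  fix a x i b \<sigma> assume h: "a < n" "x \<in> \<Delta>" "i \<le> 3" "x i = 0" "G (a, i) = (b, \<sigma>)"
  have "sheets (b, x \<circ> inv_into UNIV \<sigma>) = (\<lambda>j. sheet (b, x \<circ> inv_into UNIV \<sigma>) (\<sigma> j)) ` {j. j \<le> 3 \<and> x j = 1/8}"
    using level_coordinates_glued[OF h(5,1,3)] by (simp add: sheets_def image_image del: comp_apply)
  also have "\<dots> = sheets (a, x)"
    unfolding sheets_def using sheet_glued[OF h] by (intro image_cong) auto
  finally show "sheets (a, x) = sheets (b, x \<circ> inv_into UNIV \<sigma>)" by simp
qed

lemma sheet_fibre:
  assumes "u \<in> {..<n} \<times> \<Delta>"
  shows "{s \<in> sheet_points. fst s = q u} = sheets u"
proof (intro equalityI subsetI)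
  fix s assume "s \<in> {s \<in> sheet_points. fst s = q u}"
  then obtain a x j where h: "s = sheet (a, x) j" "a < n" "x \<in> \<Delta>" "j \<le> 3" "x j = 1/8" "fst s = q u"
    by (auto simp: sheet_points_def)
  have "sheets (a, x) = sheets u" using h assms by (intro sheets_invariant) (auto simp: sheet_def)
  then show "s \<in> sheets u" using h by (auto simp: sheets_def)
next
  fix s assume "s \<in> sheets u"
  then show "s \<in> {s \<in> sheet_points. fst s = q u}"
    using assms by (auto simp: sheets_def sheet_def[abs_def] sheet_points_def) blast
qed

lemma sheet_points_subset: "sheet_points \<subseteq> topspace M \<times> topspace M"
  using q_in push_simplex by (auto simp: sheet_points_def sheet_def)

lemma topspace_sheet_space: "topspace sheet_space = sheet_points"
  using sheet_points_subset by (auto simp: sheet_space_def)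

lemma continuous_fst_sheet_space: "continuous_map sheet_space M fst"
  unfolding sheet_space_def by (intro continuous_map_from_subtopology continuous_map_fst)

lemma continuous_snd_sheet_space: "continuous_map sheet_space M snd"
  unfolding sheet_space_def by (intro continuous_map_from_subtopology continuous_map_snd)

lemma compact_sheet_points: "compactin (prod_topology M M) sheet_points"
proof -
  let ?K = "\<lambda>j. {x \<in> \<Delta>. x j = 1/8}"
  have "compactin (prod_topology M M) ((\<lambda>x. sheet (a, x) j) ` ?K j)" if a: "a < n" "j \<le> 3" for a j
  proof (rule image_compactin)
    have "closed {x :: nat \<Rightarrow> real. x j = 1/8}"
      by (intro closed_Collect_eq continuous_on_coordinate continuous_on_const)
    then have "compact (\<Delta> \<inter> {x. x j = 1/8})" by (rule compact_Int_closed[OF compact_simplex3])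
    then show "compactin (top_of_set \<Delta>) (?K j)" by (auto simp: compactin_subtopology Collect_conj_eq)
    have "continuous_map (top_of_set \<Delta>) M (q \<circ> Pair a)"
      by (rule continuous_map_compose[OF continuous_injection[OF a(1)] q_continuous])
    moreover have "continuous_map (top_of_set \<Delta>) (top_of_set \<Delta>) (push j)"
      using continuous_push push_simplex a(2) by auto
    ultimately show "continuous_map (top_of_set \<Delta>) (prod_topology M M) (\<lambda>x. sheet (a, x) j)"
      using continuous_map_compose[of "top_of_set \<Delta>" "top_of_set \<Delta>" "push j" M "q \<circ> Pair a"]
      by (simp add: sheet_def o_def continuous_map_pairwise)
  qed
  then have "compactin (prod_topology M M) (\<Union>(a, j) \<in> {..<n} \<times> {..3}. (\<lambda>x. sheet (a, x) j) ` ?K j)"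
    by (intro compactin_Union) auto
  moreover have "(\<Union>(a, j) \<in> {..<n} \<times> {..3}. (\<lambda>x. sheet (a, x) j) ` ?K j) = sheet_points"
    unfolding sheet_points_def by force
  ultimately show ?thesis by simp
qed

lemma surface_eq: "fst ` sheet_points = surface"
proof -
  have "fst ` sheet_points = q ` {u \<in> {..<n} \<times> \<Delta>. level u}"
    by (force simp: sheet_points_def sheet_def level_def image_iff)
  then show ?thesis by (simp add: surface_def)
qed

lemma closedin_surface: "closedin M surface"
proof -
  have "compactin M (fst ` sheet_points)"
    by (rule image_compactin[OF compact_sheet_points continuous_map_fst])
  then show ?thesis using compactin_imp_closedin[OF Hausdorff] surface_eq by simp
qed

lemma sheet_space_properties:
  "compact_space sheet_space" "Hausdorff_space sheet_space" "second_countable sheet_space"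
  using compact_sheet_points Hausdorff manifold
  by (auto simp: sheet_space_def compact_space_subtopology Hausdorff_space_subtopology Hausdorff_space_prod_topology
      second_countable_subtopology second_countable_prod_topology closed_manifold_def)

text \<open>
  The fibre over \<open>q (a, x)\<close> is an image of the set of coordinates of \<open>x\<close> equal to \<open>1/8\<close>. Not all four
  coordinates can have this value, so at a triple point exactly three do, and the remaining one is
  \<open>5/8\<close>.
\<close>

lemma card_triple_points:
  "card (triple_points sheet_space fst) \<le> 4 * n"
proof -
  let ?t = "\<lambda>(a, d). q (a, \<lambda>j. if j > 3 then 0 else if j = d then 5/8 else 1/8 :: real)"
  have "triple_points sheet_space fst \<subseteq> ?t ` ({..<n} \<times> {..3})"
  proof
    fix p assume "p \<in> triple_points sheet_space fst"
    then have c: "card {s \<in> sheet_points. fst s = p} = 3" by (simp add: triple_points_def topspace_sheet_space)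
    then have "{s \<in> sheet_points. fst s = p} \<noteq> {}" by force
    then obtain s where s: "s \<in> sheet_points" "fst s = p" by auto
    then have "p \<in> surface" using surface_eq by blast
    then obtain a x where ax: "a < n" "x \<in> \<Delta>" "p = q (a, x)" by (auto simp: surface_def)
    let ?C = "{j. j \<le> 3 \<and> x j = 1/8}"
    have "card (sheets (a, x)) = 3" using sheet_fibre[of "(a, x)"] ax c by simp
    moreover have "card (sheets (a, x)) \<le> card ?C" unfolding sheets_def by (simp add: card_image_le)
    ultimately have C3: "3 \<le> card ?C" by simp
    have sum: "x 0 + x 1 + x 2 + x 3 = 1" using ax(2) by (simp add: simplex3_iff atMost_3)
    have "?C \<noteq> {..3}"
    proof
      assume "?C = {..3}"
      then have "x j = 1/8" if "j \<le> 3" for j using that by auto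
      from this[of 0] this[of 1] this[of 2] this[of 3] show False using sum by simp
    qed
    then obtain d where d: "d \<le> 3" "x d \<noteq> 1/8" by auto
    have "?C = {..3} - {d}"
    proof (rule card_subset_eq)
      show "?C \<subseteq> {..3} - {d}" using d by auto
      have "card ({..3} - {d}) = 3" using d by (simp add: card_Diff_subset)
      moreover have "card ?C \<le> card ({..3} - {d})" using d by (intro card_mono) auto
      ultimately show "card ?C = card ({..3} - {d})" using C3 by simp
    qed simp
    then have xj: "x j = 1/8" if "j \<le> 3" "j \<noteq> d" for j using that by auto
    have "d = 0 \<or> d = 1 \<or> d = 2 \<or> d = 3" using d(1) by auto
    then have "x d = 5/8" using sum xj[of 0] xj[of 1] xj[of 2] xj[of 3] by auto
    then have "x = (\<lambda>j. if j > 3 then 0 else if j = d then 5/8 else 1/8)"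
      using xj ax(2) by (auto simp: fun_eq_iff simplex3_iff)
    then show "p \<in> ?t ` ({..<n} \<times> {..3})" using ax d(1) by force
  qed
  then have "card (triple_points sheet_space fst) \<le> card (?t ` ({..<n} \<times> {..3::nat}))"
    by (intro card_mono) auto
  also have "\<dots> \<le> card ({..<n} \<times> {..3::nat})" by (rule card_image_le) simp
  finally show ?thesis by simp
qed

text \<open>
  The gluing of face \<open>i\<close> is inverted by the gluing of its partner, so compatibility with the gluings
  needs to be checked in one direction only.
\<close>

lemma forward_saturated:
  assumes fw: "\<And>a x i b \<sigma>. a < n \<Longrightarrow> x \<in> \<Delta> \<Longrightarrow> i \<le> 3 \<Longrightarrow> x i = 0 \<Longrightarrow> G (a, i) = (b, \<sigma>) \<Longrightarrow>
      (a, x) \<in> N \<Longrightarrow> (b, x \<circ> inv_into UNIV \<sigma>) \<in> N"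
    and h: "a < n" "x \<in> \<Delta>" "i \<le> 3" "x i = 0" "G (a, i) = (b, \<sigma>)"
  shows "(a, x) \<in> N \<longleftrightarrow> (b, x \<circ> inv_into UNIV \<sigma>) \<in> N"
proof
  assume N: "(b, x \<circ> inv_into UNIV \<sigma>) \<in> N"
  note p = pairingD[OF h(5,1,3)]
  have "(x \<circ> inv_into UNIV \<sigma>) (\<sigma> i) = 0" using h(4) permutes_inverses[OF p(2)] by simp
  from fw[OF p(1) q_glued(2)[OF h] p(5) this p(4) N]
  show "(a, x) \<in> N" using permutes_inverses[OF p(2)] permutes_inv_inv[OF p(2)] by (simp add: o_def)
qed (use fw h in blast)

text \<open>
  A point outside the edges has no representatives except itself and, if it lies on a face, its
  image under the gluing of this face.
\<close>

lemma face_class: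
  assumes a: "a < n" "x \<in> \<Delta>" "i \<le> 3" "\<And>l. l \<le> 3 \<Longrightarrow> l \<noteq> i \<Longrightarrow> x l \<noteq> 0" "G (a, i) = (b, \<sigma>)"
    and u: "u \<in> {..<n} \<times> \<Delta>" "q u = q (a, x)"
  shows "u = (a, x) \<or> x i = 0 \<and> u = (b, x \<circ> inv_into UNIV \<sigma>)"
proof -
  define N where "N = {u. u = (a, x) \<or> x i = 0 \<and> u = (b, x \<circ> inv_into UNIV \<sigma>)}"
  note p = pairingD[OF a(5,1,3)]
  have iv: "inv_into UNIV \<sigma> (\<sigma> j) = j" "\<sigma> (inv_into UNIV \<sigma> j) = j" for j
    using permutes_inverses[OF p(2)] by auto
  have "(a, x) \<in> N = (u \<in> N)"
  proof (rule q_invariant[where F = "\<lambda>u. u \<in> N"])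
    fix c z l d \<tau> assume h: "c < n" "z \<in> \<Delta>" "l \<le> 3" "z l = 0" "G (c, l) = (d, \<tau>)"
    show "((c, z) \<in> N) = ((d, z \<circ> inv_into UNIV \<tau>) \<in> N)"
    proof (rule forward_saturated[OF _ h])
      fix c z l d \<tau> assume h: "c < n" "z \<in> \<Delta>" "l \<le> 3" "z l = 0" "G (c, l) = (d, \<tau>)" "(c, z) \<in> N"
      show "(d, z \<circ> inv_into UNIV \<tau>) \<in> N"
      proof (cases "(c, z) = (a, x)")
        case True
        then have "l = i" using a(4)[of l] h(3,4) by auto
        then show ?thesis using True h(4,5) a(5) by (auto simp: N_def)
      next
        case False
        then have z: "x i = 0" "c = b" "z = x \<circ> inv_into UNIV \<sigma>" using h(6) by (auto simp: N_def)
        have "inv_into UNIV \<sigma> l = i"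
          using a(4)[of "inv_into UNIV \<sigma> l"] h(3,4) z(3) permutes_le3[OF permutes_inv[OF p(2)], of l] by auto
        then have "l = \<sigma> i" using iv by metis
        then have "d = a" "\<tau> = inv_into UNIV \<sigma>" using h(5) p(4) z(2) by auto
        then show ?thesis using z(3) iv permutes_inv_inv[OF p(2)] by (simp add: N_def o_def)
      qed
    qed
  qed (use u a in auto)
  then show ?thesis by (auto simp: N_def)
qed

text \<open>
  Two coordinates equal to \<open>1/8\<close> leave \<open>3/4\<close> for the others, so at most one coordinate vanishes. If
  the two pushed points were identified, this would be through the gluing of a face; they lie in the
  same face of the same tetrahedron, but no face is glued to itself.
\<close>

lemma sheets_separated:
  assumes a: "a < n" "x \<in> \<Delta>" and j: "j \<le> 3" "x j = 1/8" "j' \<le> 3" "x j' = 1/8" "j \<noteq> j'"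
  shows "sheet (a, x) j \<noteq> sheet (a, x) j'"
proof
  assume "sheet (a, x) j = sheet (a, x) j'"
  then have e: "q (a, push j' x) = q (a, push j x)" by (simp add: sheet_def)
  have sum: "x 0 + x 1 + x 2 + x 3 = 1" using a(2) by (simp add: simplex3_iff atMost_3)
  have "\<exists>i\<le>3. \<forall>l\<le>3. l \<noteq> i \<longrightarrow> x l \<noteq> 0"
  proof (rule ccontr)
    assume n: "\<not> ?thesis"
    obtain l where l: "l \<le> 3" "l \<noteq> j" "x l = 0" using n j(1) by blast
    obtain l' where l': "l' \<le> 3" "l' \<noteq> l" "x l' = 0" using n l(1) by blast
    have d: "distinct [j, j', l, l']" using j l l' by auto
    have "(\<Sum>i\<in>set [j, j', l, l']. x i) = (\<Sum>i\<le>3. x i)"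
      using d j(1,3) l(1) l'(1) distinct_card[OF d] by (intro sum.cong card_subset_eq) auto
    then have "x j + x j' + x l + x l' = 1" using d a(2) by (simp add: simplex3_iff)
    then show False using j l l' by simp
  qed
  then obtain i where i: "i \<le> 3" "\<And>l. l \<le> 3 \<Longrightarrow> l \<noteq> i \<Longrightarrow> x l \<noteq> 0" by blast
  obtain b \<sigma> where G: "G (a, i) = (b, \<sigma>)" by fastforce
  have x0: "0 \<le> x l" for l using a(2) by (simp add: simplex3_iff)
  have nz: "push k x l \<noteq> 0" if "l \<le> 3" "l \<noteq> i" for k l
    using i(2)[OF that] x0[of l] by (auto simp: push_def)
  have "push j' x j \<noteq> push j x j" using j(5) by (simp add: push_def)
  then have ne: "(a, push j' x) \<noteq> (a, push j x)" by (auto simp: fun_eq_iff)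
  have "(a, push j' x) = (a, push j x) \<or> push j x i = 0 \<and> (a, push j' x) = (b, push j x \<circ> inv_into UNIV \<sigma>)"
    by (rule face_class[OF a(1) push_simplex[OF a(2) j(1)] i(1) nz G])
      (use a push_simplex[OF a(2) j(3)] e in auto)
  then have z: "push j x i = 0" "a = b" "push j' x = push j x \<circ> inv_into UNIV \<sigma>" using ne by auto
  note p = pairingD[OF G a(1) i(1)]
  have "push j' x (\<sigma> i) = 0" using z(1,3) permutes_inverses[OF p(2)] by simp
  then have "\<sigma> i = i" using nz[of "\<sigma> i" j'] p(5) by auto
  then show False using p(3) z(2) by simp
qed

end

section \<open>Crossing charts from corners\<close>

text \<open>
  Data for a chart at a point of the surface. There is one corner \<open>(ca k, ct k)\<close>, with \<open>k < m\<close>, for each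
  way in which a tetrahedron contains the point; \<open>ct k\<close> lists the vertices so that in the listed
  coordinates \<open>y = x \<circ> ct k\<close> the point is always \<open>y0\<close>, and \<open>P\<close> is the neighbourhood
  of \<open>y0\<close> that each corner contributes. The map \<open>\<phi> k\<close> is the chart on corner \<open>k\<close>; the first
  \<open>d\<close> coordinates of \<open>y0\<close> are those at level \<open>1/8\<close>, and they correspond to the first \<open>d\<close> coordinates of
  the chart. In the assumption \<open>glue\<close> the permutation \<open>\<pi>\<close> accounts for the different listing of the
  vertices in the next corner; it fixes the first \<open>d\<close> positions, as it has to respect the sheets.
\<close>

locale corner_chart = triangulation +
  fixes m :: nat and ca :: "nat \<Rightarrow> nat" and ct :: "nat \<Rightarrow> nat \<Rightarrow> nat" and P :: "(nat \<Rightarrow> real) set"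
    and \<phi> :: "nat \<Rightarrow> (nat \<Rightarrow> real) \<Rightarrow> nat \<Rightarrow> real" and d :: nat and y0 :: "nat \<Rightarrow> real"
  assumes corner: "\<And>k. k < m \<Longrightarrow> ca k < n \<and> ct k permutes {..3}"
    and P_open: "openin (top_of_set \<Delta>) P" and d3: "d \<le> 3"
    and phi_cont: "\<And>k. k < m \<Longrightarrow> continuous_map (top_of_set P) (Euclidean_space 3) (\<phi> k)"
    and phi_level: "\<And>k y i. k < m \<Longrightarrow> y \<in> P \<Longrightarrow> i \<le> 3 \<Longrightarrow> y i = 1/8 \<longleftrightarrow> i < d \<and> \<phi> k y i = 0"
    and disjoint: "\<And>k l y z. k < m \<Longrightarrow> l < m \<Longrightarrow> y \<in> P \<Longrightarrow> z \<in> P \<Longrightarrow> ca k = ca l \<Longrightarrow>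
        y \<circ> inv_into UNIV (ct k) = z \<circ> inv_into UNIV (ct l) \<Longrightarrow> k = l"
    and glue: "\<And>k y i b \<sigma>. k < m \<Longrightarrow> y \<in> P \<Longrightarrow> i \<le> 3 \<Longrightarrow> y i = 0 \<Longrightarrow> G (ca k, ct k i) = (b, \<sigma>) \<Longrightarrow>
        \<exists>l \<pi>. l < m \<and> ca l = b \<and> \<pi> permutes {..3} \<and> (\<forall>i<d. \<pi> i = i) \<and> ct l = \<sigma> \<circ> ct k \<circ> \<pi> \<and>
          y \<circ> \<pi> \<in> P \<and> \<phi> l (y \<circ> \<pi>) = \<phi> k y"
    and phi_inj: "\<And>k l y z. k < m \<Longrightarrow> l < m \<Longrightarrow> y \<in> P \<Longrightarrow> z \<in> P \<Longrightarrow> \<phi> k y = \<phi> l z \<Longrightarrow>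
        q (ca k, y \<circ> inv_into UNIV (ct k)) = q (ca l, z \<circ> inv_into UNIV (ct l))"
    and base: "0 < m" "y0 \<in> P" "\<phi> 0 y0 = (\<lambda>_. 0)"
begin

lemma P_sub: "P \<subseteq> \<Delta>" using openin_subset[OF P_open] by simp

definition piece :: "nat \<Rightarrow> (nat \<Rightarrow> real) set" where
  "piece k = {x \<in> \<Delta>. x \<circ> ct k \<in> P}"

definition nbhd :: "(nat \<times> (nat \<Rightarrow> real)) set" where
  "nbhd = (\<Union>k<m. {ca k} \<times> piece k)"

lemma ct_inv:
  fixes x y :: "nat \<Rightarrow> real"
  assumes "k < m"
  shows "(y \<circ> inv_into UNIV (ct k)) \<circ> ct k = y" "(x \<circ> ct k) \<circ> inv_into UNIV (ct k) = x"
  using permutes_inverses[of "ct k" "{..3}"] corner[OF assms] by (auto simp: fun_eq_iff)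

lemma openin_piece_set: "k < m \<Longrightarrow> openin (top_of_set \<Delta>) (piece k)"
proof -
  assume k: "k < m"
  have "continuous_map (top_of_set \<Delta>) (top_of_set \<Delta>) (\<lambda>x. x \<circ> ct k)"
    using simplex3_permute[of "ct k"] corner[OF k]
    by (auto simp: o_def intro!: continuous_on_coordinatewise_then_product continuous_on_coordinate)
  from openin_continuous_map_preimage[OF this P_open]
  show "openin (top_of_set \<Delta>) (piece k)" by (simp add: piece_def)
qed

lemma openin_nbhd: "openin (tetrahedra n) nbhd"
  unfolding nbhd_def using openin_piece openin_piece_set corner by blast

lemma nbhd_sub: "nbhd \<subseteq> {..<n} \<times> \<Delta>"
  using openin_subset[OF openin_nbhd] by (simp add: topspace_tetrahedra)

lemma corner_unique:
  assumes "k < m" "l < m" "(a, x) \<in> {ca k} \<times> piece k" "(a, x) \<in> {ca l} \<times> piece l"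
  shows "k = l"
  using disjoint[OF assms(1,2), of "x \<circ> ct k" "x \<circ> ct l"] assms ct_inv by (auto simp: piece_def)

definition corner_of :: "nat \<times> (nat \<Rightarrow> real) \<Rightarrow> nat" where
  "corner_of u = (SOME k. k < m \<and> u \<in> {ca k} \<times> piece k)"

lemma corner_of:
  assumes "k < m" "u \<in> {ca k} \<times> piece k"
  shows "corner_of u = k"
  unfolding corner_of_def
proof (rule some_equality)
  show "l = k" if "l < m \<and> u \<in> {ca l} \<times> piece l" for l
    using corner_unique[of l k "fst u" "snd u"] that assms by simp
qed (use assms in simp)

definition coord :: "nat \<times> (nat \<Rightarrow> real) \<Rightarrow> nat \<Rightarrow> real" where
  "coord u = \<phi> (corner_of u) (snd u \<circ> ct (corner_of u))"

text \<open>
  The \<open>i\<close>-th sheet of the surface near the point. It is a point of the surface only where the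
  \<open>i\<close>-th coordinate of the chart vanishes, but the formula is continuous on the whole neighbourhood.
\<close>

definition strand :: "nat \<Rightarrow> nat \<times> (nat \<Rightarrow> real) \<Rightarrow> 'a \<times> 'a" where
  "strand i u = sheet u (ct (corner_of u) i)"

lemma nbhdE:
  assumes "u \<in> nbhd"
  obtains k x where "u = (ca k, x)" "k < m" "x \<in> \<Delta>" "x \<circ> ct k \<in> P" "corner_of u = k" "ca k < n"
    "coord u = \<phi> k (x \<circ> ct k)" "ct k permutes {..3}"
proof -
  obtain k where k: "k < m" "u \<in> {ca k} \<times> piece k" using assms by (auto simp: nbhd_def)
  note c = corner_of[OF k]
  obtain x where x: "u = (ca k, x)" "x \<in> piece k" using k(2) by auto
  show thesis by (rule that[OF x(1) k(1)]) (use x c corner[OF k(1)] in \<open>auto simp: piece_def coord_def\<close>)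
qed

lemma nbhd_glued:
  assumes h: "a < n" "x \<in> \<Delta>" "i \<le> 3" "x i = 0" "G (a, i) = (b, \<sigma>)" and N: "(a, x) \<in> nbhd"
  defines "v \<equiv> (b, x \<circ> inv_into UNIV \<sigma>)"
  shows "v \<in> nbhd" "coord v = coord (a, x)"
    "j < d \<Longrightarrow> coord (a, x) j = 0 \<Longrightarrow> strand j v = strand j (a, x)"
proof -
  from N obtain k where k: "a = ca k" "k < m" "x \<circ> ct k \<in> P" "corner_of (a, x) = k" "ca k < n"
    "coord (a, x) = \<phi> k (x \<circ> ct k)" "ct k permutes {..3}"
    by (rule nbhdE) auto
  note p = pairingD[OF h(5,1,3)]
  define i' where "i' = inv_into UNIV (ct k) i"
  have i': "ct k i' = i" "i' \<le> 3"
    using permutes_inverses[OF k(7)] permutes_le3[OF permutes_inv[OF k(7)]] h(3) by (auto simp: i'_def)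
  obtain l \<pi> where l: "l < m" "ca l = b" "\<pi> permutes {..3}" "\<forall>i<d. \<pi> i = i" "ct l = \<sigma> \<circ> ct k \<circ> \<pi>"
      "x \<circ> ct k \<circ> \<pi> \<in> P" "\<phi> l (x \<circ> ct k \<circ> \<pi>) = \<phi> k (x \<circ> ct k)"
    using glue[OF k(2,3) i'(2), of b \<sigma>] i'(1) h(4,5) k(1) by auto
  have e: "(x \<circ> inv_into UNIV \<sigma>) \<circ> ct l = x \<circ> ct k \<circ> \<pi>"
    using permutes_inverses[OF p(2)] by (auto simp: l(5) fun_eq_iff)
  have "v \<in> {ca l} \<times> piece l" using l e q_glued(2)[OF h] by (simp add: v_def piece_def)
  then have v: "v \<in> nbhd" "corner_of v = l" using l(1) corner_of by (auto simp: nbhd_def)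
  then show "v \<in> nbhd" by simp
  show "coord v = coord (a, x)" using v(2) e l(7) k(6) by (simp add: coord_def v_def)
  assume j: "j < d" "coord (a, x) j = 0"
  have "(x \<circ> ct k) j = 1/8" using phi_level[OF k(2,3), of j] j k(6) d3 by auto
  then have "sheet v (\<sigma> (ct k j)) = sheet (a, x) (ct k j)"
    unfolding v_def using j(1) d3 permutes_le3[OF k(7), of j] by (intro sheet_glued[OF h]) auto
  then show "strand j v = strand j (a, x)" using v(2) k(4) l(4,5) j(1) by (simp add: strand_def)
qed

lemma nbhd_image:
  shows "openin M (q ` nbhd)" "quotient_map (subtopology (tetrahedra n) nbhd) (subtopology M (q ` nbhd)) q"
    "\<And>u. u \<in> {..<n} \<times> \<Delta> \<Longrightarrow> q u \<in> q ` nbhd \<longleftrightarrow> u \<in> nbhd"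
proof -
  have sat: "(a, x) \<in> nbhd \<longleftrightarrow> (b, x \<circ> inv_into UNIV \<sigma>) \<in> nbhd"
    if "a < n" "x \<in> \<Delta>" "i \<le> 3" "x i = 0" "G (a, i) = (b, \<sigma>)" for a x i b \<sigma>
    by (rule forward_saturated[OF _ that]) (rule nbhd_glued(1))
  note * = open_saturated_image[OF openin_nbhd]
  show "openin M (q ` nbhd)" by (rule *(1)) (rule sat)
  show "quotient_map (subtopology (tetrahedra n) nbhd) (subtopology M (q ` nbhd)) q" by (rule *(2)) (rule sat)
  show "\<And>u. u \<in> {..<n} \<times> \<Delta> \<Longrightarrow> q u \<in> q ` nbhd \<longleftrightarrow> u \<in> nbhd" by (rule *(3)) (use sat in blast)
qed

text \<open>
  Coordinates and strands depend on the point of \<open>M\<close> only. For strands this holds just where they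
  are points of the surface, hence the partial function in the proof.
\<close>

lemma coord_strand_invariant:
  assumes "u \<in> nbhd" "v \<in> nbhd" "q u = q v"
  shows "coord u = coord v" "j < d \<Longrightarrow> coord u j = 0 \<Longrightarrow> strand j u = strand j v"
proof -
  define F where "F w = (if w \<in> nbhd then Some (coord w, \<lambda>j. if j < d \<and> coord w j = 0 then Some (strand j w) else None)
      else None)" for w
  have "F u = F v"
  proof (rule q_invariant)
    fix a x i b \<sigma> assume h: "a < n" "x \<in> \<Delta>" "i \<le> 3" "x i = 0" "G (a, i) = (b, \<sigma>)"
    let ?v = "(b, x \<circ> inv_into UNIV \<sigma>)"
    have iff: "(a, x) \<in> nbhd \<longleftrightarrow> ?v \<in> nbhd"
      by (rule forward_saturated[OF _ h]) (rule nbhd_glued(1))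
    show "F (a, x) = F ?v"
    proof (cases "(a, x) \<in> nbhd")
      case True
      then show ?thesis using iff nbhd_glued(2,3)[OF h True] by (auto simp: F_def fun_eq_iff)
    next
      case False
      then show ?thesis using iff by (simp add: F_def)
    qed
  qed (use assms nbhd_sub in auto)
  then have *: "coord u = coord v"
    "(\<lambda>j. if j < d \<and> coord u j = 0 then Some (strand j u) else None) =
     (\<lambda>j. if j < d \<and> coord v j = 0 then Some (strand j v) else None)"
    using assms by (auto simp: F_def)
  show "coord u = coord v" by (rule *(1))
  show "j < d \<Longrightarrow> coord u j = 0 \<Longrightarrow> strand j u = strand j v"
    using fun_cong[OF *(2), of j] *(1) by simp
qed

lemma continuous_on_nbhd:
  assumes "\<And>k. k < m \<Longrightarrow> continuous_map (top_of_set (piece k)) Z (\<lambda>x. f (ca k, x))"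
  shows "continuous_map (subtopology (tetrahedra n) nbhd) Z f"
proof (rule pasting_lemma[where I = "{..<m}" and T = "\<lambda>k. {ca k} \<times> piece k" and f = "\<lambda>_. f"])
  fix k assume "k \<in> {..<m}"
  then have k: "k < m" by simp
  have sub: "{ca k} \<times> piece k \<subseteq> nbhd" using k by (auto simp: nbhd_def)
  show "openin (subtopology (tetrahedra n) nbhd) ({ca k} \<times> piece k)"
    using sub openin_piece[OF _ openin_piece_set[OF k]] corner[OF k] openin_open_subtopology[OF openin_nbhd] by simp
  have "continuous_map (subtopology (tetrahedra n) ({ca k} \<times> piece k)) Z f"
    by (rule continuous_on_piece) (use assms[OF k] in \<open>auto simp: piece_def\<close>)
  then show "continuous_map (subtopology (subtopology (tetrahedra n) nbhd) ({ca k} \<times> piece k)) Z f"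
    using sub by (simp add: subtopology_subtopology Int_absorb1)
qed (auto simp: nbhd_def)

lemma continuous_coord: "continuous_map (subtopology (tetrahedra n) nbhd) (Euclidean_space 3) coord"
proof (rule continuous_on_nbhd)
  fix k assume k: "k < m"
  have "continuous_on (piece k) (\<lambda>x. x \<circ> ct k)"
    by (auto simp: o_def intro!: continuous_on_coordinatewise_then_product continuous_on_coordinate)
  then have "continuous_map (top_of_set (piece k)) (top_of_set P) (\<lambda>x. x \<circ> ct k)"
    by (auto simp: piece_def)
  from continuous_map_compose[OF this phi_cont[OF k]]
  show "continuous_map (top_of_set (piece k)) (Euclidean_space 3) (\<lambda>x. coord (ca k, x))"
    by (rule continuous_map_eq) (use corner_of[OF k] in \<open>auto simp: coord_def\<close>)
qed

lemma continuous_strand: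
  assumes j: "j \<le> 3"
  shows "continuous_map (subtopology (tetrahedra n) nbhd) M (\<lambda>u. snd (strand j u))"
proof (rule continuous_on_nbhd)
  fix k assume k: "k < m"
  have c: "ct k j \<le> 3" using permutes_le3[of "ct k" j] corner[OF k] j by simp
  have "continuous_map (top_of_set (piece k)) (top_of_set \<Delta>) (push (ct k j))"
    using continuous_push push_simplex[OF _ c] by (auto simp: piece_def)
  then have "continuous_map (top_of_set (piece k)) M (q \<circ> (Pair (ca k) \<circ> push (ct k j)))"
    using corner[OF k] by (intro continuous_map_compose[OF continuous_map_compose[OF _ continuous_injection] q_continuous]) auto
  then show "continuous_map (top_of_set (piece k)) M (\<lambda>x. snd (strand j (ca k, x)))"
    by (rule continuous_map_eq) (use corner_of[OF k] in \<open>auto simp: strand_def sheet_def\<close>)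
qed

lemma coord_injective:
  assumes "u \<in> nbhd" "v \<in> nbhd" "coord u = coord v"
  shows "q u = q v"
proof -
  obtain k x where k: "u = (ca k, x)" "k < m" "x \<circ> ct k \<in> P" "coord u = \<phi> k (x \<circ> ct k)"
    using assms(1) by (rule nbhdE)
  obtain l z where l: "v = (ca l, z)" "l < m" "z \<circ> ct l \<in> P" "coord v = \<phi> l (z \<circ> ct l)"
    using assms(2) by (rule nbhdE)
  show ?thesis using phi_inj[OF k(2) l(2) k(3) l(3)] assms(3) k l ct_inv(2)[OF k(2)] ct_inv(2)[OF l(2)] by simp
qed

lemma strands:
  assumes "u \<in> nbhd"
  shows "sheets u = {strand i u | i. i < d \<and> coord u i = 0}"
    "i < d \<Longrightarrow> j < d \<Longrightarrow> i \<noteq> j \<Longrightarrow> coord u i = 0 \<Longrightarrow> coord u j = 0 \<Longrightarrow> strand i u \<noteq> strand j u"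
proof -
  obtain k x where k: "u = (ca k, x)" "k < m" "x \<in> \<Delta>" "x \<circ> ct k \<in> P" "corner_of u = k" "ca k < n"
      "coord u = \<phi> k (x \<circ> ct k)" "ct k permutes {..3}"
    using assms by (rule nbhdE)
  have lev: "x (ct k i) = 1/8 \<longleftrightarrow> i < d \<and> coord u i = 0" if "i \<le> 3" for i
    using phi_level[OF k(2,4) that] k(7) by simp
  have le: "ct k i \<le> 3 \<longleftrightarrow> i \<le> 3" for i by (rule permutes_le3[OF k(8)])
  have "{j. j \<le> 3 \<and> x j = 1/8} = ct k ` {i. i < d \<and> coord u i = 0}"
  proof (intro equalityI subsetI)
    fix j assume j: "j \<in> {j. j \<le> 3 \<and> x j = 1/8}"
    define i where "i = inv_into UNIV (ct k) j"
    have i: "j = ct k i" using permutes_inverses[OF k(8)] by (simp add: i_def)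
    then show "j \<in> ct k ` {i. i < d \<and> coord u i = 0}" using j lev[of i] le[of i] by auto
  next
    fix j assume "j \<in> ct k ` {i. i < d \<and> coord u i = 0}"
    then obtain i where "j = ct k i" "i < d" "coord u i = 0" by auto
    then show "j \<in> {j. j \<le> 3 \<and> x j = 1/8}" using lev[of i] le[of i] d3 by auto
  qed
  then show "sheets u = {strand i u | i. i < d \<and> coord u i = 0}"
    using k(1,5) by (auto simp: sheets_def strand_def)
  assume h: "i < d" "j < d" "i \<noteq> j" "coord u i = 0" "coord u j = 0"
  have "ct k i \<noteq> ct k j" using h(3) permutes_inj[OF k(8)] by (auto simp: inj_def)
  then have "sheet (ca k, x) (ct k i) \<noteq> sheet (ca k, x) (ct k j)"
    using h d3 lev[of i] lev[of j] le[of i] le[of j] by (intro sheets_separated[OF k(6,3)]) auto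
  then show "strand i u \<noteq> strand j u" using k(5) unfolding strand_def k(1) by simp
qed

text \<open>
  Over the \<open>i\<close>-th coordinate plane the \<open>i\<close>-th sheet is the graph of a continuous function into \<open>M\<close>,
  by restricting the quotient map to this closed set.
\<close>

lemma section_exists:
  assumes i: "i < d"
  obtains s where "continuous_map (subtopology M {m \<in> q ` nbhd. \<exists>u\<in>nbhd. m = q u \<and> coord u i = 0}) M s"
    "\<And>u. u \<in> nbhd \<Longrightarrow> coord u i = 0 \<Longrightarrow> s (q u) = snd (strand i u)"
proof -
  let ?N = "{u \<in> nbhd. coord u i = 0}"
  let ?Z = "{m \<in> q ` nbhd. \<exists>u\<in>nbhd. m = q u \<and> coord u i = 0}"
  let ?TN = "subtopology (tetrahedra n) nbhd" and ?MN = "subtopology M (q ` nbhd)"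
  have tT: "topspace ?TN = nbhd" using nbhd_sub by (auto simp: topspace_tetrahedra)
  have Nq: "q u \<in> ?Z \<longleftrightarrow> coord u i = 0" if "u \<in> nbhd" for u
  proof
    assume "q u \<in> ?Z"
    then obtain v where v: "v \<in> nbhd" "q u = q v" "coord v i = 0" by blast
    then show "coord u i = 0" using coord_strand_invariant(1)[OF that v(1,2)] by simp
  qed (use that in blast)
  have eq: "{u \<in> topspace ?TN. q u \<in> ?Z} = ?N" using Nq tT by auto
  have clN: "closedin ?TN ?N"
  proof -
    have "continuous_map ?TN euclideanreal (\<lambda>u. coord u i)"
      using continuous_coord unfolding Euclidean_space_def
      by (simp add: continuous_map_in_subtopology continuous_map_componentwise_UNIV)
    from closedin_continuous_map_preimage[OF this, of "{0}"] show ?thesis unfolding tT by simp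
  qed
  have "?Z \<subseteq> topspace ?MN" using openin_subset[OF nbhd_image(1)] by auto
  then have "closedin ?TN {u \<in> topspace ?TN. q u \<in> ?Z} = closedin ?MN ?Z"
    using nbhd_image(2) unfolding quotient_map_closedin by blast
  then have "closedin ?MN ?Z" using clN unfolding eq by simp
  then have quo: "quotient_map (subtopology ?TN ?N) (subtopology ?MN ?Z) q"
    by (intro quotient_map_restriction[OF nbhd_image(2) eq]) simp
  have MZ: "subtopology ?MN ?Z = subtopology M ?Z"
  proof -
    have "q ` nbhd \<inter> ?Z = ?Z" by blast
    then show ?thesis by (simp add: subtopology_subtopology)
  qed
  have cs: "continuous_map (subtopology ?TN ?N) M (\<lambda>u. snd (strand i u))"
    by (rule continuous_map_from_subtopology[OF continuous_strand]) (use i d3 in simp)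
  have tN: "topspace (subtopology ?TN ?N) = ?N" using tT by auto
  obtain s where s: "continuous_map (subtopology ?MN ?Z) M s"
    "\<And>u. u \<in> topspace (subtopology ?TN ?N) \<Longrightarrow> s (q u) = snd (strand i u)"
  proof (rule quotient_map_lift_exists[OF quo cs])
    fix u v assume "u \<in> topspace (subtopology ?TN ?N)" "v \<in> topspace (subtopology ?TN ?N)" "q u = q v"
    then show "snd (strand i u) = snd (strand i v)"
      unfolding tN using coord_strand_invariant(2)[of u v i] i by simp
  qed (rule that)
  show thesis
  proof (rule that)
    show "continuous_map (subtopology M ?Z) M s" using s(1) unfolding MZ .
    show "s (q u) = snd (strand i u)" if "u \<in> nbhd" "coord u i = 0" for u
      using s(2) that unfolding tN by simp
  qed
qed

text \<open>
  The preimage of the chart domain in the surface is the disjoint union of graphs over the coordinate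
  planes. Each graph is closed in it, as the planes are closed and \<open>M\<close> is a Hausdorff space; being
  finitely many, the graphs are also open.
\<close>

theorem crossing_chart_exists:
  "\<exists>U \<psi> W. crossing_chart sheet_space M fst (q (ca 0, y0 \<circ> inv_into UNIV (ct 0))) U \<psi> d W"
proof -
  let ?p = "q (ca 0, y0 \<circ> inv_into UNIV (ct 0))"
  let ?TN = "subtopology (tetrahedra n) nbhd" and ?MN = "subtopology M (q ` nbhd)"
  have tT: "topspace ?TN = nbhd" using nbhd_sub by (auto simp: topspace_tetrahedra)
  define u0 where "u0 = (ca 0, y0 \<circ> inv_into UNIV (ct 0))"
  have "u0 \<in> {ca 0} \<times> piece 0"
    using base(2) P_sub ct_inv(1)[OF base(1)] simplex3_permute[OF permutes_inv, of "ct 0" y0] corner[OF base(1)]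
    by (auto simp: u0_def piece_def)
  then have u0: "u0 \<in> nbhd" "coord u0 = (\<lambda>_. 0)"
    using base corner_of[OF base(1)] ct_inv(1)[OF base(1)] by (auto simp: nbhd_def coord_def u0_def)
  obtain g where g: "continuous_map ?MN (Euclidean_space 3) g" "\<And>u. u \<in> nbhd \<Longrightarrow> g (q u) = coord u"
  proof (rule quotient_map_lift_exists[OF nbhd_image(2) continuous_coord])
    show "coord u = coord v" if "u \<in> topspace ?TN" "v \<in> topspace ?TN" "q u = q v" for u v
      using that coord_strand_invariant(1) tT by simp
  next
    fix g assume "continuous_map ?MN (Euclidean_space 3) g" "\<And>u. u \<in> topspace ?TN \<Longrightarrow> g (q u) = coord u"
    then show thesis unfolding tT by (rule that)
  qed
  have ginj: "inj_on g (q ` nbhd)"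
  proof (rule inj_onI)
    fix x y assume "x \<in> q ` nbhd" "y \<in> q ` nbhd" and e: "g x = g y"
    then obtain u v where "u \<in> nbhd" "x = q u" "v \<in> nbhd" "y = q v" by blast
    then show "x = y" using e g(2) coord_injective[of u v] by simp
  qed
  have p: "?p \<in> q ` nbhd" "g ?p = (\<lambda>_. 0)" using u0 g(2) unfolding u0_def by auto
  obtain U \<psi> where U: "openin M U" "U \<subseteq> q ` nbhd" "?p \<in> U"
    "homeomorphic_map (subtopology M U) (Euclidean_space 3) \<psi>" "\<psi> ?p = (\<lambda>_. 0)"
    "\<And>x i. x \<in> U \<Longrightarrow> \<psi> x i = 0 \<longleftrightarrow> g x i = 0"
    by (rule chart_from_injection[OF manifold nbhd_image(1) p(1) g(1) ginj p(2)]) (rule that)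
  have Usub: "U \<subseteq> topspace M" using openin_subset[OF U(1)] .
  define W where "W i = {strand i u | u. u \<in> nbhd \<and> q u \<in> U \<and> coord u i = 0}" for i
  have WI: "strand i u \<in> W i" if "u \<in> nbhd" "q u \<in> U" "coord u i = 0" for i u
    unfolding W_def using that by blast
  have fst_strand: "fst (strand i u) = q u" for i u by (simp add: strand_def sheet_def)
  have Wi: "strand i u \<in> sheet_points" if "u \<in> nbhd" "i < d" "coord u i = 0" for i u
    using strands(1)[OF that(1)] sheet_fibre[of u] that nbhd_sub by blast
  have pre: "{s \<in> topspace sheet_space. fst s \<in> U} = (\<Union>i<d. W i)"
  proof (intro equalityI subsetI)
    fix s assume s: "s \<in> {s \<in> topspace sheet_space. fst s \<in> U}"
    then obtain u where u: "u \<in> nbhd" "fst s = q u" using U(2) by blast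
    then have "s \<in> sheets u" using sheet_fibre[of u] nbhd_sub s by (auto simp: topspace_sheet_space)
    then obtain i where i: "i < d" "coord u i = 0" "s = strand i u" using strands(1)[OF u(1)] by blast
    moreover have "q u \<in> U" using u(2) s by simp
    ultimately have "s \<in> W i" using WI[OF u(1)] by simp
    then show "s \<in> (\<Union>i<d. W i)" using i by blast
  next
    fix s assume "s \<in> (\<Union>i<d. W i)"
    then obtain i u where "i < d" "u \<in> nbhd" "q u \<in> U" "coord u i = 0" "s = strand i u" unfolding W_def by blast
    then show "s \<in> {s \<in> topspace sheet_space. fst s \<in> U}"
      using Wi[of u i] fst_strand[of i u] by (simp add: topspace_sheet_space)
  qed
  have disj: "W i \<inter> W j = {}" if ij: "i < d" "j < d" "i \<noteq> j" for i j
  proof (rule ccontr)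
    assume "W i \<inter> W j \<noteq> {}"
    then obtain u v where h: "u \<in> nbhd" "coord u i = 0" "v \<in> nbhd" "coord v j = 0" "strand i u = strand j v"
      unfolding W_def by blast
    then have e: "q v = q u" using fst_strand by metis
    have "coord v = coord u" "strand j v = strand j u"
      using coord_strand_invariant[OF h(3,1) e] ij(2) h(4) by auto
    then show False using strands(2)[OF h(1) ij] h by simp
  qed
  have SU: "openin sheet_space {s \<in> topspace sheet_space. fst s \<in> U}"
    by (rule openin_continuous_map_preimage[OF continuous_fst_sheet_space U(1)])
  have closedW: "closedin (subtopology sheet_space {s \<in> topspace sheet_space. fst s \<in> U}) (W i)"
    and homW: "homeomorphic_map (subtopology sheet_space (W i))
        (subtopology (Euclidean_space 3) {x. x i = 0}) (\<psi> \<circ> fst)"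
    if i: "i < d" for i
  proof -
    let ?Z = "{m \<in> q ` nbhd. \<exists>u\<in>nbhd. m = q u \<and> coord u i = 0}"
    let ?SU = "subtopology sheet_space {s \<in> topspace sheet_space. fst s \<in> U}"
    have tSU: "topspace ?SU = {s \<in> sheet_points. fst s \<in> U}" by (auto simp: topspace_sheet_space)
    have Z: "?Z = {m \<in> q ` nbhd. g m i = 0}" using g(2) by auto
    obtain s where s: "continuous_map (subtopology M ?Z) M s"
        "\<And>u. u \<in> nbhd \<Longrightarrow> coord u i = 0 \<Longrightarrow> s (q u) = snd (strand i u)"
      using section_exists[OF i] by blast
    have W_eq: "W i = {t \<in> sheet_points. fst t \<in> U \<and> fst t \<in> ?Z \<and> snd t = s (fst t)}"
    proof (intro equalityI subsetI)
      fix t assume "t \<in> W i"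
      then obtain u where "u \<in> nbhd" "q u \<in> U" "coord u i = 0" "t = strand i u" unfolding W_def by blast
      then show "t \<in> {t \<in> sheet_points. fst t \<in> U \<and> fst t \<in> ?Z \<and> snd t = s (fst t)}"
        using Wi i s(2) fst_strand by auto
    next
      fix t assume t: "t \<in> {t \<in> sheet_points. fst t \<in> U \<and> fst t \<in> ?Z \<and> snd t = s (fst t)}"
      then obtain u where u: "u \<in> nbhd" "fst t = q u" "coord u i = 0" by auto
      then have "t = strand i u" using t s(2) fst_strand by (intro prod_eqI) auto
      moreover have "q u \<in> U" using u(2) t by simp
      ultimately show "t \<in> W i" using WI[OF u(1) _ u(3)] by simp
    qed
    have Wsub: "W i \<subseteq> sheet_points" using W_eq by auto
    show "closedin ?SU (W i)"
    proof -
      have cf: "continuous_map ?SU M fst" "continuous_map ?SU M snd"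
        by (intro continuous_map_from_subtopology continuous_fst_sheet_space continuous_snd_sheet_space)+
      have "continuous_map ?SU ?MN fst"
        using cf(1) U(2) by (auto simp: continuous_map_in_subtopology)
      from continuous_map_compose[OF this g(1)] have "continuous_map ?SU (Euclidean_space 3) (g \<circ> fst)" .
      then have "continuous_map ?SU euclideanreal (\<lambda>t. (g \<circ> fst) t i)"
        unfolding Euclidean_space_def
        by (simp add: continuous_map_in_subtopology continuous_map_componentwise_UNIV)
      from closedin_continuous_map_preimage[OF this, of "{0}"]
      have cl1: "closedin ?SU {t \<in> topspace ?SU. g (fst t) i = 0}" by simp
      let ?A = "{t \<in> topspace ?SU. g (fst t) i = 0}"
      have A: "fst t \<in> ?Z" if "t \<in> ?A" for t using that U(2) tSU unfolding Z by auto
      have "continuous_map (subtopology ?SU ?A) (subtopology M ?Z) fst"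
        using cf(1) A by (auto simp: continuous_map_in_subtopology continuous_map_from_subtopology)
      from continuous_map_compose[OF this s(1)]
      have "continuous_map (subtopology ?SU ?A) M (s \<circ> fst)" .
      then have "closedin (subtopology ?SU ?A) {t \<in> topspace (subtopology ?SU ?A). snd t = (s \<circ> fst) t}"
        by (rule closedin_continuous_maps_eq[OF Hausdorff continuous_map_from_subtopology[OF cf(2)]])
      moreover have "{t \<in> topspace (subtopology ?SU ?A). snd t = (s \<circ> fst) t} = W i"
        unfolding W_eq Z using tSU U(2) by auto
      ultimately show ?thesis using closedin_trans_full[OF _ cl1] by simp
    qed
    have "homeomorphic_maps (subtopology sheet_space (W i)) (subtopology M (U \<inter> ?Z)) fst (\<lambda>m. (m, s m))"
      unfolding homeomorphic_maps_def
    proof (intro conjI ballI)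
      have "continuous_map (subtopology sheet_space (W i)) M fst"
        by (intro continuous_map_from_subtopology continuous_fst_sheet_space)
      then show "continuous_map (subtopology sheet_space (W i)) (subtopology M (U \<inter> ?Z)) fst"
        unfolding continuous_map_in_subtopology using W_eq by auto
      have "continuous_map (subtopology (subtopology M ?Z) U) M s" by (rule continuous_map_from_subtopology[OF s(1)])
      then have "continuous_map (subtopology M (U \<inter> ?Z)) M s" by (simp add: subtopology_subtopology Int_commute)
      then have "continuous_map (subtopology M (U \<inter> ?Z)) (prod_topology M M) (\<lambda>m. (m, s m))"
        by (intro continuous_map_pairedI continuous_map_from_subtopology[OF continuous_map_id[unfolded id_def]])
      moreover have "(z, s z) \<in> W i" if z: "z \<in> U \<inter> ?Z" for z
      proof -
        obtain u where u: "u \<in> nbhd" "z = q u" "coord u i = 0" using z by blast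
        then have "(z, s z) = strand i u" using s(2) fst_strand by (intro prod_eqI) auto
        moreover have "q u \<in> U" using u(2) z by simp
        ultimately show ?thesis using WI[OF u(1) _ u(3)] by simp
      qed
      ultimately show "continuous_map (subtopology M (U \<inter> ?Z)) (subtopology sheet_space (W i)) (\<lambda>m. (m, s m))"
        unfolding sheet_space_def using Wsub by (auto simp: continuous_map_in_subtopology)
      show "(fst t, s (fst t)) = t" if "t \<in> topspace (subtopology sheet_space (W i))" for t
        using that W_eq by (intro prod_eqI) auto
    qed simp
    then have 1: "homeomorphic_map (subtopology sheet_space (W i)) (subtopology M (U \<inter> ?Z)) fst"
      using homeomorphic_maps_imp_map by blast
    have "homeomorphic_map (subtopology (subtopology M U) ?Z) (subtopology (Euclidean_space 3) {x. x i = 0}) \<psi>"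
    proof (rule homeomorphic_map_subtopologies_alt[OF U(4)])
      show "\<psi> x \<in> {x. x i = 0} \<longleftrightarrow> x \<in> ?Z" if "x \<in> topspace (subtopology M U)" for x
        unfolding Z using that U(2,6) by auto
    qed
    then have 2: "homeomorphic_map (subtopology M (U \<inter> ?Z)) (subtopology (Euclidean_space 3) {x. x i = 0}) \<psi>"
      by (simp add: subtopology_subtopology)
    show "homeomorphic_map (subtopology sheet_space (W i))
        (subtopology (Euclidean_space 3) {x. x i = 0}) (\<psi> \<circ> fst)"
      by (rule homeomorphic_map_compose[OF 1 2])
  qed
  have openW: "openin sheet_space (W i)" if i: "i < d" for i
  proof -
    let ?SU = "subtopology sheet_space {s \<in> topspace sheet_space. fst s \<in> U}"
    have t: "topspace ?SU = (\<Union>i<d. W i)" using pre by auto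
    have "closedin ?SU (\<Union>j\<in>{..<d} - {i}. W j)" using closedW by (intro closedin_Union) auto
    then have "openin ?SU (topspace ?SU - (\<Union>j\<in>{..<d} - {i}. W j))"
      by (rule openin_diff[OF openin_topspace])
    moreover have "topspace ?SU - (\<Union>j\<in>{..<d} - {i}. W j) = W i"
      unfolding t using disj[OF i] i by blast
    ultimately have "openin ?SU (W i)" by simp
    then show ?thesis using SU by (rule openin_trans_full)
  qed
  have "crossing_chart sheet_space M fst ?p U \<psi> d W"
    unfolding crossing_chart_def using U d3 pre disj openW homW by (auto simp: disjoint_family_on_def)
  then show ?thesis by blast
qed

end

section \<open>Charts at the points of the surface\<close>

lemma open_Collect_Ball:
  assumes "finite A" "\<And>i. i \<in> A \<Longrightarrow> open {y. Q i y}"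
  shows "open {y. \<forall>i\<in>A. Q i y}"
proof -
  have "{y. \<forall>i\<in>A. Q i y} = (\<Inter>i\<in>A. {y. Q i y})" by auto
  then show ?thesis using assms by auto
qed

lemma open_coordinate_conditions:
  fixes c :: real
  shows "open {y :: nat \<Rightarrow> real. y i < y j}" "open {y :: nat \<Rightarrow> real. y i < c}"
    "open {y :: nat \<Rightarrow> real. c < y i}" "open {y :: nat \<Rightarrow> real. y i \<noteq> c}"
  by (intro open_Collect_less open_Collect_neq continuous_on_coordinate continuous_on_const)+

lemma simplex3_eqI:
  assumes "y \<in> \<Delta>" "z \<in> \<Delta>" "y 0 = z 0" "y 1 = z 1" "y 2 = z 2 \<or> y 3 = z 3"
  shows "y = z"
proof
  fix i
  have "y 0 + y 1 + y 2 + y 3 = 1" "z 0 + z 1 + z 2 + z 3 = 1"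
    using assms(1,2) by (auto simp: simplex3_iff atMost_3)
  then have e: "y 2 = z 2" "y 3 = z 3" using assms by auto
  show "y i = z i"
  proof (cases "i > 3")
    case True
    then show ?thesis using assms(1,2) by (simp add: simplex3_iff)
  next
    case False
    then have "i = 0 \<or> i = 1 \<or> i = 2 \<or> i = 3" by auto
    then show ?thesis using e assms(3,4) by auto
  qed
qed

lemma initial_segment:
  assumes "\<And>i j. i \<le> j \<Longrightarrow> j \<le> 3 \<Longrightarrow> Q j \<Longrightarrow> Q i"
  obtains d :: nat where "d \<le> 4" "\<And>i. i \<le> 3 \<Longrightarrow> Q i \<longleftrightarrow> i < d"
proof -
  define d where "d = (LEAST i. i = 4 \<or> \<not> Q i)"
  have d: "d = 4 \<or> \<not> Q d" unfolding d_def by (rule LeastI[of _ 4]) simp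
  have le: "d \<le> 4" unfolding d_def by (rule Least_le) simp
  have "Q i" if "i < d" for i using not_less_Least[of i "\<lambda>i. i = 4 \<or> \<not> Q i"] that by (auto simp: d_def)
  moreover have "\<not> Q i" if "d \<le> i" "i \<le> 3" for i using assms[OF that] d that by auto
  ultimately show thesis using that[of d] le by (metis not_le)
qed

text \<open>
  The vertices are listed with the coordinates at level \<open>1/8\<close> first and the vanishing ones last.
  Some coordinate is of neither kind, since four numbers from \<open>{0, 1/8}\<close> do not have sum \<open>1\<close>.
\<close>

lemma sorted_coordinates:
  fixes x :: "nat \<Rightarrow> real"
  assumes x: "x \<in> \<Delta>" and lev: "\<exists>j\<le>3. x j = 1/8"
  obtains \<tau> d e where "\<tau> permutes {..3}" "1 \<le> d" "d < e" "e \<le> 4" "d \<le> 3"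
    "\<And>i. i \<le> 3 \<Longrightarrow> x (\<tau> i) = 1/8 \<longleftrightarrow> i < d" "\<And>i. i \<le> 3 \<Longrightarrow> x (\<tau> i) = 0 \<longleftrightarrow> e \<le> i"
proof -
  define \<kappa> :: "nat \<Rightarrow> nat" where "\<kappa> j = (if x j = 1/8 then 0 else if x j = 0 then 2 else 1)" for j
  define xs where "xs = sort_key \<kappa> [0..<4]"
  have xs: "length xs = 4" "set xs = {..3}" "distinct xs" "sorted (map \<kappa> xs)"
    by (auto simp: xs_def)
  define \<tau> where "\<tau> i = (if i \<le> 3 then xs ! i else i)" for i
  have bij: "bij_betw \<tau> {..3} {..3}"
  proof -
    have "bij_betw (\<lambda>i. xs ! i) {..<length xs} (set xs)" using xs(3) by (intro bij_betw_nth) auto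
    moreover have "{..<length xs} = {..3}" using xs(1) by auto
    ultimately have "bij_betw (\<lambda>i. xs ! i) {..3} {..3}" using xs(2) by simp
    then show ?thesis by (rule bij_betw_cong[THEN iffD1, rotated]) (simp add: \<tau>_def)
  qed
  have per: "\<tau> permutes {..3}" by (rule bij_imp_permutes[OF bij]) (simp add: \<tau>_def)
  have mono: "\<kappa> (\<tau> i) \<le> \<kappa> (\<tau> j)" if "i \<le> j" "j \<le> 3" for i j
    using sorted_nth_mono[OF xs(4), of i j] that xs(1) by (simp add: \<tau>_def)
  obtain d where d: "d \<le> 4" "\<And>i. i \<le> 3 \<Longrightarrow> \<kappa> (\<tau> i) \<le> 0 \<longleftrightarrow> i < d"
  proof (rule initial_segment[of "\<lambda>i. \<kappa> (\<tau> i) \<le> 0"])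
    show "\<kappa> (\<tau> i) \<le> 0" if "i \<le> j" "j \<le> 3" "\<kappa> (\<tau> j) \<le> 0" for i j
      using mono[OF that(1,2)] that(3) by simp
  qed (rule that)
  obtain e where e: "e \<le> 4" "\<And>i. i \<le> 3 \<Longrightarrow> \<kappa> (\<tau> i) \<le> 1 \<longleftrightarrow> i < e"
  proof (rule initial_segment[of "\<lambda>i. \<kappa> (\<tau> i) \<le> 1"])
    show "\<kappa> (\<tau> i) \<le> 1" if "i \<le> j" "j \<le> 3" "\<kappa> (\<tau> j) \<le> 1" for i j
      using mono[OF that(1,2)] that(3) by simp
  qed (rule that)
  have d': "x (\<tau> i) = 1/8 \<longleftrightarrow> i < d" if "i \<le> 3" for i
    using d(2)[OF that] by (auto simp: \<kappa>_def split: if_splits)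
  have e': "x (\<tau> i) = 0 \<longleftrightarrow> e \<le> i" if "i \<le> 3" for i
    using e(2)[OF that] by (auto simp: \<kappa>_def not_less[symmetric] split: if_splits)
  obtain j where j: "j \<le> 3" "x j = 1/8" using lev by blast
  have "\<tau> (inv_into UNIV \<tau> j) = j" "inv_into UNIV \<tau> j \<le> 3"
    using permutes_inverses[OF per] permutes_le3[OF permutes_inv[OF per]] j(1) by auto
  then have d1: "1 \<le> d" using d'[of "inv_into UNIV \<tau> j"] j(2) by auto
  have "x \<circ> \<tau> \<in> \<Delta>" using simplex3_permute[OF per] x by simp
  then have sum: "x (\<tau> 0) + x (\<tau> 1) + x (\<tau> 2) + x (\<tau> 3) = 1" by (simp add: simplex3_iff atMost_3)
  have de: "d < e"
  proof (rule ccontr)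
    assume n: "\<not> d < e"
    have "x (\<tau> i) \<le> 1/8" if "i \<le> 3" for i
    proof (cases "i < d")
      case True
      then show ?thesis using d'[OF that] by simp
    next
      case False
      then show ?thesis using e'[OF that] n by simp
    qed
    from this[of 0] this[of 1] this[of 2] this[of 3] show False using sum by simp
  qed
  show thesis by (rule that[OF per d1 de e(1) _ d' e']) (use de e(1) in auto)
qed

context triangulation
begin

text \<open>
  Inside a tetrahedron barycentric coordinates are a chart; three of them determine the fourth.
\<close>

lemma chart_interior:
  assumes a: "a < n" and t: "\<tau> permutes {..3}" and y0: "y0 \<in> \<Delta>" and d: "d \<le> 3"
    and lev: "\<And>i. i \<le> 3 \<Longrightarrow> y0 i = 1/8 \<longleftrightarrow> i < d" and pos: "\<And>i. i \<le> 3 \<Longrightarrow> y0 i \<noteq> 0"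
  shows "\<exists>U \<psi> W. crossing_chart sheet_space M fst (q (a, y0 \<circ> inv_into UNIV \<tau>)) U \<psi> d W"
proof -
  define P where "P = \<Delta> \<inter> {y. (\<forall>i\<in>{..3}. 0 < y i) \<and> (\<forall>i\<in>{d..3}. y i \<noteq> 1/8)}"
  define \<phi> :: "nat \<Rightarrow> (nat \<Rightarrow> real) \<Rightarrow> nat \<Rightarrow> real" where
    "\<phi> k y = (\<lambda>i. if i < 3 then y i - y0 i else 0)" for k y
  interpret corner_chart M n G q 1 "\<lambda>_. a" "\<lambda>_. \<tau>" P \<phi> d y0
  proof
    show "openin (top_of_set \<Delta>) P" unfolding P_def
      by (intro openin_open_Int open_Collect_conj open_Collect_Ball open_coordinate_conditions) auto
    show "continuous_map (top_of_set P) (Euclidean_space 3) (\<phi> k)" for k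
      unfolding \<phi>_def continuous_map_componentwise_Euclidean_space
      by (auto intro!: continuous_on_diff continuous_on_coordinate)
    show "y i = 1/8 \<longleftrightarrow> i < d \<and> \<phi> k y i = 0" if "y \<in> P" "i \<le> 3" for k y i
      using that lev[of i] d by (auto simp: P_def \<phi>_def)
    show "\<exists>l \<pi>. l < 1 \<and> a = b \<and> \<pi> permutes {..3} \<and> (\<forall>i<d. \<pi> i = i) \<and> \<tau> = \<sigma> \<circ> \<tau> \<circ> \<pi> \<and>
          y \<circ> \<pi> \<in> P \<and> \<phi> l (y \<circ> \<pi>) = \<phi> k y"
      if "y \<in> P" "i \<le> 3" "y i = 0" for k y i b \<sigma>
    proof -
      have "0 < y i" using that(1,2) by (simp add: P_def)
      then show ?thesis using that(3) by simp
    qed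
    show "q (a, y \<circ> inv_into UNIV \<tau>) = q (a, z \<circ> inv_into UNIV \<tau>)"
      if "y \<in> P" "z \<in> P" "\<phi> k y = \<phi> l z" for k l y z
    proof -
      have "y i = z i" if "i < 3" for i using fun_cong[OF \<open>\<phi> k y = \<phi> l z\<close>, of i] that by (simp add: \<phi>_def)
      then have "y = z" using that by (intro simplex3_eqI) (auto simp: P_def)
      then show ?thesis by simp
    qed
    show "y0 \<in> P" using y0 pos lev by (auto simp: P_def simplex3_iff less_le)
    show "\<phi> 0 y0 = (\<lambda>_. 0)" by (auto simp: \<phi>_def)
  qed (use a t d in \<open>auto simp: P_def\<close>)
  show ?thesis by (rule crossing_chart_exists)
qed

text \<open>
  At the interior of a face the two tetrahedra are placed on the two sides of a plane: the coordinate
  that vanishes on the face is taken with opposite signs.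
\<close>

lemma chart_face:
  assumes a: "a < n" and t: "\<tau> permutes {..3}" and y0: "y0 \<in> \<Delta>" and d: "d \<le> 2"
    and lev: "\<And>i. i \<le> 3 \<Longrightarrow> y0 i = 1/8 \<longleftrightarrow> i < d" and zero: "\<And>i. i \<le> 3 \<Longrightarrow> y0 i = 0 \<longleftrightarrow> i = 3"
  shows "\<exists>U \<psi> W. crossing_chart sheet_space M fst (q (a, y0 \<circ> inv_into UNIV \<tau>)) U \<psi> d W"
proof -
  have t3: "\<tau> 3 \<le> 3" using permutes_le3[OF t] by simp
  obtain b \<sigma> where G: "G (a, \<tau> 3) = (b, \<sigma>)" by fastforce
  note p = pairingD[OF G a t3]
  define ca where "ca k = (if k = 0 then a else b)" for k :: nat
  define ct where "ct k = (if k = 0 then \<tau> else \<sigma> \<circ> \<tau>)" for k :: nat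
  have st: "\<sigma> \<circ> \<tau> permutes {..3}" by (rule permutes_compose[OF t p(2)])
  define P where "P = \<Delta> \<inter> {y. (\<forall>i\<in>{..2}. y 3 < y i) \<and> (\<forall>i\<in>{d..3}. y i \<noteq> 1/8)}"
  define \<phi> :: "nat \<Rightarrow> (nat \<Rightarrow> real) \<Rightarrow> nat \<Rightarrow> real" where
    "\<phi> k y = (\<lambda>i. if i < 3 then if i < 2 then y i - y0 i else if k = 0 then y 3 else - y 3 else 0)" for k y
  have cat: "ca k < n \<and> ct k permutes {..3}" for k using a t p st by (simp add: ca_def ct_def)
  have P0: "0 < y i" if "y \<in> P" "i \<le> 2" for y i
  proof -
    have "0 \<le> y 3" using that(1) by (simp add: P_def simplex3_iff)
    also have "y 3 < y i" using that by (simp add: P_def)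
    finally show ?thesis .
  qed
  have gl: "q (a, y \<circ> inv_into UNIV \<tau>) = q (b, y \<circ> inv_into UNIV (\<sigma> \<circ> \<tau>))" if "y \<in> \<Delta>" "y 3 = 0" for y
  proof -
    have "y \<circ> inv_into UNIV \<tau> \<in> \<Delta>" using that(1) simplex3_permute[OF permutes_inv[OF t]] by simp
    moreover have "(y \<circ> inv_into UNIV \<tau>) (\<tau> 3) = 0" using that(2) permutes_inverses[OF t] by simp
    ultimately have "q (a, y \<circ> inv_into UNIV \<tau>) = q (b, y \<circ> inv_into UNIV \<tau> \<circ> inv_into UNIV \<sigma>)"
      using q_glued(1)[OF a _ t3 _ G] by blast
    then show ?thesis using o_inv_distrib[OF permutes_bij[OF p(2)] permutes_bij[OF t]] by (simp add: o_assoc)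
  qed
  \<comment> \<open>On \<open>P\<close> position \<open>3\<close> carries the strictly smallest coordinate, so both listings agree about it.\<close>
  have min: "ct k 3 = ct l 3"
    if "y \<in> P" "z \<in> P" "y \<circ> inv_into UNIV (ct k) = z \<circ> inv_into UNIV (ct l)" for k l y z
  proof (rule ccontr)
    assume ne: "ct k 3 \<noteq> ct l 3"
    let ?x = "y \<circ> inv_into UNIV (ct k)"
    note ik = permutes_inverses[OF cat[THEN conjunct2, of k]] and il = permutes_inverses[OF cat[THEN conjunct2, of l]]
    have le: "ct k 3 \<le> 3" "ct l 3 \<le> 3"
      using permutes_le3[OF cat[THEN conjunct2, of k], of 3] permutes_le3[OF cat[THEN conjunct2, of l], of 3] by auto
    have "?x (ct k 3) < ?x j" if "j \<le> 3" "j \<noteq> ct k 3" for j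
    proof -
      have "inv_into UNIV (ct k) j \<le> 3" "inv_into UNIV (ct k) j \<noteq> 3"
        using permutes_le3[OF permutes_inv[OF cat[THEN conjunct2, of k]], of j] that ik by auto metis
      then show ?thesis using \<open>y \<in> P\<close> ik by (simp add: P_def)
    qed
    moreover have "(z \<circ> inv_into UNIV (ct l)) (ct l 3) < (z \<circ> inv_into UNIV (ct l)) j" if "j \<le> 3" "j \<noteq> ct l 3" for j
    proof -
      have "inv_into UNIV (ct l) j \<le> 3" "inv_into UNIV (ct l) j \<noteq> 3"
        using permutes_le3[OF permutes_inv[OF cat[THEN conjunct2, of l]], of j] that il by auto metis
      then show ?thesis using \<open>z \<in> P\<close> il by (simp add: P_def)
    qed
    ultimately have "?x (ct k 3) < ?x (ct l 3)" "?x (ct l 3) < ?x (ct k 3)"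
      using ne le that(3) by auto
    then show False by simp
  qed
  interpret corner_chart M n G q 2 ca ct P \<phi> d y0
  proof
    show "openin (top_of_set \<Delta>) P" unfolding P_def
      by (intro openin_open_Int open_Collect_conj open_Collect_Ball open_coordinate_conditions) auto
    show "continuous_map (top_of_set P) (Euclidean_space 3) (\<phi> k)" for k
    proof -
      have "continuous_on P (\<lambda>y. if i < 2 then y i - y0 i else if k = 0 then y 3 else - y 3)" for i :: nat
        by (cases "i < 2"; cases "k = 0")
          (auto intro!: continuous_on_diff continuous_on_minus continuous_on_coordinate)
      then show ?thesis
        unfolding \<phi>_def continuous_map_componentwise_Euclidean_space continuous_map_iff_continuous by blast
    qed
    show "y i = 1/8 \<longleftrightarrow> i < d \<and> \<phi> k y i = 0" if "y \<in> P" "i \<le> 3" for k y i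
      using that lev[of i] d by (auto simp: P_def \<phi>_def)
    show "k = l" if h: "k < 2" "l < 2" "y \<in> P" "z \<in> P" "ca k = ca l"
      "y \<circ> inv_into UNIV (ct k) = z \<circ> inv_into UNIV (ct l)" for k l y z
    proof (rule ccontr)
      assume "k \<noteq> l"
      then have "{k, l} = {0, 1}" using h(1,2) by auto
      then have "b = a" "\<sigma> (\<tau> 3) = \<tau> 3"
        using h(5) min[OF h(3,4,6)] by (auto simp: ca_def ct_def doubleton_eq_iff)
      then show False using p(3) by simp
    qed
    show "\<exists>l \<pi>. l < 2 \<and> ca l = b' \<and> \<pi> permutes {..3} \<and> (\<forall>i<d. \<pi> i = i) \<and> ct l = \<sigma>' \<circ> ct k \<circ> \<pi> \<and>
          y \<circ> \<pi> \<in> P \<and> \<phi> l (y \<circ> \<pi>) = \<phi> k y"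
      if h: "k < 2" "y \<in> P" "i \<le> 3" "y i = 0" "G (ca k, ct k i) = (b', \<sigma>')" for k y i b' \<sigma>'
    proof -
      have i3: "i = 3" using P0[OF h(2), of i] h(3,4) by (cases "i \<le> 2") auto
      have y3: "y 3 = 0" using h(4) i3 by simp
      have e: "\<phi> 0 y = \<phi> 1 y" using y3 by (auto simp: \<phi>_def)
      show ?thesis
      proof (cases "k = 0")
        case True
        then have "b' = b" "\<sigma>' = \<sigma>" using h(5) G i3 by (auto simp: ca_def ct_def)
        then show ?thesis using True e h(2)
          by (intro exI[of _ 1] exI[of _ id]) (auto simp: ca_def ct_def permutes_id)
      next
        case False
        then have k: "k = 1" using h(1) by simp
        then have g: "b' = a" "\<sigma>' = inv_into UNIV \<sigma>" using h(5) p(4) i3 by (auto simp: ca_def ct_def)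
        have "\<sigma>' \<circ> (\<sigma> \<circ> \<tau>) = \<tau>" using permutes_inverses[OF p(2)] by (auto simp: g fun_eq_iff)
        then show ?thesis using k e h(2) g
          by (intro exI[of _ 0] exI[of _ id]) (auto simp: ca_def ct_def permutes_id)
      qed
    qed
    show "q (ca k, y \<circ> inv_into UNIV (ct k)) = q (ca l, z \<circ> inv_into UNIV (ct l))"
      if h: "k < 2" "l < 2" "y \<in> P" "z \<in> P" "\<phi> k y = \<phi> l z" for k l y z
    proof -
      have y01: "y i = z i" if "i < 2" for i using fun_cong[OF h(5), of i] that by (simp add: \<phi>_def)
      have yD: "y \<in> \<Delta>" "z \<in> \<Delta>" using h by (auto simp: P_def)
      have y3: "(if k = 0 then y 3 else - y 3) = (if l = 0 then z 3 else - z 3)"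
        using fun_cong[OF h(5), of 2] by (simp add: \<phi>_def)
      have nn: "0 \<le> y 3" "0 \<le> z 3" using yD by (auto simp: simplex3_iff)
      have e3: "y 3 = z 3" using y3 nn by (auto split: if_splits)
      have yz: "y = z" using y01 e3 yD by (intro simplex3_eqI) auto
      show ?thesis
      proof (cases "k = l")
        case False
        then have "y 3 = 0" using y3 e3 h(1,2) by (auto split: if_splits)
        then show ?thesis using gl[OF yD(1)] False h(1,2) yz by (auto simp: ca_def ct_def)
      qed (use yz in simp)
    qed
    have "0 \<le> y0 i" for i using y0 by (simp add: simplex3_iff)
    then have "0 < y0 i" if "i \<le> 2" for i using zero[of i] that by (simp add: less_le)
    moreover have "y0 3 = 0" using zero[of 3] by simp
    ultimately show "y0 \<in> P" using y0 lev by (auto simp: P_def)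
    show "\<phi> 0 y0 = (\<lambda>_. 0)" using \<open>y0 3 = 0\<close> by (auto simp: \<phi>_def)
  qed (use cat d in auto)
  show ?thesis using crossing_chart_exists by (simp add: ca_def ct_def)
qed


end

text \<open>
  A bounded function of the angular coordinate, multiplied by the radius, is continuous at the
  origin too, whatever value the angular coordinate is given there.
\<close>

lemma continuous_on_polar:
  fixes h :: "real \<Rightarrow> real"
  assumes h: "continuous_on UNIV h" "\<And>r. \<bar>h r\<bar> \<le> 1"
  shows "continuous_on A (\<lambda>w. (fst w + snd w) * h (snd w / (fst w + snd w)))"
proof -
  let ?f = "\<lambda>w. (fst w + snd w) * h (snd w / (fst w + snd w))"
  have "isCont ?f w" for w :: "real \<times> real"
  proof (cases "fst w + snd w = 0")
    case False
    have ch: "isCont h r" for r using h(1) continuous_on_eq_continuous_at open_UNIV by blast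
    have "isCont (\<lambda>w. h (snd w / (fst w + snd w))) w"
      using False by (intro isCont_o2[OF _ ch] continuous_intros) auto
    then show ?thesis by (intro continuous_intros)
  next
    case True
    have "((\<lambda>w :: real \<times> real. fst w + snd w) \<longlongrightarrow> fst w + snd w) (at w)"
      by (intro tendsto_intros)
    then have l: "((\<lambda>w :: real \<times> real. fst w + snd w) \<longlongrightarrow> 0) (at w)" using True by simp
    have "(?f \<longlongrightarrow> 0) (at w)"
    proof (rule Lim_null_comparison[OF _ tendsto_norm_zero[OF l]])
      show "\<forall>\<^sub>F z in at w. norm (?f z) \<le> norm (fst z + snd z)"
        using mult_left_mono[OF h(2)] by (intro always_eventually) (auto simp: abs_mult mult_left_le)
    qed
    then show ?thesis using True by (simp add: isCont_def)
  qed
  then show ?thesis by (intro continuous_at_imp_continuous_on) auto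
qed

lemma same_angle:
  fixes m :: nat and s t :: real
  assumes m: "0 < m" and s: "0 \<le> s" "s \<le> m" and t: "0 \<le> t" "t \<le> m"
    and e: "cos (2 * pi * s / m) = cos (2 * pi * t / m)" "sin (2 * pi * s / m) = sin (2 * pi * t / m)"
  shows "s = t \<or> (s = 0 \<and> t = m) \<or> (s = m \<and> t = 0)"
proof -
  obtain N :: int where N: "2 * pi * s / m = 2 * pi * t / m + 2 * pi * N"
    using e sin_cos_eq_iff[of "2 * pi * s / m" "2 * pi * t / m"] by auto
  have "2 * pi * s = 2 * pi * t + 2 * pi * (m * N)" using N m by (simp add: field_simps)
  then have "2 * pi * s = 2 * pi * (t + m * N)" by (simp add: distrib_left)
  then have st: "s = t + m * N" by simp
  have "real_of_int N * m \<le> m" "- real m \<le> N * m" using st s t by (auto simp: mult.commute)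
  then have "real_of_int N \<le> 1" "-1 \<le> real_of_int N"
    using m by (auto simp: mult_le_cancel_right1 minus_le_iff) (metis (no_types, opaque_lifting) mult_le_cancel_right_pos mult_minus1 of_nat_0_less_iff)
  then have "N = -1 \<or> N = 0 \<or> N = 1" by linarith
  then show ?thesis using st s t by auto
qed

context triangulation
begin

abbreviation swap23 :: "nat \<Rightarrow> nat" where "swap23 \<equiv> Transposition.transpose 2 3"

text \<open>
  A corner \<open>(a, t)\<close> is a tetrahedron with its vertices listed in the order \<open>t\<close>; it distinguishes the
  directed edge from \<open>t 0\<close> to \<open>t 1\<close> and the two faces \<open>t 2\<close> and \<open>t 3\<close> that contain this edge. Crossing
  goes through face \<open>t 2\<close> to the next tetrahedron, flipping exchanges the roles of the two faces, so
  that iterating both turns around the edge.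
\<close>

definition cross :: "nat \<times> (nat \<Rightarrow> nat) \<Rightarrow> nat \<times> (nat \<Rightarrow> nat)" where
  "cross c = (case G (fst c, snd c 2) of (b, \<sigma>) \<Rightarrow> (b, \<sigma> \<circ> snd c))"

definition flip :: "nat \<times> (nat \<Rightarrow> nat) \<Rightarrow> nat \<times> (nat \<Rightarrow> nat)" where
  "flip c = (fst c, snd c \<circ> swap23)"

definition turn :: "nat \<times> (nat \<Rightarrow> nat) \<Rightarrow> nat \<times> (nat \<Rightarrow> nat)" where
  "turn c = flip (cross c)"

definition corners :: "(nat \<times> (nat \<Rightarrow> nat)) set" where
  "corners = {..<n} \<times> {t. t permutes {..3}}"

lemma swap23: "swap23 permutes {..3}" "swap23 \<circ> swap23 = id" "inv_into UNIV swap23 = swap23"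
  "swap23 0 = 0" "swap23 1 = 1" "swap23 2 = 3" "swap23 3 = 2"
  by (auto simp: permutes_swap_id Transposition.transpose_def fun_eq_iff intro: inv_unique_comp)

lemma finite_corners: "finite corners"
  by (simp add: corners_def finite_permutations)

lemma cornersD: "c \<in> corners \<Longrightarrow> fst c < n \<and> snd c permutes {..3}"
  by (auto simp: corners_def)

lemma flip_in: "c \<in> corners \<Longrightarrow> flip c \<in> corners"
  using permutes_compose[OF swap23(1)] by (auto simp: corners_def flip_def)

lemma flip_flip: "flip (flip c) = c"
  using swap23(2) by (auto simp: flip_def o_assoc[symmetric])

lemma cross_facts:
  assumes c: "c \<in> corners"
  shows "cross c \<in> corners" "cross (cross c) = c" "cross c \<noteq> c"
proof -
  obtain b \<sigma> where G: "G (fst c, snd c 2) = (b, \<sigma>)" by fastforce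
  have le: "snd c 2 \<le> 3" using permutes_le3 cornersD[OF c] by simp
  note p = pairingD[OF G _ le]
  have e: "cross c = (b, \<sigma> \<circ> snd c)" using G by (simp add: cross_def)
  show "cross c \<in> corners"
    using p(1,2) cornersD[OF c] permutes_compose by (auto simp: e corners_def)
  have "G (fst (cross c), snd (cross c) 2) = (fst c, inv_into UNIV \<sigma>)" using p(4) cornersD[OF c] by (simp add: e)
  then have "cross (cross c) = (fst c, inv_into UNIV \<sigma> \<circ> (\<sigma> \<circ> snd c))" by (simp add: cross_def[of "cross c"]) (simp add: e)
  also have "\<dots> = c" using permutes_inverses[OF p(2)] cornersD[OF c] by (auto simp: prod_eq_iff fun_eq_iff)
  finally show "cross (cross c) = c" .
  show "cross c \<noteq> c"
  proof
    assume "cross c = c"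
    then have "b = fst c" "\<sigma> (snd c 2) = snd c 2" unfolding e by (auto simp: prod_eq_iff dest: fun_cong[of _ _ 2])
    then show False using p(3) cornersD[OF c] by simp
  qed
qed

lemma turn_in: "c \<in> corners \<Longrightarrow> turn c \<in> corners"
  using cross_facts(1) flip_in by (simp add: turn_def)

lemma turn_pow_in: "c \<in> corners \<Longrightarrow> (turn ^^ k) c \<in> corners"
  by (induction k) (auto simp: turn_in)

lemma cross_turn: "c \<in> corners \<Longrightarrow> cross c = flip (turn c)"
  by (simp add: turn_def flip_flip)

lemma turn_inj: "c \<in> corners \<Longrightarrow> c' \<in> corners \<Longrightarrow> turn c = turn c' \<Longrightarrow> c = c'"
  using cross_turn cross_facts(2) by metis

lemma turn_flip_turn: "c \<in> corners \<Longrightarrow> turn (flip (turn c)) = flip c"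
  using cross_facts(2)[of c] by (simp add: cross_turn[symmetric] turn_def[of "cross c"])

text \<open>
  If corner \<open>l\<close> were the flip of corner \<open>k\<close>, then corner \<open>l + 1\<close> would be the flip of corner \<open>k - 1\<close>, and so
  on until the two indices meet or are adjacent. In the first case a corner would be its own flip,
  but the listing of its vertices is injective; in the second case a face would be glued to itself.
\<close>

lemma turn_pow_not_flip_le:
  assumes c: "c \<in> corners"
  shows "l \<le> k \<Longrightarrow> (turn ^^ l) c \<noteq> flip ((turn ^^ k) c)"
proof (induction "k - l" arbitrary: k l rule: less_induct)
  case less
  let ?c = "\<lambda>k. (turn ^^ k) c"
  have C: "?c k \<in> corners" for k by (rule turn_pow_in[OF c])
  show ?case
  proof
    assume eq: "?c l = flip (?c k)"
    consider "k = l" | "k = Suc l" | "l + 2 \<le> k" using less.prems by linarith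
    then show False
    proof cases
      case 1
      then have "snd (?c l) = snd (?c l) \<circ> swap23" using eq by (metis flip_def snd_conv)
      then have "snd (?c l) 2 = snd (?c l) 3" using swap23(6) by (metis comp_apply)
      then show False using injD[OF permutes_inj[of "snd (?c l)" "{..3}"], of 2 3] cornersD[OF C[of l]] by simp
    next
      case 2
      then have "?c l = cross (?c l)" using eq cross_turn[OF C[of l]] by simp
      then show False using cross_facts(3)[OF C[of l]] by simp
    next
      case 3
      define k' where "k' = k - 1"
      have k: "k = Suc k'" "Suc l \<le> k'" "k' - Suc l < k - l" using 3 by (auto simp: k'_def)
      have "?c (Suc l) = turn (flip (turn (?c k')))" using eq k(1) by simp
      also have "\<dots> = flip (?c k')" by (rule turn_flip_turn[OF C])
      finally show False using less.hyps[OF k(3,2)] by simp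
    qed
  qed
qed

lemma turn_pow_not_flip:
  assumes "c \<in> corners" shows "(turn ^^ l) c \<noteq> flip ((turn ^^ k) c)"
  using turn_pow_not_flip_le[OF assms, of l k] turn_pow_not_flip_le[OF assms, of k l] flip_flip
  by (metis nle_le)

text \<open>
  Turning is an injective map on a finite set, so every corner comes back to itself, and before that
  no corner is repeated.
\<close>

lemma turn_period:
  assumes c: "c \<in> corners"
  obtains m where "0 < m" "(turn ^^ m) c = c" "\<And>k l. k < m \<Longrightarrow> l < m \<Longrightarrow> (turn ^^ k) c = (turn ^^ l) c \<Longrightarrow> k = l"
proof -
  have canc: "(turn ^^ (l - k)) c = c" if "k \<le> l" "(turn ^^ k) c = (turn ^^ l) c" for k l
    using that
  proof (induction k arbitrary: l)
    case (Suc k)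
    then obtain l' where l: "l = Suc l'" by (cases l) auto
    then have "(turn ^^ k) c = (turn ^^ l') c"
      using Suc.prems(2) turn_inj[OF turn_pow_in[OF c] turn_pow_in[OF c], of k l'] by simp
    then show ?case using Suc.IH[of l'] Suc.prems(1) l by simp
  qed simp
  have "\<not> inj (\<lambda>k. (turn ^^ k) c)"
  proof
    assume "inj (\<lambda>k. (turn ^^ k) c)"
    moreover have "range (\<lambda>k. (turn ^^ k) c) \<subseteq> corners" using turn_pow_in[OF c] by auto
    ultimately show False using finite_corners finite_imageD finite_subset infinite_UNIV_nat by metis
  qed
  then obtain k l where "k \<noteq> l" "(turn ^^ k) c = (turn ^^ l) c" by (auto simp: inj_def)
  then obtain k l where kl: "k < l" "(turn ^^ k) c = (turn ^^ l) c" by (metis nat_neq_iff)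
  define m where "m = (LEAST m. 0 < m \<and> (turn ^^ m) c = c)"
  have "0 < l - k \<and> (turn ^^ (l - k)) c = c" using canc[of k l] kl by simp
  then have m: "0 < m \<and> (turn ^^ m) c = c" unfolding m_def by (rule LeastI)
  have least: "\<not> (0 < j \<and> (turn ^^ j) c = c)" if "j < m" for j using that not_less_Least unfolding m_def by blast
  have uniq: "k = l" if "k \<le> l" "l < m" "(turn ^^ k) c = (turn ^^ l) c" for k l
  proof -
    have "l - k < m" using that(2) by linarith
    then show ?thesis using canc[OF that(1,3)] least[of "l - k"] that(1) by auto
  qed
  show thesis
  proof
    show "0 < m" "(turn ^^ m) c = c" using m by auto
    show "k = l" if "k < m" "l < m" "(turn ^^ k) c = (turn ^^ l) c" for k l
      using uniq[of k l] uniq[of l k] that by (metis nle_le)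
  qed
qed

text \<open>
  The tetrahedra around an edge are arranged as the sectors of a disc, in the direction transverse to
  the edge. There may be any positive number of sectors, hence the use of polar coordinates instead
  of a piecewise linear map.
\<close>

lemma chart_edge:
  assumes a: "a < n" and t: "\<tau> permutes {..3}" and y0: "y0 \<in> \<Delta>"
    and y0_values: "y0 0 = 1/8" "y0 2 = 0" "y0 3 = 0"
  shows "\<exists>U \<psi> W. crossing_chart sheet_space M fst (q (a, y0 \<circ> inv_into UNIV \<tau>)) U \<psi> 1 W"
proof -
  have c0: "(a, \<tau>) \<in> corners" using a t by (simp add: corners_def)
  obtain m where m: "0 < m" "(turn ^^ m) (a, \<tau>) = (a, \<tau>)"
      "\<And>k l. k < m \<Longrightarrow> l < m \<Longrightarrow> (turn ^^ k) (a, \<tau>) = (turn ^^ l) (a, \<tau>) \<Longrightarrow> k = l"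
    using turn_period[OF c0] by blast
  define c where "c k = (turn ^^ k) (a, \<tau>)" for k
  \<comment> \<open>The tetrahedra around the edge are numbered cyclically; \<open>nx\<close> is the next number.\<close>
  define nx where "nx k = (if Suc k = m then 0 else Suc k)" for k
  have nx: "nx k < m" "c (nx k) = turn (c k)" if "k < m" for k
    using that m(1,2) by (auto simp: nx_def c_def)
  have nx_onto: "\<exists>l<m. nx l = k" if "k < m" for k
  proof (cases k)
    case 0
    then show ?thesis using m(1) by (intro exI[of _ "m - 1"]) (simp add: nx_def)
  next
    case (Suc j)
    then show ?thesis using that by (intro exI[of _ j]) (auto simp: nx_def)
  qed
  have nx_adjacent: "k = l \<and> f = f' \<or> f = 1 \<and> f' = 0 \<and> l = nx k \<or> f = 0 \<and> f' = 1 \<and> k = nx l"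
    if "k < m" "l < m" "0 \<le> f" "f \<le> 1" "0 \<le> f'" "f' \<le> 1"
      and e: "real k + f = real l + f' \<or> real k + f = 0 \<and> real l + f' = m \<or> real k + f = m \<and> real l + f' = 0"
    for k l and f f' :: real
    using e
  proof (elim disjE conjE)
    assume e: "real k + f = real l + f'"
    consider "k = l" | "k < l" | "l < k" by linarith
    then show ?thesis
    proof cases
      case 2
      then have "real k + 1 \<le> real l" by linarith
      then have "f = 1" "f' = 0" "real l = real (Suc k)" using e that(3-6) by linarith+
      then show ?thesis using that(2) by (auto simp: nx_def)
    next
      case 3
      then have "real l + 1 \<le> real k" by linarith
      then have "f' = 1" "f = 0" "real k = real (Suc l)" using e that(3-6) by linarith+
      then show ?thesis using that(1) by (auto simp: nx_def)
    qed (use e in simp)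
  next
    assume e: "real k + f = 0" "real l + f' = m"
    have "real l + 1 \<le> real m" using that(2) by linarith
    then have "real (Suc l) = real m" "f' = 1" "real k = 0" "f = 0" using e that(3-6) by linarith+
    then show ?thesis by (simp add: nx_def)
  next
    assume e: "real k + f = m" "real l + f' = 0"
    have "real k + 1 \<le> real m" using that(1) by linarith
    then have "real (Suc k) = real m" "f = 1" "real l = 0" "f' = 0" using e that(3-6) by linarith+
    then show ?thesis by (simp add: nx_def)
  qed
  define ca where "ca k = fst (c k)" for k
  define ct where "ct k = snd (c k)" for k
  have C: "c k \<in> corners" for k unfolding c_def by (rule turn_pow_in[OF c0])
  have cat: "ca k < n" "ct k permutes {..3}" for k using cornersD[OF C[of k]] by (auto simp: ca_def ct_def)
  define P where "P = \<Delta> \<inter> {y. y 2 < 1/8 \<and> y 3 < 1/8 \<and> 1/8 < y 1 \<and> y 2 < y 0 \<and> y 3 < y 0 \<and> y 0 < y 1}"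
  have P: "0 \<le> y i" "y 2 < 1/8" "y 3 < 1/8" "1/8 < y 1" "y 2 < y 0" "y 3 < y 0" "y 0 < y 1" "y \<in> \<Delta>" if "y \<in> P" for y i
    using that by (auto simp: P_def simplex3_iff)
  \<comment> \<open>The \<open>k\<close>-th corner becomes the \<open>k\<close>-th of \<open>m\<close> equal sectors of a disc, with \<open>y 2 + y 3\<close> as radius;
    its face \<open>y 3 = 0\<close> is the side at angle \<open>2 \<pi> k / m\<close> and \<open>y 2 = 0\<close> the side at \<open>2 \<pi> (k + 1) / m\<close>.\<close>
  define ang :: "nat \<Rightarrow> (nat \<Rightarrow> real) \<Rightarrow> real" where
    "ang k y = 2 * pi * (real k + y 3 / (y 2 + y 3)) / m" for k y
  define \<phi> :: "nat \<Rightarrow> (nat \<Rightarrow> real) \<Rightarrow> nat \<Rightarrow> real" where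
    "\<phi> k y = (\<lambda>i. if i < 3 then if i = 0 then y 0 - 1/8 else
        if i = 1 then (y 2 + y 3) * cos (ang k y) else (y 2 + y 3) * sin (ang k y) else 0)" for k y
  have nx_angle: "cos (2 * pi * (real k + 1) / m) = cos (2 * pi * real (nx k) / m)"
      "sin (2 * pi * (real k + 1) / m) = sin (2 * pi * real (nx k) / m)" if "k < m" for k
  proof -
    have "real k + 1 = real m" if "Suc k = m" using that by auto
    then show "cos (2 * pi * (real k + 1) / m) = cos (2 * pi * real (nx k) / m)"
      "sin (2 * pi * (real k + 1) / m) = sin (2 * pi * real (nx k) / m)"
      using m(1) by (auto simp: nx_def add.commute)
  qed
  have phi_nx: "\<phi> (nx k) (y \<circ> swap23) = \<phi> k y" if "k < m" "y 2 = 0" for k y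
  proof (cases "y 3 = 0")
    case False
    have "ang k y = 2 * pi * (real k + 1) / m" "ang (nx k) (y \<circ> swap23) = 2 * pi * real (nx k) / m"
      using that(2) False swap23 by (auto simp: ang_def)
    then show ?thesis using nx_angle[OF that(1)] that(2) swap23 by (auto simp: \<phi>_def fun_eq_iff)
  qed (use that swap23 in \<open>auto simp: \<phi>_def fun_eq_iff\<close>)
  have P_swap: "y \<circ> swap23 \<in> P" if "y \<in> P" for y
    using P[OF that] that simplex3_permute[OF swap23(1), of y] swap23 by (auto simp: P_def)
  have G_next: "ca (nx k) = b" "ct (nx k) = \<sigma> \<circ> ct k \<circ> swap23"
    if "k < m" "G (ca k, ct k 2) = (b, \<sigma>)" for k b \<sigma>
    using nx(2)[OF that(1)] that(2) by (auto simp: turn_def flip_def cross_def ca_def ct_def)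
  have G_prev: "ca k = b" "ct k = \<sigma> \<circ> ct (nx k) \<circ> swap23"
    if "k < m" "G (ca (nx k), ct (nx k) 3) = (b, \<sigma>)" for k b \<sigma>
  proof -
    have "c k = cross (flip (c (nx k)))"
      using nx(2)[OF that(1)] cross_turn[OF C[of k]] cross_facts(2)[OF C[of k]] by metis
    moreover have "cross (flip (c (nx k))) = (b, \<sigma> \<circ> (ct (nx k) \<circ> swap23))"
      using that(2) swap23 by (simp add: cross_def flip_def ca_def ct_def)
    ultimately show "ca k = b" "ct k = \<sigma> \<circ> ct (nx k) \<circ> swap23" by (auto simp: ca_def ct_def o_assoc)
  qed
  have q_next: "q (ca k, y \<circ> inv_into UNIV (ct k)) = q (ca (nx k), (y \<circ> swap23) \<circ> inv_into UNIV (ct (nx k)))"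
    if "k < m" "y \<in> \<Delta>" "y 2 = 0" for k y
  proof -
    obtain b \<sigma> where G: "G (ca k, ct k 2) = (b, \<sigma>)" by fastforce
    have le: "ct k 2 \<le> 3" using permutes_le3[OF cat(2)] by simp
    note p = pairingD[OF G cat(1) le]
    have "y \<circ> inv_into UNIV (ct k) \<in> \<Delta>" using that(2) simplex3_permute[OF permutes_inv[OF cat(2)]] by simp
    moreover have "(y \<circ> inv_into UNIV (ct k)) (ct k 2) = 0" using that(3) permutes_inverses[OF cat(2)] by simp
    ultimately have "q (ca k, y \<circ> inv_into UNIV (ct k)) = q (b, y \<circ> inv_into UNIV (ct k) \<circ> inv_into UNIV \<sigma>)"
      using q_glued(1)[OF cat(1) _ le _ G] by blast
    moreover have "inv_into UNIV (ct (nx k)) = swap23 \<circ> (inv_into UNIV (ct k) \<circ> inv_into UNIV \<sigma>)"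
      unfolding G_next(2)[OF that(1) G]
      using o_inv_distrib[OF bij_comp[OF permutes_bij[OF cat(2)[of k]] permutes_bij[OF p(2)]] permutes_bij[OF swap23(1)]]
        o_inv_distrib[OF permutes_bij[OF p(2)] permutes_bij[OF cat(2)[of k]]] swap23(3) by simp
    moreover have "(y \<circ> swap23) \<circ> (swap23 \<circ> (inv_into UNIV (ct k) \<circ> inv_into UNIV \<sigma>)) =
        y \<circ> inv_into UNIV (ct k) \<circ> inv_into UNIV \<sigma>"
      using fun_cong[OF swap23(2)] by (auto simp: fun_eq_iff)
    ultimately show ?thesis using G_next(1)[OF that(1) G] by simp
  qed
  have q_axis: "q (ca k, y \<circ> inv_into UNIV (ct k)) = q (ca 0, y \<circ> inv_into UNIV (ct 0))"
    if "k < m" "y \<in> \<Delta>" "y 2 = 0" "y 3 = 0" for k y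
    using that(1)
  proof (induction k)
    case (Suc k)
    have s: "y \<circ> swap23 = y" using that(3,4) by (auto simp: fun_eq_iff Transposition.transpose_def)
    have "nx k = Suc k" using Suc.prems by (simp add: nx_def)
    then have "q (ca k, y \<circ> inv_into UNIV (ct k)) = q (ca (Suc k), y \<circ> inv_into UNIV (ct (Suc k)))"
      using q_next[OF Suc_lessD[OF Suc.prems] that(2,3), unfolded s] by (simp only:)
    then show ?case using Suc.IH[OF Suc_lessD[OF Suc.prems]] by (simp only:)
  qed simp
  interpret corner_chart M n G q m ca ct P \<phi> 1 y0
  proof
    show "openin (top_of_set \<Delta>) P" unfolding P_def
      by (intro openin_open_Int open_Collect_conj open_coordinate_conditions)
    show "continuous_map (top_of_set P) (Euclidean_space 3) (\<phi> k)" for k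
    proof -
      have c: "continuous_on P (\<lambda>y. (y 2 + y 3) * h (2 * pi * (real k + y 3 / (y 2 + y 3)) / m))"
        if h: "h = sin \<or> h = cos" for h :: "real \<Rightarrow> real"
      proof -
        have "continuous_on UNIV (\<lambda>r. h (2 * pi * (real k + r) / m))" "\<bar>h (2 * pi * (real k + r) / m)\<bar> \<le> 1" for r
          using h m(1) by (auto intro!: continuous_intros)
        note pol = continuous_on_polar[OF this]
        have "continuous_on P (\<lambda>y. (y 2, y 3))" by (intro continuous_on_Pair continuous_on_coordinate)
        from continuous_on_compose2[OF pol this subset_UNIV] show ?thesis by simp
      qed
      have "continuous_on P (\<lambda>y. if i = 0 then y 0 - 1/8 else
        if i = 1 then (y 2 + y 3) * cos (ang k y) else (y 2 + y 3) * sin (ang k y))" for i :: nat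
        using c[of cos] c[of sin] unfolding ang_def
        by (cases "i = 0"; cases "i = 1") (auto intro!: continuous_on_diff continuous_on_coordinate)
      then show ?thesis
        unfolding \<phi>_def continuous_map_componentwise_Euclidean_space continuous_map_iff_continuous by blast
    qed
    show "y i = 1/8 \<longleftrightarrow> i < 1 \<and> \<phi> k y i = 0" if "y \<in> P" "i \<le> 3" for k y i
    proof -
      have "i = 0 \<or> i = 1 \<or> i = 2 \<or> i = 3" using that(2) by auto
      then show ?thesis using P[OF that(1)] by (auto simp: \<phi>_def)
    qed
    show "k = l" if h: "k < m" "l < m" "y \<in> P" "z \<in> P" "ca k = ca l"
      "y \<circ> inv_into UNIV (ct k) = z \<circ> inv_into UNIV (ct l)" for k l y z
    proof -
      \<comment> \<open>The two largest coordinates in \<open>P\<close> are those at positions \<open>1\<close> and \<open>0\<close>, in this order, so they are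
        recognised in both listings. The listings agree or differ by a flip, and flips do not occur.\<close>
      define \<rho> where "\<rho> = inv_into UNIV (ct k) \<circ> ct l"
      have rho: "\<rho> permutes {..3}" unfolding \<rho>_def by (rule permutes_compose[OF cat(2) permutes_inv[OF cat(2)]])
      have ctl: "ct l = ct k \<circ> \<rho>" using permutes_inverses[OF cat(2)] by (auto simp: \<rho>_def fun_eq_iff)
      have z: "z i = y (\<rho> i)" for i
        using fun_cong[OF h(6), of "ct l i"] permutes_inverses[OF cat(2)] by (simp add: \<rho>_def)
      have inj: "\<rho> i = \<rho> j \<longleftrightarrow> i = j" for i j using permutes_inj[OF rho] by (auto simp: inj_def)
      have le: "\<rho> i = 0 \<or> \<rho> i = 1 \<or> \<rho> i = 2 \<or> \<rho> i = 3" if "i \<le> 3" for i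
      proof -
        have "\<rho> i \<le> 3" using permutes_le3[OF rho] that by simp
        then show ?thesis by auto
      qed
      have onto: "\<exists>j. (j = 0 \<or> j = 1 \<or> j = 2 \<or> j = 3) \<and> \<rho> j = i" if "i \<le> 3" for i
      proof -
        have "inv_into UNIV \<rho> i \<le> 3" "\<rho> (inv_into UNIV \<rho> i) = i"
          using permutes_le3[OF permutes_inv[OF rho]] permutes_inverses[OF rho] that by auto
        moreover from this(1) have "inv_into UNIV \<rho> i = 0 \<or> inv_into UNIV \<rho> i = 1 \<or>
            inv_into UNIV \<rho> i = 2 \<or> inv_into UNIV \<rho> i = 3" by auto
        ultimately show ?thesis by blast
      qed
      have r1: "\<rho> 1 = 1"
      proof -
        obtain j where j: "j = 0 \<or> j = 1 \<or> j = 2 \<or> j = 3" "\<rho> j = 1" using onto[of 1] by auto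
        have "y (\<rho> 1) \<le> y 1" using le[of 1] P(2-7)[OF h(3)] by auto
        then have "z 1 \<le> z j" using z[of 1] z[of j] j(2) by simp
        then have "j = 1" using j(1) P(2-7)[OF h(4)] by auto
        then show ?thesis using j(2) by simp
      qed
      have r0: "\<rho> 0 = 0"
      proof -
        obtain j where j: "j = 0 \<or> j = 1 \<or> j = 2 \<or> j = 3" "\<rho> j = 0" using onto[of 0] by auto
        have "\<rho> 0 \<noteq> 1" using inj[of 0 1] r1 by simp
        then have "y (\<rho> 0) \<le> y 0" using le[of 0] P(2-7)[OF h(3)] by auto
        then have "z 0 \<le> z j" using z[of 0] z[of j] j(2) by simp
        moreover have "j \<noteq> 1" using j(2) r1 by auto
        ultimately have "j = 0" using j(1) P(2-7)[OF h(4)] by auto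
        then show ?thesis using j(2) by simp
      qed
      have 1: "\<rho> 1 = 1 \<and> \<rho> 0 = 0" using r0 r1 by simp
      then have "\<rho> 2 = 2 \<and> \<rho> 3 = 3 \<or> \<rho> 2 = 3 \<and> \<rho> 3 = 2"
        using le[of 2] le[of 3] inj[of 0 2] inj[of 0 3] inj[of 1 2] inj[of 1 3] inj[of 2 3] by auto
      moreover have out: "\<rho> i = i" if "i > 3" for i using permutes_not_in[OF rho, of i] that by simp
      have ext: "\<rho> = \<rho>'" if "\<rho> 0 = \<rho>' 0" "\<rho> 1 = \<rho>' 1" "\<rho> 2 = \<rho>' 2" "\<rho> 3 = \<rho>' 3" "\<And>i. i > 3 \<Longrightarrow> \<rho>' i = i" for \<rho>'
      proof
        fix i show "\<rho> i = \<rho>' i"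
        proof (cases "i > 3")
          case False
          then have "i = 0 \<or> i = 1 \<or> i = 2 \<or> i = 3" by auto
          then show ?thesis using that by auto
        qed (use out that(5) in simp)
      qed
      ultimately have "\<rho> = id \<or> \<rho> = swap23"
      proof (elim disjE)
        assume "\<rho> 2 = 2 \<and> \<rho> 3 = 3"
        then have "\<rho> = id" using 1 by (intro ext) auto
        then show ?thesis ..
      next
        assume "\<rho> 2 = 3 \<and> \<rho> 3 = 2"
        then have "\<rho> = swap23" using 1 swap23 by (intro ext) (auto simp: Transposition.transpose_def)
        then show ?thesis ..
      qed
      then have "c l = c k \<or> c l = flip (c k)"
        using ctl h(5) by (auto simp: ca_def ct_def flip_def prod_eq_iff)
      moreover have "c l \<noteq> flip (c k)" unfolding c_def by (rule turn_pow_not_flip[OF c0])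
      ultimately have "c k = c l" by simp
      then show "k = l" unfolding c_def by (rule m(3)[OF h(1,2)])
    qed
    show "\<exists>l \<pi>. l < m \<and> ca l = b \<and> \<pi> permutes {..3} \<and> (\<forall>i<1. \<pi> i = i) \<and> ct l = \<sigma> \<circ> ct k \<circ> \<pi> \<and>
          y \<circ> \<pi> \<in> P \<and> \<phi> l (y \<circ> \<pi>) = \<phi> k y"
      if h: "k < m" "y \<in> P" "i \<le> 3" "y i = 0" "G (ca k, ct k i) = (b, \<sigma>)" for k y i b \<sigma>
    proof -
      have "0 < y 0" "0 < y 1" using P(1)[OF h(2), of 2] P(5,4)[OF h(2)] by linarith+
      then have "i \<noteq> 0 \<and> i \<noteq> 1" using h(4) by (metis less_irrefl)
      then consider "i = 2" | "i = 3" using h(3) by fastforce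
      then show ?thesis
      proof cases
        case 1
        show ?thesis
        proof (intro exI conjI)
          show "nx k < m" by (rule nx(1)[OF h(1)])
          show "ca (nx k) = b" "ct (nx k) = \<sigma> \<circ> ct k \<circ> swap23"
            using G_next[OF h(1)] h(5) unfolding 1 by blast+
          show "\<phi> (nx k) (y \<circ> swap23) = \<phi> k y" by (rule phi_nx[OF h(1)]) (use h(4) 1 in simp)
        qed (use swap23 P_swap[OF h(2)] in auto)
      next
        case 2
        obtain l where l: "l < m" "nx l = k" using nx_onto[OF h(1)] by blast
        have "(y \<circ> swap23) \<circ> swap23 = y" using swap23(2) by (simp add: o_assoc[symmetric])
        moreover have "(y \<circ> swap23) 2 = 0" using 2 h(4) swap23 by simp
        ultimately have phi: "\<phi> l (y \<circ> swap23) = \<phi> k y" using phi_nx[OF l(1), of "y \<circ> swap23"] l(2) by simp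
        show ?thesis
        proof (intro exI conjI)
          show "l < m" by (rule l(1))
          show "ca l = b" "ct l = \<sigma> \<circ> ct k \<circ> swap23"
            using G_prev[OF l(1)] h(5) unfolding 2 l(2) by blast+
          show "\<phi> l (y \<circ> swap23) = \<phi> k y" by (rule phi)
        qed (use swap23 P_swap[OF h(2)] in auto)
      qed
    qed
    show "q (ca k, y \<circ> inv_into UNIV (ct k)) = q (ca l, z \<circ> inv_into UNIV (ct l))"
      if h: "k < m" "l < m" "y \<in> P" "z \<in> P" "\<phi> k y = \<phi> l z" for k l y z
    proof -
      define r where "r = y 2 + y 3"
      define r' where "r' = z 2 + z 3"
      have nn: "0 \<le> y 2" "0 \<le> y 3" "0 \<le> z 2" "0 \<le> z 3" "0 \<le> r" "0 \<le> r'"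
        using P(1)[OF h(3)] P(1)[OF h(4)] by (auto simp: r_def r'_def)
      have e0: "y 0 = z 0" using fun_cong[OF h(5), of 0] by (simp add: \<phi>_def)
      have e1: "r * cos (ang k y) = r' * cos (ang l z)" and e2: "r * sin (ang k y) = r' * sin (ang l z)"
        using fun_cong[OF h(5), of 1] fun_cong[OF h(5), of 2] by (auto simp: \<phi>_def r_def r'_def)
      have sq: "(s * cos b)\<^sup>2 + (s * sin b)\<^sup>2 = s\<^sup>2" for s b :: real
        by (simp add: power_mult_distrib distrib_left[symmetric])
      have "r\<^sup>2 = r'\<^sup>2" using sq[of r "ang k y"] sq[of r' "ang l z"] e1 e2 by simp
      then have rr: "r = r'" using nn by simp
      have sum: "y 0 + y 1 + y 2 + y 3 = 1" "z 0 + z 1 + z 2 + z 3 = 1"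
        using P(8)[OF h(3)] P(8)[OF h(4)] by (auto simp: simplex3_iff atMost_3)
      have y1: "y 1 = z 1" using sum e0 rr by (simp add: r_def r'_def)
      have eqI: "y = z" if "y 3 = z 3" by (rule simplex3_eqI[OF P(8)[OF h(3)] P(8)[OF h(4)] e0 y1]) (use that in simp)
      show ?thesis
      proof (cases "r = 0")
        case True
        then have z0: "y 2 = 0" "y 3 = 0" "z 2 = 0" "z 3 = 0" using nn rr by (auto simp: r_def r'_def)
        then have "y = z" by (intro eqI) simp
        then show ?thesis using q_axis[OF h(1) P(8)[OF h(3)]] q_axis[OF h(2) P(8)[OF h(3)]] z0 by simp
      next
        case False
        define f where "f = y 3 / r"
        define f' where "f' = z 3 / r"
        have f: "0 \<le> f" "f \<le> 1" "0 \<le> f'" "f' \<le> 1" "y 3 = f * r" "z 3 = f' * r"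
          using nn False rr by (auto simp: f_def f'_def r_def r'_def divide_simps)
        have "cos (ang k y) = cos (ang l z)" "sin (ang k y) = sin (ang l z)" using e1 e2 rr False by auto
        moreover have "ang k y = 2 * pi * (real k + f) / m" "ang l z = 2 * pi * (real l + f') / m"
          using rr by (auto simp: ang_def f_def f'_def r_def r'_def)
        moreover have "real k + f \<le> m" "real l + f' \<le> m" using f h(1,2) by linarith+
        ultimately have "real k + f = real l + f' \<or> real k + f = 0 \<and> real l + f' = m \<or> real k + f = m \<and> real l + f' = 0"
          using f m(1) by (intro same_angle) auto
        then have "k = l \<and> f = f' \<or> f = 1 \<and> f' = 0 \<and> l = nx k \<or> f = 0 \<and> f' = 1 \<and> k = nx l"
          using nx_adjacent[OF h(1,2) f(1-4)] by blast
        then consider "k = l" "f = f'" | "f = 1" "f' = 0" "l = nx k" | "f = 0" "f' = 1" "k = nx l" by blast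
        then show ?thesis
        proof cases
          case 1
          then have "y = z" using f by (intro eqI) simp
          then show ?thesis using 1 by simp
        next
          case 2
          have v: "y 3 = r" "z 3 = 0" "y 2 = 0" "z 2 = r" using 2 f rr by (auto simp: r_def r'_def)
          have "y \<circ> swap23 = z"
            using v e0 y1 swap23 simplex3_permute[OF swap23(1), of y] P(8)[OF h(3)] P(8)[OF h(4)]
            by (intro simplex3_eqI) auto
          then show ?thesis using q_next[OF h(1) P(8)[OF h(3)] v(3)] 2(3) by simp
        next
          case 3
          have v: "z 3 = r" "y 3 = 0" "z 2 = 0" "y 2 = r" using 3 f rr by (auto simp: r_def r'_def)
          have "z \<circ> swap23 = y"
            using v e0 y1 swap23 simplex3_permute[OF swap23(1), of z] P(8)[OF h(3)] P(8)[OF h(4)]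
            by (intro simplex3_eqI) auto
          then show ?thesis using q_next[OF h(2) P(8)[OF h(4)] v(3)] 3(3) by simp
        qed
      qed
    qed
    have "y0 0 + y0 1 + y0 2 + y0 3 = 1" using y0 by (simp add: simplex3_iff atMost_3)
    then show "y0 \<in> P" using y0 y0_values by (auto simp: P_def)
    show "\<phi> 0 y0 = (\<lambda>_. 0)" using y0_values by (auto simp: \<phi>_def)
  qed (use cat m in auto)
  show ?thesis using crossing_chart_exists by (simp add: ca_def ct_def c_def)
qed

lemma transverse: "transverse_immersion sheet_space M fst"
  unfolding transverse_immersion_def
proof (intro conjI ballI)
  show "continuous_map sheet_space M fst" by (rule continuous_fst_sheet_space)
  fix p assume p: "p \<in> topspace M"
  show "\<exists>U \<phi> k W. crossing_chart sheet_space M fst p U \<phi> k W"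
  proof (cases "p \<in> surface")
    case False
    have "openin M (topspace M - surface)" using closedin_surface by blast
    moreover have "p \<in> topspace M - surface" using p False by simp
    ultimately obtain U \<phi> where U: "openin M U" "U \<subseteq> topspace M - surface" "p \<in> U"
      "homeomorphic_map (subtopology M U) (Euclidean_space 3) \<phi>" "\<phi> p = (\<lambda>_. 0)"
      by (rule centred_chart[OF manifold]) (rule that)
    have "fst s \<notin> U" if "s \<in> topspace sheet_space" for s
      using that U(2) surface_eq by (auto simp: topspace_sheet_space)
    then have "crossing_chart sheet_space M fst p U \<phi> 0 (\<lambda>_. {})"
      using U by (auto simp: crossing_chart_def disjoint_family_on_def)
    then show ?thesis by blast
  next
    case True
    then obtain u where u: "u \<in> {..<n} \<times> \<Delta>" "level u" "p = q u" by (auto simp: surface_def)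
    define a x where "a = fst u" and "x = snd u"
    have ax: "a < n" "x \<in> \<Delta>" "p = q (a, x)" "\<exists>j\<le>3. x j = 1/8"
      using u by (auto simp: a_def x_def level_def)
    obtain \<tau> d e where t: "\<tau> permutes {..3}" "1 \<le> d" "d < e" "e \<le> 4" "d \<le> 3"
      "\<And>i. i \<le> 3 \<Longrightarrow> x (\<tau> i) = 1/8 \<longleftrightarrow> i < d" "\<And>i. i \<le> 3 \<Longrightarrow> x (\<tau> i) = 0 \<longleftrightarrow> e \<le> i"
      by (rule sorted_coordinates[OF ax(2,4)]) (rule that)
    define y0 where "y0 = x \<circ> \<tau>"
    have y0: "y0 \<in> \<Delta>" using simplex3_permute[OF t(1)] ax(2) by (simp add: y0_def)
    have y: "y0 i = 1/8 \<longleftrightarrow> i < d" "y0 i = 0 \<longleftrightarrow> e \<le> i" if "i \<le> 3" for i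
      using t(6,7)[OF that] by (auto simp: y0_def)
    have "y0 \<circ> inv_into UNIV \<tau> = x" using permutes_inverses[OF t(1)] by (auto simp: y0_def fun_eq_iff)
    then have p_eq: "p = q (a, y0 \<circ> inv_into UNIV \<tau>)" using ax(3) by simp
    consider "e = 4" | "e = 3" | "e = 2" "d = 1" using t(2-5) by linarith
    then show ?thesis
    proof cases
      case 1
      have "\<exists>U \<psi> W. crossing_chart sheet_space M fst p U \<psi> d W" unfolding p_eq
        by (rule chart_interior[OF ax(1) t(1) y0 t(5) y(1)]) (use y(2) 1 in auto)
      then show ?thesis by blast
    next
      case 2
      have "\<exists>U \<psi> W. crossing_chart sheet_space M fst p U \<psi> d W" unfolding p_eq
        by (rule chart_face[OF ax(1) t(1) y0 _ y(1)]) (use y(2) 2 t(3) in auto)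
      then show ?thesis by blast
    next
      case 3
      have "\<exists>U \<psi> W. crossing_chart sheet_space M fst p U \<psi> 1 W" unfolding p_eq
        by (rule chart_edge[OF ax(1) t(1) y0]) (use y[of 0] y[of 2] y[of 3] 3 in auto)
      then show ?thesis by blast
    qed
  qed
qed

text \<open>
  The sheets of a crossing chart are open in the surface and homeomorphic to planes.
\<close>

lemma closed_surface: "closed_manifold 2 sheet_space"
  unfolding closed_manifold_def
proof (intro conjI ballI sheet_space_properties)
  fix s assume s: "s \<in> topspace sheet_space"
  then have "fst s \<in> topspace M" using sheet_points_subset by (auto simp: topspace_sheet_space)
  then obtain U \<phi> k W where ch: "crossing_chart sheet_space M fst (fst s) U \<phi> k W"
    using transverse by (auto simp: transverse_immersion_def)
  then have "s \<in> (\<Union>i<k. W i)" using s by (auto simp: crossing_chart_def)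
  then obtain i where i: "i < k" "s \<in> W i" by auto
  have W: "openin sheet_space (W i)" "homeomorphic_map (subtopology sheet_space (W i))
          (subtopology (Euclidean_space 3) {x. x i = 0}) (\<phi> \<circ> fst)" "i < 3"
    using ch i(1) by (auto simp: crossing_chart_def)
  have "subtopology sheet_space (W i) homeomorphic_space Euclidean_space 2"
    using homeomorphic_space_trans[OF homeomorphic_map_imp_homeomorphic_space[OF W(2)] coordinate_plane_homeomorphic[OF W(3)]] .
  then show "\<exists>U. openin sheet_space U \<and> s \<in> U \<and> subtopology sheet_space U homeomorphic_space Euclidean_space 2"
    using W(1) i(2) by blast
qed

section \<open>The bound\<close>

lemma surface_complexity_le: "surface_complexity M \<le> enat (4 * n)"
proof -
  obtain S :: "real topology" and f where S: "dehn_surface M S f (fst ` topspace sheet_space)"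
    "triple_points S f = triple_points sheet_space fst"
    by (rule closed_surface_on_reals[OF closed_surface transverse])
  have "fst ` topspace sheet_space = surface" using surface_eq by (simp add: topspace_sheet_space)
  then have "surface_complexity M \<le> enat (card (triple_points S f))"
    unfolding surface_complexity_def using S(1) quasi_filling_surface by (intro Inf_lower) auto
  also have "\<dots> \<le> enat (4 * n)" using S(2) card_triple_points by simp
  finally show ?thesis .
qed

end

theorem theorem11:
  fixes M :: "'a topology" and n :: nat
  assumes "closed_manifold 3 M" and "connected_space M"
    and "has_triangulation M n"
  shows "surface_complexity M \<le> enat (4 * n)"
proof -
  obtain G q where Gq: "face_pairing n G" "quotient_map (tetrahedra n) M q"
    "\<forall>u \<in> topspace (tetrahedra n). \<forall>v \<in> topspace (tetrahedra n). q u = q v \<longleftrightarrow> equivclp (glued_points n G) u v"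
    using assms(3) unfolding has_triangulation_def by blast
  interpret triangulation M n G q
    by unfold_locales (use assms(1) Gq in auto)
  show ?thesis by (rule surface_complexity_le)
qed

end
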